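(* Let $\ell\in\mathbb{Z}_+$, let $\varepsilon^{1/2}$ be a primitive $\ell$-th root of unity, let $\Bbbk$ be a field extension of $\mathbb{Q}(\varepsilon^{1/2})$, and let $(M_\varepsilon,\tilde B)$ be a root of unity quantum seed over $\Bbbk$. Assume that $\ell$ is odd and coprime to the skew-symmetrizing integers $d_j$ ($j\in\mathbf{ex}$) for the principal part of $\tilde B$. If the root of unity upper quantum cluster algebra $\mathbf{U}_\varepsilon(M_\varepsilon,\tilde B,\mathbf{inv})$ is a finitely generated $\Bbbk$-algebra, then the upper cluster algebra $\mathbf{U}(\tilde B,\mathbf{inv})_{\Bbbk}$ is a finitely generated $\Bbbk$-algebra.
   Context: Fix $N\in\mathbb{Z}_+$, a set $\mathbf{ex}\subseteq[1,N]$ of exchangeable indices and a set $\mathbf{inv}\subseteq[1,N]\setminus\mathbf{ex}$ (frozen indices to be inverted). An exchange matrix is $\tilde B=(b_{ij})\in M_{N\times\mathbf{ex}}(\mathbb{Z})$ whose $\mathbf{ex}\times\mathbf{ex}$ submatrix $B$ (principal part) is such that $DB$ is skew-symmetric for some $D=\mathrm{diag}(d_j,j\in\mathbf{ex})$, $d_j\in\mathbb{Z}_+$. For $k\in\mathbf{ex}$, $\mu_k(\tilde B)=(b'_{ij})$ with $b'_{ij}=-b_{ij}$ if $i=k$ or $j=k$, and $b'_{ij}=b_{ij}+\frac{|b_{ik}|b_{kj}+b_{ik}|b_{kj}|}{2}$ otherwise. **Classical upper cluster algebra.** Let $\mathcal{F}$ be a purely transcendental extension of degree $N$ of (the fraction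 field of) $\Bbbk$. A seed is $(\tilde{\mathbf{x}},\tilde B)$ with $\tilde{\mathbf{x}}=\{x_1,\dots,x_N\}$ a transcendence basis of $\mathcal{F}$ (generating it) and $\tilde B$ an exchange matrix. Mutation at $k\in\mathbf{ex}$ replaces $\tilde B$ by $\mu_k(\tilde B)$ and $x_k$ by $x_k'$ with $x_kx_k'=\prod_{b_{ik}>0}x_i^{b_{ik}}+\prod_{b_{ik}<0}x_i^{-b_{ik}}$. Then $\mathbf{U}(\tilde B,\mathbf{inv})_\Bbbk$ is the intersection, over all seeds $(\tilde{\mathbf{x}}'',\tilde B'')$ obtained from $(\tilde{\mathbf{x}},\tilde B)$ by sequences of mutations, of the rings $\Bbbk[(x''_i)^{\pm1},x''_j;\ i\in\mathbf{ex}\sqcup\mathbf{inv},\ j\notin\mathbf{ex}\sqcup\mathbf{inv}]$. **Root of unity upper quantum cluster algebra.** For a skew-symmetric bicharacter $\Lambda:\mathbb{Z}^N\times\mathbb{Z}^N\to\mathbb{Z}/\ell$ (identified with its matrix), the quantum torus $\mathcal{T}_\varepsilon(\Lambda)$ is the $\Bbbk[\varepsilon^{1/2}]$-algebra with basis $\{X^f\mid f\in\mathbb{Z}^N\}$ and product $X^fX^g=\varepsilon^{\Lambda(f,g)/2}X^{f+g}$. A root of unity toric frame of a division algebra $\mathcal{F}_\varepsilon$ is a map $M_\varepsilon:\mathbb{Z}^N\to\mathcal{F}_\varepsilon$ for which there is such a $\Lambda$ (the matrix $\Lambda_{M_\varepsilon}$ of the frame) so that $X^f\mapsto M_\varepsilon(f)$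 is an algebra embedding $\mathcal{T}_\varepsilon(\Lambda)\hookrightarrow\mathcal{F}_\varepsilon$ and $\mathcal{F}_\varepsilon$ is the division ring of fractions of the image. The mixed quantum torus $\mathcal{T}_\varepsilon(M_\varepsilon)_\ge$ is the span of the $M_\varepsilon(f)$ with $f_j\ge0$ for all $j\notin\mathbf{ex}\sqcup\mathbf{inv}$. A root of unity quantum seed is a pair $(M_\varepsilon,\tilde B)$ such that, for some diagonal matrix $D=\mathrm{diag}(d_j,j\in\mathbf{ex})$ with $d_j\in\mathbb{Z}_+$ and $DB$ skew-symmetric ($B$ being the principal part of $\tilde B$), the $(i,j)$ entry of $\Lambda_{M_\varepsilon}^\top\tilde B$ modulo $\ell$ equals $d_j$ if $i=j$ and $0$ otherwise ($i\in[1,N]$, $j\in\mathbf{ex}$); the $d_j$ in the claim are the diagonal entries of this $D$. Its mutation at $k\in\mathbf{ex}$ is $(\mu_k(M_\varepsilon),\mu_k(\tilde B))$, where $\mu_k(M_\varepsilon)$ is the toric frame with $\mu_k(M_\varepsilon)(e_i)=M_\varepsilon(e_i)$ for $i\ne k$ and $\mu_k(M_\varepsilon)(e_k)=M_\varepsilon(-e_k+[b^k]_+)+M_\varepsilon(-e_k-[b^k]_-)$; here $b^k$ is the $k$-th column of $\tilde B$, and $[c]_+$, $[c]_-$ are the parts of $c\in\mathbb{Z}^N$ with nonnegative, resp. nonpositive, coordinates. (Its matrix $\Lambda'$ satisfies $\Lambda'(e_i,e_j)=\Lambda(e_i,e_j)$ and $\Lambda'(e_i,e_k)=\Lambda(e_i,-e_k+[b^k]_+)$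 for $i,j\neq k$.) Then $\mathbf{U}_\varepsilon(M_\varepsilon,\tilde B,\mathbf{inv})$ is the intersection of $\mathcal{T}_\varepsilon(M''_\varepsilon)_\ge$ over all seeds $(M''_\varepsilon,\tilde B'')$ obtained from $(M_\varepsilon,\tilde B)$ by sequences of mutations. *)

theory Defs
  imports
    "HOL-Analysis.Finite_Cartesian_Product"
    "HOL-Library.Poly_Mapping"
    "HOL-Number_Theory.Cong"
begin

(* The index set [1,N] is the finite type 'n, Z^N is int^'n with standard basis axis i 1.
   The square root eps^(1/2) is written q throughout. *)

section \<open>Algebras over a field\<close>

locale algebra_over = vector_space sc
  for sc :: "'k::field \<Rightarrow> 'a::ring_1 \<Rightarrow> 'a" +
  assumes sc_mult_left: "sc c x * y = sc c (x * y)"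
    and sc_mult_right: "x * sc c y = sc c (x * y)"

definition is_subalgebra :: "('k::field \<Rightarrow> 'a::ring_1 \<Rightarrow> 'a) \<Rightarrow> 'a set \<Rightarrow> bool" where
  "is_subalgebra sc S \<longleftrightarrow> 1 \<in> S \<and> (\<forall>x\<in>S. \<forall>y\<in>S. x + y \<in> S \<and> x * y \<in> S)
     \<and> (\<forall>c. \<forall>x\<in>S. sc c x \<in> S)"

definition finitely_generated_algebra :: "('k::field \<Rightarrow> 'a::ring_1 \<Rightarrow> 'a) \<Rightarrow> 'a set \<Rightarrow> bool" where
  "finitely_generated_algebra sc A \<longleftrightarrow> (\<exists>S. finite S \<and> is_subalgebra sc hull S = A)"

definition is_intermediate_field :: "('k::field \<Rightarrow> 'f::field \<Rightarrow> 'f) \<Rightarrow> 'f set \<Rightarrow> bool" where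
  "is_intermediate_field sc K \<longleftrightarrow> is_subalgebra sc K \<and> (\<forall>x\<in>K. inverse x \<in> K)"

definition primitive_root_of_unity :: "nat \<Rightarrow> 'k::field \<Rightarrow> bool" where
  "primitive_root_of_unity l q \<longleftrightarrow> l > 0 \<and> q ^ l = 1 \<and> (\<forall>m. 0 < m \<and> m < l \<longrightarrow> q ^ m \<noteq> 1)"

section \<open>Exchange matrices\<close>

(* An N x ex matrix is an N x N matrix of which only the columns in ex are ever used;
   its other columns are arbitrary and play no role. *)

definition skew_symmetrizer :: "'n::finite set \<Rightarrow> ('n \<Rightarrow> nat) \<Rightarrow> int^'n^'n \<Rightarrow> bool" where
  "skew_symmetrizer ex d B \<longleftrightarrow> (\<forall>j\<in>ex. d j > 0)
     \<and> (\<forall>i\<in>ex. \<forall>j\<in>ex. int (d i) * B$i$j = - (int (d j) * B$j$i))"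

definition exchange_matrix :: "'n::finite set \<Rightarrow> int^'n^'n \<Rightarrow> bool" where
  "exchange_matrix ex B \<longleftrightarrow> (\<exists>d. skew_symmetrizer ex d B)"

(* The division by 2 is exact. *)
definition mutate_matrix :: "'n::finite \<Rightarrow> int^'n^'n \<Rightarrow> int^'n^'n" where
  "mutate_matrix k B = (\<chi> i j. if i = k \<or> j = k then - B$i$j
     else B$i$j + (\<bar>B$i$k\<bar> * B$k$j + B$i$k * \<bar>B$k$j\<bar>) div 2)"

section \<open>Upper cluster algebras\<close>

(* Polynomials in the variables indexed by 'n are finitely supported functions on exponents. *)
definition eval_mpoly ::
  "('k::field \<Rightarrow> 'f::field \<Rightarrow> 'f) \<Rightarrow> ('n::finite \<Rightarrow> 'f) \<Rightarrow> (('n \<Rightarrow>\<^sub>0 nat) \<Rightarrow>\<^sub>0 'k) \<Rightarrow> 'f" where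
  "eval_mpoly sc x p = (\<Sum>m\<in>Poly_Mapping.keys p. sc (Poly_Mapping.lookup p m) (\<Prod>i\<in>UNIV. x i ^ Poly_Mapping.lookup m i))"

definition algebraically_independent ::
  "('k::field \<Rightarrow> 'f::field \<Rightarrow> 'f) \<Rightarrow> ('n::finite \<Rightarrow> 'f) \<Rightarrow> bool" where
  "algebraically_independent sc x \<longleftrightarrow> (\<forall>p. eval_mpoly sc x p = 0 \<longrightarrow> p = 0)"

(* The condition on the ambient field to be purely transcendental of degree N over the base
   field is the existence of such a generating family. *)
definition cluster_seed ::
  "('k::field \<Rightarrow> 'f::field \<Rightarrow> 'f) \<Rightarrow> 'n::finite set \<Rightarrow> ('n \<Rightarrow> 'f) \<times> (int^'n^'n) \<Rightarrow> bool" where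
  "cluster_seed sc ex = (\<lambda>(x, B). algebraically_independent sc x
     \<and> is_intermediate_field sc hull (range x) = UNIV \<and> exchange_matrix ex B)"

definition mutate_cluster ::
  "'n::finite \<Rightarrow> int^'n^'n \<Rightarrow> ('n \<Rightarrow> 'f::field) \<Rightarrow> ('n \<Rightarrow> 'f)" where
  "mutate_cluster k B x = x(k :=
     ((\<Prod>i | B$i$k > 0. x i ^ nat (B$i$k)) + (\<Prod>i | B$i$k < 0. x i ^ nat (- B$i$k))) / x k)"

definition seed_mutation ::
  "'n::finite set \<Rightarrow> ('n \<Rightarrow> 'f::field) \<times> (int^'n^'n) \<Rightarrow> ('n \<Rightarrow> 'f) \<times> (int^'n^'n) \<Rightarrow> bool" where
  "seed_mutation ex = (\<lambda>(x, B) (x', B'). \<exists>k\<in>ex. x' = mutate_cluster k B x \<and> B' = mutate_matrix k B)"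

definition mixed_laurent_ring ::
  "('k::field \<Rightarrow> 'f::field \<Rightarrow> 'f) \<Rightarrow> 'n::finite set \<Rightarrow> ('n \<Rightarrow> 'f) \<Rightarrow> 'f set" where
  "mixed_laurent_ring sc units x =
     is_subalgebra sc hull (range x \<union> (\<lambda>i. inverse (x i)) ` units)"

definition upper_cluster_algebra ::
  "('k::field \<Rightarrow> 'f::field \<Rightarrow> 'f) \<Rightarrow> 'n::finite set \<Rightarrow> 'n set
     \<Rightarrow> ('n \<Rightarrow> 'f) \<Rightarrow> int^'n^'n \<Rightarrow> 'f set" where
  "upper_cluster_algebra sc ex invt x B =
     \<Inter> {mixed_laurent_ring sc (ex \<union> invt) x' | x' B'. (seed_mutation ex)\<^sup>*\<^sup>* (x, B) (x', B')}"

section \<open>Root of unity quantum tori and toric frames\<close>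

(* A bicharacter with values in Z/l is given by an integer lift L of its matrix;
   L matters only modulo l. *)

definition bichar :: "int^'n^'n \<Rightarrow> int^'n \<Rightarrow> int^'n \<Rightarrow> int" where
  "bichar L f g = (\<Sum>i\<in>UNIV. \<Sum>j\<in>UNIV. f$i * L$i$j * g$j)"

definition skew_mod :: "nat \<Rightarrow> int^'n^'n \<Rightarrow> bool" where
  "skew_mod l L \<longleftrightarrow> (\<forall>i j. [L$i$j = - L$j$i] (mod int l))"

(* The quantum torus: finitely supported functions on Z^N, where single f 1 is X^f, with the
   twisted product X^f X^g = q^(L(f,g)) X^(f+g). *)
definition qtorus_mult ::
  "'k::field \<Rightarrow> int^'n^'n \<Rightarrow> ((int^'n) \<Rightarrow>\<^sub>0 'k) \<Rightarrow> ((int^'n) \<Rightarrow>\<^sub>0 'k) \<Rightarrow> ((int^'n) \<Rightarrow>\<^sub>0 'k)" where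
  "qtorus_mult q L a b = (\<Sum>f\<in>Poly_Mapping.keys a. \<Sum>g\<in>Poly_Mapping.keys b.
     Poly_Mapping.single (f + g) (Poly_Mapping.lookup a f * Poly_Mapping.lookup b g * q powi bichar L f g))"

definition frame_extension ::
  "('k::field \<Rightarrow> 'd::division_ring \<Rightarrow> 'd) \<Rightarrow> (int^'n \<Rightarrow> 'd) \<Rightarrow> ((int^'n) \<Rightarrow>\<^sub>0 'k) \<Rightarrow> 'd" where
  "frame_extension sc M a = (\<Sum>f\<in>Poly_Mapping.keys a. sc (Poly_Mapping.lookup a f) (M f))"

(* The last condition: the ambient division ring is the division ring of (right) fractions of the
   image, which is an Ore domain. *)
definition toric_frame ::
  "('k::field \<Rightarrow> 'd::division_ring \<Rightarrow> 'd) \<Rightarrow> 'k \<Rightarrow> nat \<Rightarrow> int^'n^'n \<Rightarrow> (int^'n \<Rightarrow> 'd) \<Rightarrow> bool" where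
  "toric_frame sc q l L M \<longleftrightarrow> skew_mod l L
     \<and> inj (frame_extension sc M)
     \<and> frame_extension sc M (Poly_Mapping.single 0 1) = 1
     \<and> (\<forall>a b. frame_extension sc M (qtorus_mult q L a b)
               = frame_extension sc M a * frame_extension sc M b)
     \<and> (\<forall>y. \<exists>a b. frame_extension sc M b \<noteq> 0
               \<and> y = frame_extension sc M a * inverse (frame_extension sc M b))"

definition mixed_quantum_torus ::
  "('k::field \<Rightarrow> 'd::division_ring \<Rightarrow> 'd) \<Rightarrow> 'n::finite set \<Rightarrow> (int^'n \<Rightarrow> 'd) \<Rightarrow> 'd set" where
  "mixed_quantum_torus sc units M =
     module.span sc {M f | f. \<forall>j. j \<notin> units \<longrightarrow> f$j \<ge> 0}"

section \<open>Root of unity upper quantum cluster algebras\<close>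

definition quantum_seed ::
  "('k::field \<Rightarrow> 'd::division_ring \<Rightarrow> 'd) \<Rightarrow> 'k \<Rightarrow> nat \<Rightarrow> 'n::finite set \<Rightarrow> ('n \<Rightarrow> nat)
     \<Rightarrow> (int^'n \<Rightarrow> 'd) \<times> (int^'n^'n) \<Rightarrow> bool" where
  "quantum_seed sc q l ex d = (\<lambda>(M, B). skew_symmetrizer ex d B \<and>
     (\<exists>L. toric_frame sc q l L M
        \<and> (\<forall>i. \<forall>j\<in>ex. [(transpose L ** B)$i$j = (if i = j then int (d j) else 0)] (mod int l))))"

definition pos_part :: "int^'n \<Rightarrow> int^'n" where
  "pos_part c = (\<chi> i. max (c$i) 0)"

definition neg_part :: "int^'n \<Rightarrow> int^'n" where
  "neg_part c = (\<chi> i. min (c$i) 0)"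

(* M' is the mutation of the frame M at k. The lifts L, L' are determined modulo l by M, M'
   when q is a primitive l-th root of unity. *)
definition frame_mutation ::
  "('k::field \<Rightarrow> 'd::division_ring \<Rightarrow> 'd) \<Rightarrow> 'k \<Rightarrow> nat \<Rightarrow> 'n::finite \<Rightarrow> int^'n^'n
     \<Rightarrow> (int^'n \<Rightarrow> 'd) \<Rightarrow> (int^'n \<Rightarrow> 'd) \<Rightarrow> bool" where
  "frame_mutation sc q l k B M M' \<longleftrightarrow> (\<exists>L L'.
     toric_frame sc q l L M \<and> toric_frame sc q l L' M'
     \<and> (\<forall>i j. i \<noteq> k \<longrightarrow> j \<noteq> k \<longrightarrow> [L'$i$j = L$i$j] (mod int l))
     \<and> (\<forall>i. i \<noteq> k \<longrightarrow>
          [L'$i$k = bichar L (axis i 1) (- axis k 1 + pos_part (column k B))] (mod int l))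
     \<and> (\<forall>i. i \<noteq> k \<longrightarrow> M' (axis i 1) = M (axis i 1))
     \<and> M' (axis k 1) = M (- axis k 1 + pos_part (column k B))
                       + M (- axis k 1 - neg_part (column k B)))"

definition quantum_seed_mutation ::
  "('k::field \<Rightarrow> 'd::division_ring \<Rightarrow> 'd) \<Rightarrow> 'k \<Rightarrow> nat \<Rightarrow> 'n::finite set
     \<Rightarrow> (int^'n \<Rightarrow> 'd) \<times> (int^'n^'n) \<Rightarrow> (int^'n \<Rightarrow> 'd) \<times> (int^'n^'n) \<Rightarrow> bool" where
  "quantum_seed_mutation sc q l ex = (\<lambda>(M, B) (M', B').
     \<exists>k\<in>ex. frame_mutation sc q l k B M M' \<and> B' = mutate_matrix k B)"

definition upper_quantum_cluster_algebra ::
  "('k::field \<Rightarrow> 'd::division_ring \<Rightarrow> 'd) \<Rightarrow> 'k \<Rightarrow> nat \<Rightarrow> 'n::finite set \<Rightarrow> 'n set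
     \<Rightarrow> (int^'n \<Rightarrow> 'd) \<Rightarrow> int^'n^'n \<Rightarrow> 'd set" where
  "upper_quantum_cluster_algebra sc q l ex invt M B =
     \<Inter> {mixed_quantum_torus sc (ex \<union> invt) M' | M' B'.
          (quantum_seed_mutation sc q l ex)\<^sup>*\<^sup>* (M, B) (M', B')}"

end

(* Write U_eps for the quantum upper cluster algebra and pi_M for the projection of a quantum torus
   onto the span of the M(l f). It is the normalised trace of the torus over its central subalgebra
   spanned by the M(l f).

   Since l is odd and coprime to the d_j, the l-th power of an exchange binomial M(u) + M(v) is
   M(l u) + M(l v). Hence the elements M(l e_i) mutate like classical cluster variables, and pi_M and
   pi_M' agree on the intersection of the tori of adjacent seeds. So pi = pi_M maps U_eps to itself,
   and pi(U_eps) is a copy of the classical upper cluster algebra under x_i -> M(l e_i).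

   It remains to see that the traces pi(U_eps) of a finitely generated U_eps are finitely generated.
   By Cayley-Hamilton an element satisfies a polynomial of degree n = l^N whose coefficients are
   polynomials in traces, so modulo the ideal generated by traces the augmentation ideal is nil of
   index n + 1. By Nagata-Higman every long word in the generators is a combination of shorter words
   with coefficients in the traces of shorter words; therefore the traces of the words of length less
   than 2^(n+1) generate all traces. *)

theory Submission
  imports Defs "Jordan_Normal_Form.Char_Poly" "HOL-Computational_Algebra.Formal_Power_Series"
begin

no_notation Matrix.vec_index (infixl "$" 100)

section \<open>Subspaces and the Nagata--Higman theorem\<close>

text \<open>The Artin-Tate lemma would settle finite generation of the traces if
  \<open>U_eps\<close> were a finite module over them. The nil index is n + 1 and not n because the
  augmentation ideal has no unit: the characteristic equation has to be multiplied by one more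
  factor. Relations among the generators destroy the grading by word length, so the argument runs
  over power series, where a generator a is replaced by a X. The trace becomes a matrix trace only
  after extension of scalars: the torus is expanded over the fraction field of its central
  subalgebra, realised as the image of the classical ambient field. The same embedding transports
  the generators at the end. Mutation of frames is a relation. If some mutated frame failed to
  exist, the intersection defining \<open>U_eps\<close> would omit seeds that have a classical
  counterpart, and pi(\<open>U_eps\<close>) could be too large. This is why the mutated toric frame
  is constructed explicitly, including its fractions.\<close>

context algebra_over
begin

lemma sc_eq_mult: "sc c x = sc c 1 * x" "sc c x = x * sc c 1"
  by (simp_all add: sc_mult_left sc_mult_right)

lemma sc_of_nat: "sc (of_nat n) x = of_nat n * x"
  by (induction n) (simp_all add: scale_left_distrib algebra_simps)

text \<open>Replacing \<open>c\<close> by \<open>2c\<close> in a polynomial expression and subtracting eliminates the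
  leading coefficient.\<close>

lemma coefficients_in_subspace:
  fixes y :: "nat \<Rightarrow> 'a"
  assumes char0: "\<And>m::nat. m > 0 \<Longrightarrow> (of_nat m :: 'k) \<noteq> 0"
    and J: "subspace J"
    and "\<And>c. (\<Sum>i\<le>n. sc (c ^ i) (y i)) \<in> J" "i \<le> n"
  shows "y i \<in> J"
  using assms(3,4)
proof (induction n arbitrary: y i)
  case 0
  have "sc (1 ^ 0) (y 0) \<in> J" using 0(1)[of 1] by simp
  then show ?case using 0 by simp
next
  case (Suc n)
  have *: "(2::'k) ^ i - 2 ^ Suc n \<noteq> 0" if "i \<le> n" for i
  proof -
    have "(2::nat) ^ i < 2 ^ Suc n" using that by (intro power_strict_increasing) auto
    then have "(of_nat (2 ^ Suc n - 2 ^ i) :: 'k) \<noteq> 0" by (intro char0) simp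
    then show ?thesis using \<open>(2::nat) ^ i < 2 ^ Suc n\<close> by (simp add: of_nat_diff)
  qed
  have low: "y i \<in> J" if i: "i \<le> n" for i
  proof -
    have "(\<Sum>i\<le>n. sc (c ^ i) (sc (2 ^ i - 2 ^ Suc n) (y i))) \<in> J" for c
    proof -
      have "(\<Sum>i\<le>Suc n. sc ((2 * c) ^ i) (y i)) - sc (2 ^ Suc n) (\<Sum>i\<le>Suc n. sc (c ^ i) (y i)) \<in> J"
        using Suc.prems(1)[of "2 * c"] Suc.prems(1)[of c] J
        by (intro subspace_diff) (auto intro: subspace_scale)
      also have "(\<Sum>i\<le>Suc n. sc ((2 * c) ^ i) (y i)) - sc (2 ^ Suc n) (\<Sum>i\<le>Suc n. sc (c ^ i) (y i))
         = (\<Sum>i\<le>Suc n. sc (c ^ i) (sc (2 ^ i - 2 ^ Suc n) (y i)))"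
        unfolding scale_sum_right sum_subtractf[symmetric]
        by (intro sum.cong refl)
          (simp add: scale_left_diff_distrib scale_right_diff_distrib power_mult_distrib mult.commute
            del: power_Suc)
      finally show ?thesis by simp
    qed
    from Suc.IH[OF this i] have "sc (2 ^ i - 2 ^ Suc n) (y i) \<in> J" .
    then have "sc (inverse (2 ^ i - 2 ^ Suc n)) (sc (2 ^ i - 2 ^ Suc n) (y i)) \<in> J"
      by (rule subspace_scale[OF J])
    then show ?thesis using *[OF i] by (simp del: power_Suc)
  qed
  have "(\<Sum>i\<le>Suc n. sc (1 ^ i) (y i)) - (\<Sum>i\<le>n. y i) \<in> J"
    by (intro subspace_diff[OF J] Suc.prems(1) subspace_sum[OF J, of "{..n}"] low) simp
  then have "y (Suc n) \<in> J" by simp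
  with low Suc.prems(2) show ?case by (cases "i = Suc n") auto
qed

text \<open>\<open>y i\<close> is the sum of all words with \<open>i\<close> letters
  \<open>b\<close> and \<open>m - i\<close> letters \<open>a\<close>, so it does not depend on
  \<open>c\<close>. The goal is \<open>y 1\<close>, the derivative of the power in direction
  \<open>b\<close>; \<open>y 0\<close> is carried along because the recursion for \<open>y 1\<close>
  uses it.\<close>

lemma power_add_scale_expansion:
  "\<exists>y. (\<forall>c. (a + sc c b) ^ m = (\<Sum>i\<le>m. sc (c ^ i) (y i)))
     \<and> (0 < m \<longrightarrow> y 1 = (\<Sum>i<m. a ^ i * b * a ^ (m - 1 - i))) \<and> y 0 = a ^ m"
proof (induction m)
  case 0
  show ?case by (rule exI[of _ "\<lambda>_. 1"]) simp
next
  case (Suc m)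
  then obtain y where y: "\<And>c. (a + sc c b) ^ m = (\<Sum>i\<le>m. sc (c ^ i) (y i))"
    "0 < m \<Longrightarrow> y 1 = (\<Sum>i<m. a ^ i * b * a ^ (m - 1 - i))" "y 0 = a ^ m" by blast
  \<comment> \<open>Multiplying by \<open>a + sc c b\<close> on the right appends \<open>a\<close>
    to a word with \<open>i\<close> letters \<open>b\<close>, or \<open>b\<close> to a word with
    \<open>i - 1\<close> of them. The guard cuts off \<open>y\<close> above degree \<open>m\<close>,
    where its values are arbitrary.\<close>
  define y' where "y' = (\<lambda>i. (if i \<le> m then y i * a else 0) + (if i = 0 then 0 else y (i - 1) * b))"
  have "(a + sc c b) ^ Suc m = (\<Sum>i\<le>Suc m. sc (c ^ i) (y' i))" for c
  proof -
    have "(a + sc c b) ^ Suc m = (\<Sum>i\<le>m. sc (c ^ i) (y i)) * a + (\<Sum>i\<le>m. sc (c ^ i) (y i)) * sc c b"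
      by (simp add: power_Suc2 y(1) distrib_left del: power_Suc)
    also have "(\<Sum>i\<le>m. sc (c ^ i) (y i)) * a = (\<Sum>i\<le>Suc m. sc (c ^ i) (if i \<le> m then y i * a else 0))"
      by (simp add: sum_distrib_right sc_mult_left)
    also have "(\<Sum>i\<le>m. sc (c ^ i) (y i)) * sc c b
        = (\<Sum>i\<le>Suc m. sc (c ^ i) (if i = 0 then 0 else y (i - 1) * b))"
      by (subst sum.atMost_Suc_shift)
        (simp add: sum_distrib_right sc_mult_left sc_mult_right mult.commute scale_sum_right)
    finally show ?thesis
      by (simp only: y'_def scale_right_distrib sum.distrib)
  qed
  moreover have "y' 1 = (\<Sum>i<Suc m. a ^ i * b * a ^ (Suc m - 1 - i))"
  proof (cases "m = 0")
    case True
    then show ?thesis using y(3) by (simp add: y'_def)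
  next
    case False
    have "(\<Sum>i<m. a ^ i * b * a ^ (m - 1 - i)) * a = (\<Sum>i<m. a ^ i * b * a ^ (m - i))"
      unfolding sum_distrib_right
    proof (intro sum.cong refl)
      fix i assume "i \<in> {..<m}"
      then have "m - i = Suc (m - 1 - i)" by simp
      then show "a ^ i * b * a ^ (m - 1 - i) * a = a ^ i * b * a ^ (m - i)"
        by (simp add: power_Suc2 mult.assoc del: power_Suc)
    qed
    then show ?thesis using False y(2,3) by (simp add: y'_def)
  qed
  moreover have "y' 0 = a ^ Suc m"
    using y(3) by (simp add: y'_def power_Suc2 del: power_Suc)
  ultimately show ?case by blast
qed

text \<open>\<open>P\<close> is a subspace, so the nil hypothesis holds for
  \<open>a + sc c b\<close> with every scalar \<open>c\<close>. Hence each coefficient in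
  \<open>c\<close> lies in \<open>J\<close>, and the linear one is this sum.\<close>

lemma nil_linearization:
  assumes char0: "\<And>m::nat. m > 0 \<Longrightarrow> (of_nat m :: 'k) \<noteq> 0"
    and P: "subspace P" and J: "subspace J"
    and nil: "\<And>a. a \<in> P \<Longrightarrow> a ^ Suc n \<in> J"
    and a: "a \<in> P" and b: "b \<in> P"
  shows "(\<Sum>i\<le>n. a ^ i * b * a ^ (n - i)) \<in> J"
proof -
  obtain y where y: "\<And>c. (a + sc c b) ^ Suc n = (\<Sum>i\<le>Suc n. sc (c ^ i) (y i))"
    "y 1 = (\<Sum>i<Suc n. a ^ i * b * a ^ (Suc n - 1 - i))"
    using power_add_scale_expansion[of a b "Suc n"] by blast
  have "(\<Sum>i\<le>Suc n. sc (c ^ i) (y i)) \<in> J" for c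
    unfolding y(1)[symmetric] using a b P by (intro nil) (auto intro: subspace_add subspace_scale)
  from coefficients_in_subspace[OF char0 J this, of 1] have "y 1 \<in> J" by simp
  then show ?thesis unfolding y(2) by (simp add: lessThan_Suc_atMost)
qed

text \<open>Higman's double sum \<open>S\<close> is evaluated in two ways. Summing over
  \<open>i\<close> first linearizes at \<open>a\<close> and gives \<open>S \<in> J\<close>. Summing
  over \<open>j\<close> first linearizes at \<open>b\<close> around \<open>a ^ (n - i)\<close>,
  which disposes of all \<open>i < n\<close>; the case \<open>i = n\<close> leaves
  \<open>n + 1\<close> copies of \<open>a ^ n * c * b ^ n\<close>.\<close>

lemma power_mult_power_in_ideal:
  assumes char0: "\<And>m::nat. m > 0 \<Longrightarrow> (of_nat m :: 'k) \<noteq> 0"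
    and P: "subspace P" and PP: "\<And>x y. x \<in> P \<Longrightarrow> y \<in> P \<Longrightarrow> x * y \<in> P"
    and J: "subspace J"
    and PJ: "\<And>x y. x \<in> P \<Longrightarrow> y \<in> J \<Longrightarrow> x * y \<in> J"
    and JP: "\<And>x y. x \<in> J \<Longrightarrow> y \<in> P \<Longrightarrow> x * y \<in> J"
    and nil: "\<And>a. a \<in> P \<Longrightarrow> a ^ Suc n \<in> J"
    and a: "a \<in> P" and b: "b \<in> P" and c: "c \<in> P"
  shows "a ^ n * c * b ^ n \<in> J"
proof -
  note lin = nil_linearization[OF char0 P J nil]
  have pow: "x ^ m \<in> P" if "x \<in> P" "m > 0" for x m
    using that(2)
  proof (induction m)
    case (Suc m) then show ?case using that(1) PP by (cases m) auto
  qed simp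
  \<comment> \<open>\<open>P\<close> need not contain 1, so exponent 0 is a separate case here and
    in the next two facts.\<close>
  have cpow: "c * b ^ m \<in> P" for m
    using pow[OF b, of m] PP[OF c] c by (cases m) auto
  have Jpow: "x * b ^ m \<in> J" if "x \<in> J" for x m
    using pow[OF b, of m] JP[OF that] that by (cases m) auto
  have powJ: "a ^ m * x \<in> J" if "x \<in> J" for x m
    using pow[OF a, of m] PJ[OF _ that] that by (cases m) auto
  define S where "S = (\<Sum>j\<le>n. \<Sum>i\<le>n. a ^ i * (c * b ^ j) * a ^ (n - i) * b ^ (n - j))"
  have "S = (\<Sum>j\<le>n. (\<Sum>i\<le>n. a ^ i * (c * b ^ j) * a ^ (n - i)) * b ^ (n - j))"
    by (simp add: S_def sum_distrib_right)
  also have "\<dots> \<in> J"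
    by (intro subspace_sum[OF J] Jpow lin a cpow)
  finally have SJ: "S \<in> J" .
  have "S = (\<Sum>i\<le>n. a ^ i * (c * (\<Sum>j\<le>n. b ^ j * a ^ (n - i) * b ^ (n - j))))"
    unfolding S_def by (subst sum.swap) (simp add: sum_distrib_left mult.assoc)
  also have "\<dots> = (\<Sum>i<n. a ^ i * (c * (\<Sum>j\<le>n. b ^ j * a ^ (n - i) * b ^ (n - j))))
      + a ^ n * (c * (\<Sum>j\<le>n. b ^ n))"
    by (simp add: lessThan_Suc_atMost[symmetric] power_add[symmetric] distrib_right add.commute)
  finally have S: "S = (\<Sum>i<n. a ^ i * (c * (\<Sum>j\<le>n. b ^ j * a ^ (n - i) * b ^ (n - j))))
      + a ^ n * (c * (\<Sum>j\<le>n. b ^ n))" .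
  have "(\<Sum>i<n. a ^ i * (c * (\<Sum>j\<le>n. b ^ j * a ^ (n - i) * b ^ (n - j)))) \<in> J"
    by (intro subspace_sum[OF J] powJ PJ[OF c] lin b pow a) auto
  from subspace_diff[OF J SJ this] have "a ^ n * (c * (\<Sum>j\<le>n. b ^ n)) \<in> J" unfolding S by simp
  also have "(\<Sum>j\<le>n. b ^ n) = sc (of_nat (Suc n)) (b ^ n)" by (subst sc_of_nat) simp
  finally have "sc (of_nat (Suc n)) (a ^ n * c * b ^ n) \<in> J"
    by (simp add: sc_mult_right mult.assoc del: of_nat_Suc)
  then have "sc (inverse (of_nat (Suc n))) (sc (of_nat (Suc n)) (a ^ n * c * b ^ n)) \<in> J"
    by (rule subspace_scale[OF J])
  then show ?thesis using char0[of "Suc n"] by (simp del: of_nat_Suc)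
qed

text \<open>Higman's induction: if \<open>x ^ Suc n \<in> J\<close> on \<open>P\<close>, then \<open>x * c * y \<in> J\<close> for products \<open>x\<close>, \<open>y\<close>
  of \<open>2 ^ n - 1\<close> factors, by the induction hypothesis for two transporter ideals in turn.\<close>

theorem nagata_higman:
  assumes char0: "\<And>m::nat. m > 0 \<Longrightarrow> (of_nat m :: 'k) \<noteq> 0"
    and P: "subspace P" and PP: "\<And>x y. x \<in> P \<Longrightarrow> y \<in> P \<Longrightarrow> x * y \<in> P"
    and "subspace J"
    and "\<And>x y. x \<in> P \<Longrightarrow> y \<in> J \<Longrightarrow> x * y \<in> J"
    and "\<And>x y. x \<in> J \<Longrightarrow> y \<in> P \<Longrightarrow> x * y \<in> J"
    and "\<And>a. a \<in> P \<Longrightarrow> a ^ n \<in> J"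
    and "set xs \<subseteq> P" "length xs = 2 ^ n - 1"
  shows "prod_list xs \<in> J"
  using assms(4-)
proof (induction n arbitrary: J xs)
  case 0
  \<comment> \<open>As \<open>0 ^ 0 = 1\<close>, the nil hypothesis for index 0 says that
    \<open>J\<close> contains the empty product.\<close>
  have "(0::'a) ^ 0 \<in> J" using 0(4)[of 0] subspace_0[OF P] by simp
  then show ?case using 0 by simp
next
  case (Suc n)
  note J = Suc.prems(1) and PJ = Suc.prems(2) and JP = Suc.prems(3) and nil = Suc.prems(4)
  note key = power_mult_power_in_ideal[OF char0 P PP J PJ JP nil]
  define J1 where "J1 = {x. \<forall>c\<in>P. \<forall>b\<in>P. x * c * b ^ n \<in> J}"
  have J1: "prod_list ys \<in> J1" if ys: "set ys \<subseteq> P" "length ys = 2 ^ n - 1" for ys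
  proof (rule Suc.IH[OF _ _ _ _ ys])
    show "subspace J1" unfolding subspace_def J1_def
      using J by (auto simp: distrib_right sc_mult_left intro: subspace_0 subspace_add subspace_scale)
    show "x * y \<in> J1" if "x \<in> P" "y \<in> J1" for x y
      using that PJ by (auto simp: J1_def mult.assoc)
    show "x * y \<in> J1" if "x \<in> J1" "y \<in> P" for x y
      unfolding J1_def
    proof (intro CollectI ballI)
      fix c b assume "c \<in> P" "b \<in> P"
      then have "x * (y * c) * b ^ n \<in> J" using that PP by (auto simp: J1_def)
      then show "x * y * c * b ^ n \<in> J" by (simp add: mult.assoc)
    qed
    show "a ^ n \<in> J1" if "a \<in> P" for a
      using that key by (auto simp: J1_def)
  qed
  \<comment> \<open>By the first round, a product of \<open>2 ^ n - 1\<close> factors lies in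
    \<open>J1\<close>, which means that \<open>prod_list ys * c * b ^ n \<in> J\<close>. This is the
    nil hypothesis \<open>b ^ n \<in> J2\<close> for the second round.\<close>
  define J2 where "J2 = {y. \<forall>ys. set ys \<subseteq> P \<longrightarrow> length ys = 2 ^ n - 1 \<longrightarrow> (\<forall>c\<in>P. prod_list ys * c * y \<in> J)}"
  have J2: "prod_list ys \<in> J2" if ys: "set ys \<subseteq> P" "length ys = 2 ^ n - 1" for ys
  proof (rule Suc.IH[OF _ _ _ _ ys])
    show "subspace J2" unfolding subspace_def J2_def
      using J by (auto simp: distrib_left sc_mult_right intro: subspace_0 subspace_add subspace_scale)
    show "x * y \<in> J2" if "x \<in> P" "y \<in> J2" for x y
      unfolding J2_def
    proof (intro CollectI allI impI ballI)
      fix ys c assume "set ys \<subseteq> P" "length ys = 2 ^ n - 1" "c \<in> P"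
      then have "prod_list ys * (c * x) * y \<in> J" using that PP by (auto simp: J2_def)
      then show "prod_list ys * c * (x * y) \<in> J" by (simp add: mult.assoc)
    qed
    show "x * y \<in> J2" if "x \<in> J2" "y \<in> P" for x y
      using that JP by (auto simp: J2_def mult.assoc[symmetric])
    show "a ^ n \<in> J2" if "a \<in> P" for a
      using that J1 by (auto simp: J2_def J1_def)
  qed
  \<comment> \<open>The count \<open>2 ^ Suc n - 1 = k + 1 + k\<close> splits the word into two long
    products around a single middle factor.\<close>
  define k where "k = (2::nat) ^ n - 1"
  have len: "length xs = k + Suc k"
  proof -
    have "0 < (2::nat) ^ n" by simp
    then show ?thesis using Suc.prems(6) unfolding k_def power_Suc by linarith
  qed
  have xs: "xs = take k xs @ xs ! k # drop (Suc k) xs"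
    using len by (intro id_take_nth_drop) simp
  have "set (take k xs) \<subseteq> P" "set (drop (Suc k) xs) \<subseteq> P"
    using Suc.prems(5) set_take_subset[of k xs] set_drop_subset[of "Suc k" xs] by auto
  moreover have "xs ! k \<in> P" using Suc.prems(5) len nth_mem[of k xs] by auto
  ultimately have "prod_list (take k xs) * (xs ! k) * prod_list (drop (Suc k) xs) \<in> J"
    using J2[of "drop (Suc k) xs"] len by (auto simp: J2_def k_def)
  then show ?case by (subst xs) (simp add: mult.assoc)
qed

end

section \<open>Characteristic polynomials from traces\<close>

text \<open>The Faddeev--LeVerrier recursion. With \<open>C = X \<cdot> 1 - z\<close>, the matrices \<open>H k\<close> are the coefficients
  of the adjugate of \<open>C\<close> and the \<open>c k\<close> those of \<open>det C\<close>, in descending order; the last equation is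
  the derivative of \<open>det C\<close>.\<close>

lemma faddeev_leverrier:
  fixes z :: "nat \<Rightarrow> nat \<Rightarrow> 'z::idom"
  assumes n: "0 < n"
  obtains c :: "nat \<Rightarrow> 'z" and H :: "nat \<Rightarrow> nat \<Rightarrow> nat \<Rightarrow> 'z" where
    "c 0 = 1"
    "\<And>i j. i < n \<Longrightarrow> j < n \<Longrightarrow> H 0 i j = (if i = j then 1 else 0)"
    "\<And>k i j. k < n \<Longrightarrow> i < n \<Longrightarrow> j < n \<Longrightarrow>
       H (Suc k) i j = (if i = j then c (Suc k) else 0) + (\<Sum>m<n. z i m * H k m j)"
    "\<And>i j. i < n \<Longrightarrow> j < n \<Longrightarrow> H n i j = 0"
    "\<And>k. k < n \<Longrightarrow> (\<Sum>i<n. \<Sum>m<n. z i m * H k m i) = - (of_nat (Suc k) * c (Suc k))"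
proof -
  define A where "A = Matrix.mat n n (\<lambda>(i, j). z i j)"
  define C where "C = char_poly_matrix A"
  define D where "D = adj_mat C"
  define cp where "cp = char_poly A"
  define G where "G = (\<lambda>m i j. coeff (D $$ (i, j)) m)"
  have A: "A \<in> carrier_mat n n" by (simp add: A_def)
  have C: "C \<in> carrier_mat n n" using A by (simp add: C_def)
  note D = adj_mat(1)[OF C, folded D_def]
  have Cij: "C $$ (i, j) = (if i = j then [:0, 1:] else 0) - [:z i j:]" if "i < n" "j < n" for i j
    using that A by (simp add: C_def char_poly_matrix_def A_def)
  have prod: "(if i = j then cp else 0) = pCons 0 (D $$ (i, j)) - (\<Sum>m<n. Polynomial.smult (z i m) (D $$ (m, j)))"
    if ij: "i < n" "j < n" for i j
  proof -
    have "(if i = j then cp else 0) = (C * D) $$ (i, j)"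
      using adj_mat(2)[OF C, folded D_def] ij by (simp add: cp_def char_poly_def C_def)
    also have "\<dots> = (\<Sum>m<n. C $$ (i, m) * D $$ (m, j))"
      using ij C D by (auto simp: scalar_prod_def atLeast0LessThan intro!: sum.cong)
    also have "\<dots> = (\<Sum>m<n. (if i = m then pCons 0 (D $$ (m, j)) else 0) - Polynomial.smult (z i m) (D $$ (m, j)))"
      using ij by (intro sum.cong refl) (auto simp: Cij left_diff_distrib)
    also have "\<dots> = pCons 0 (D $$ (i, j)) - (\<Sum>m<n. Polynomial.smult (z i m) (D $$ (m, j)))"
      using ij by (simp add: sum_subtractf)
    finally show ?thesis .
  qed
  \<comment> \<open>\<open>G m\<close> is the coefficient matrix of \<open>X ^ m\<close> in the
    adjugate. The recursion compares coefficients of \<open>X ^ Suc m\<close> in the identity saying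
    that \<open>C * D\<close> is the scalar matrix \<open>cp\<close>.\<close>
  have G_rec: "G m i j = (if i = j then coeff cp (Suc m) else 0) + (\<Sum>p<n. z i p * G (Suc m) p j)"
    if "i < n" "j < n" for m i j
    using arg_cong[OF prod[OF that], of "\<lambda>p. coeff p (Suc m)"]
    by (auto simp: G_def coeff_sum split: if_splits)
  have G_0: "0 = (if i = j then coeff cp 0 else 0) + (\<Sum>p<n. z i p * G 0 p j)"
    if "i < n" "j < n" for i j
    using arg_cong[OF prod[OF that], of "\<lambda>p. coeff p 0"]
    by (auto simp: G_def coeff_sum split: if_splits)
  \<comment> \<open>The diagonal cofactors are the characteristic polynomials of the principal
    submatrices, and these add up to the derivative of \<open>cp\<close>.\<close>
  have tr: "(\<Sum>i<n. G m i i) = of_nat (Suc m) * coeff cp (Suc m)" for m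
  proof -
    have "(\<Sum>i<n. D $$ (i, i)) = pderiv cp"
      unfolding cp_def pderiv_char_poly[OF A]
    proof (intro sum.cong refl)
      fix i assume "i \<in> {..<n}"
      then have i: "i < n" by simp
      have "D $$ (i, i) = Determinant.det (mat_delete C i i)"
        using i C by (simp add: D_def adj_mat_def cofactor_def)
      also have "mat_delete C i i = char_poly_matrix (mat_delete A i i)"
        using i A by (intro eq_matI) (auto simp: C_def char_poly_matrix_def mat_delete_def)
      finally show "D $$ (i, i) = char_poly (mat_delete A i i)" by (simp add: char_poly_def)
    qed
    from arg_cong[OF this, of "\<lambda>p. coeff p m"] show ?thesis
      by (simp add: G_def coeff_sum coeff_pderiv)
  qed
  have deg: "degree cp = n" and monic: "coeff cp n = 1"
    using degree_monic_char_poly[OF A] by (auto simp: cp_def)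
  \<comment> \<open>Any number above all degrees of adjugate entries serves as a starting point.
    From there the recursion descends with zeros down to \<open>n\<close>, because \<open>cp\<close>
    has no coefficients above degree \<open>n\<close>.\<close>
  define N where "N = n + (\<Sum>i<n. \<Sum>j<n. Suc (degree (D $$ (i, j))))"
  have G_N: "G N i j = 0" if "i < n" "j < n" for i j
  proof -
    have "degree (D $$ (i, j)) < (\<Sum>j<n. Suc (degree (D $$ (i, j))))"
      using that by (intro less_le_trans[OF _ member_le_sum[of j]]) auto
    also have "\<dots> \<le> (\<Sum>i<n. \<Sum>j<n. Suc (degree (D $$ (i, j))))"
      using that by (intro member_le_sum[of i]) auto
    also have "\<dots> \<le> N" by (simp add: N_def)
    finally show ?thesis unfolding G_def by (rule coeff_eq_0)
  qed
  have G_large: "G m i j = 0" if "n \<le> m" "i < n" "j < n" for m i j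
  proof -
    have "m \<le> N \<or> N \<le> m" by auto
    moreover have "G m i j = 0" if "m \<le> N" "n \<le> m" "i < n" "j < n" for m i j
      using that
    proof (induction m arbitrary: i j rule: inc_induct)
      case base then show ?case by (simp add: G_N)
    next
      case (step m)
      then show ?case using deg by (subst G_rec) (auto simp: coeff_eq_0)
    qed
    moreover have "G m i j = 0" if "N \<le> m" "i < n" "j < n" for m i j
    proof -
      have "degree (D $$ (i, j)) < (\<Sum>j<n. Suc (degree (D $$ (i, j))))"
        using that by (intro less_le_trans[OF _ member_le_sum[of j]]) auto
      also have "\<dots> \<le> (\<Sum>i<n. \<Sum>j<n. Suc (degree (D $$ (i, j))))"
        using that by (intro member_le_sum[of i]) auto
      also have "\<dots> \<le> m" using that by (simp add: N_def)
      finally show ?thesis unfolding G_def by (rule coeff_eq_0)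
    qed
    ultimately show ?thesis using that by blast
  qed
  define c where "c = (\<lambda>k. coeff cp (n - k))"
  \<comment> \<open>The value 0 at \<open>k = n\<close> makes the constant-term equation
    \<open>G_0\<close> the last step of the recursion.\<close>
  define H where "H = (\<lambda>k i j. if k < n then G (n - Suc k) i j else 0)"
  have zH: "(\<Sum>p<n. z i p * H k p j) = (\<Sum>p<n. z i p * G (n - Suc k) p j)" if "k < n" for k i j
    using that by (simp add: H_def)
  show ?thesis
  proof (rule that[of c H])
    show "c 0 = 1" using monic by (simp add: c_def)
    show "H 0 i j = (if i = j then 1 else 0)" if "i < n" "j < n" for i j
      using that n monic G_rec[OF that, of "n - 1"] by (simp add: H_def G_large)
    show "H (Suc k) i j = (if i = j then c (Suc k) else 0) + (\<Sum>m<n. z i m * H k m j)"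
      if k: "k < n" and ij: "i < n" "j < n" for k i j
    proof (cases "Suc k = n")
      case True
      then show ?thesis using G_0[OF ij] unfolding zH[OF k] by (simp add: H_def c_def split: if_splits)
    next
      case False
      with k have "n - Suc k = Suc (n - Suc (Suc k))" by simp
      with False k show ?thesis unfolding zH[OF k]
        using G_rec[OF ij, of "n - Suc (Suc k)"] by (simp add: H_def c_def)
    qed
    show "H n i j = 0" for i j by (simp add: H_def)
    show "(\<Sum>i<n. \<Sum>m<n. z i m * H k m i) = - (of_nat (Suc k) * c (Suc k))" if k: "k < n" for k
    proof (cases "Suc k = n")
      case True
      then have "(\<Sum>m<n. z i m * H k m i) = - coeff cp 0" if "i < n" for i
        using G_0[OF that that] unfolding zH[OF k] by (simp add: eq_neg_iff_add_eq_0 add.commute)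
      then show ?thesis using True by (simp add: c_def del: of_nat_Suc)
    next
      case False
      define m where "m = n - Suc (Suc k)"
      have m: "n - Suc k = Suc m" "n = Suc k + Suc m" using False k by (auto simp: m_def)
      have "(\<Sum>i<n. \<Sum>p<n. z i p * H k p i) = (\<Sum>i<n. G m i i - coeff cp (Suc m))"
        by (intro sum.cong refl) (simp add: zH[OF k] m(1) G_rec[of _ _ m])
      also have "\<dots> = of_nat (Suc m) * coeff cp (Suc m) - of_nat n * coeff cp (Suc m)"
        by (simp add: sum_subtractf tr del: of_nat_Suc)
      also have "\<dots> = - (of_nat (Suc k) * coeff cp (Suc m))"
        by (subst m(2)) (simp add: algebra_simps)
      finally show ?thesis by (simp add: c_def m(1))
    qed
  qed
qed

text \<open>Models a quantum torus \<open>T\<close> with normalised trace \<open>tr\<close>, acting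
  on a family \<open>e\<close> with coefficients from \<open>\<iota>\<close>, which may lie outside
  \<open>T\<close>. In place of linear independence of \<open>e\<close>, \<open>matrix_trace\<close>
  demands that every matrix representing \<open>x\<close> has trace \<open>n * tr x\<close>.
  Division by positive integers replaces scalars, and \<open>'z\<close> is a domain rather than a
  field, so that the power series over an instance form an instance again.\<close>

locale trace_ring =
  fixes T :: "'a::ring_1 set" and tr :: "'a \<Rightarrow> 'a" and \<iota> :: "'z::idom \<Rightarrow> 'a"
    and e :: "nat \<Rightarrow> 'a" and n :: nat
  assumes T_1: "1 \<in> T"
    and T_add: "x \<in> T \<Longrightarrow> y \<in> T \<Longrightarrow> x + y \<in> T"
    and T_mult: "x \<in> T \<Longrightarrow> y \<in> T \<Longrightarrow> x * y \<in> T"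
    and T_uminus: "x \<in> T \<Longrightarrow> - x \<in> T"
    and T_div: "0 < m \<Longrightarrow> of_nat m * x \<in> T \<Longrightarrow> x \<in> T"
    and torsion_free: "0 < m \<Longrightarrow> of_nat m * x = 0 \<Longrightarrow> x = 0"
    and tr_T: "x \<in> T \<Longrightarrow> tr x \<in> T"
    and tr_add: "x \<in> T \<Longrightarrow> y \<in> T \<Longrightarrow> tr (x + y) = tr x + tr y"
    and tr_comm: "x \<in> T \<Longrightarrow> y \<in> T \<Longrightarrow> tr (x * y) = tr (y * x)"
    and tr_tr: "x \<in> T \<Longrightarrow> y \<in> T \<Longrightarrow> tr (tr x * y) = tr x * tr y"
    and tr_central: "x \<in> T \<Longrightarrow> y \<in> T \<Longrightarrow> tr x * y = y * tr x"
    and \<iota>_add: "\<iota> (u + v) = \<iota> u + \<iota> v"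
    and \<iota>_mult: "\<iota> (u * v) = \<iota> u * \<iota> v"
    and \<iota>_1: "\<iota> 1 = 1"
    and \<iota>_central: "x \<in> T \<Longrightarrow> \<iota> u * x = x * \<iota> u"
    and e_1: "1 \<in> e ` {..<n}"
    and matrix_exists: "x \<in> T \<Longrightarrow> \<exists>z. \<forall>j<n. x * e j = (\<Sum>i<n. \<iota> (z i j) * e i)"
    and matrix_trace: "x \<in> T \<Longrightarrow> (\<And>j. j < n \<Longrightarrow> x * e j = (\<Sum>i<n. \<iota> (z i j) * e i)) \<Longrightarrow>
      (\<Sum>i<n. \<iota> (z i i)) = of_nat n * tr x"
begin

lemma n_pos: "0 < n"
  using e_1 by auto

lemma T_0: "0 \<in> T"
  using T_add[OF T_1 T_uminus[OF T_1]] by simp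

lemma T_sum: "(\<And>i. i \<in> I \<Longrightarrow> f i \<in> T) \<Longrightarrow> sum f I \<in> T"
  by (induction I rule: infinite_finite_induct) (auto intro: T_0 T_add)

lemma T_power: "x \<in> T \<Longrightarrow> x ^ m \<in> T"
  by (induction m) (auto intro: T_1 T_mult)

lemma T_of_nat_mult: "x \<in> T \<Longrightarrow> of_nat m * x \<in> T"
  by (induction m) (auto simp: distrib_right intro: T_0 T_add)

lemma tr_0: "tr 0 = 0"
  using tr_add[OF T_0 T_0] by simp

lemma tr_uminus: "x \<in> T \<Longrightarrow> tr (- x) = - tr x"
  using tr_add[of x "- x"] T_uminus tr_0 by (simp add: eq_neg_iff_add_eq_0 add.commute)

lemma tr_sum: "(\<And>i. i \<in> I \<Longrightarrow> f i \<in> T) \<Longrightarrow> tr (sum f I) = (\<Sum>i\<in>I. tr (f i))"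
  by (induction I rule: infinite_finite_induct) (auto simp: tr_0 tr_add T_sum)

lemma tr_of_nat_mult: "x \<in> T \<Longrightarrow> tr (of_nat m * x) = of_nat m * tr x"
  by (induction m) (auto simp: distrib_right tr_0 tr_add T_of_nat_mult)

lemma \<iota>_0: "\<iota> 0 = 0"
  using \<iota>_add[of 0 0] by simp

lemma \<iota>_uminus: "\<iota> (- u) = - \<iota> u"
  using \<iota>_add[of u "- u"] by (simp add: \<iota>_0 eq_neg_iff_add_eq_0 add.commute)

lemma \<iota>_sum: "\<iota> (sum f I) = (\<Sum>i\<in>I. \<iota> (f i))"
  by (induction I rule: infinite_finite_induct) (auto simp: \<iota>_0 \<iota>_add)

lemma \<iota>_of_nat: "\<iota> (of_nat m) = of_nat m"
  by (induction m) (auto simp: \<iota>_0 \<iota>_add \<iota>_1)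

text \<open>A priori the coefficients of the characteristic polynomial of left multiplication lie
  only in the image of \<open>\<iota>\<close>. Newton's identities express \<open>k * c k\<close> by
  traces, and division by \<open>k\<close> puts \<open>c k\<close> into \<open>T\<close>. The last
  identity is the characteristic equation times \<open>a\<close>, so each of its terms contains a
  positive power of \<open>a\<close>.\<close>

lemma characteristic_polynomial:
  assumes a: "a \<in> T"
  obtains c where "c 0 = 1" "\<And>k. c k \<in> T" "\<And>k x. x \<in> T \<Longrightarrow> c k * x = x * c k"
    "\<And>k. k \<le> n \<Longrightarrow> 0 < k \<Longrightarrow> of_nat k * c k = - (of_nat n * tr (\<Sum>j<k. c j * a ^ (k - j)))"
    "(\<Sum>j\<le>n. c j * a ^ (Suc n - j)) = 0"
proof -
  obtain z where z: "\<And>j. j < n \<Longrightarrow> a * e j = (\<Sum>i<n. \<iota> (z i j) * e i)"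
    using matrix_exists[OF a] by blast
  obtain c H where fl: "c 0 = 1"
    "\<And>i j. i < n \<Longrightarrow> j < n \<Longrightarrow> H 0 i j = (if i = j then 1 else 0)"
    "\<And>k i j. k < n \<Longrightarrow> i < n \<Longrightarrow> j < n \<Longrightarrow>
       H (Suc k) i j = (if i = j then c (Suc k) else 0) + (\<Sum>m<n. z i m * H k m j)"
    "\<And>i j. i < n \<Longrightarrow> j < n \<Longrightarrow> H n i j = 0"
    "\<And>k. k < n \<Longrightarrow> (\<Sum>i<n. \<Sum>m<n. z i m * H k m i) = - (of_nat (Suc k) * c (Suc k))"
    apply (rule faddeev_leverrier[OF n_pos, of z])
    subgoal premises p for c H by (rule p(1)) (fact p)+
    done
  \<comment> \<open>These are the Horner partial sums of the characteristic polynomial at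
    \<open>a\<close>; on the family \<open>e\<close> they act by the adjugate coefficients
    \<open>H k\<close>.\<close>
  define b where "b = (\<lambda>k. \<Sum>j\<le>k. \<iota> (c j) * a ^ (k - j))"
  have b_Suc: "b (Suc k) = \<iota> (c (Suc k)) + a * b k" for k
  proof -
    have "a * b k = (\<Sum>j\<le>k. \<iota> (c j) * a ^ (Suc k - j))"
      unfolding b_def sum_distrib_left
    proof (intro sum.cong refl)
      fix j assume "j \<in> {..k}"
      then show "a * (\<iota> (c j) * a ^ (k - j)) = \<iota> (c j) * a ^ (Suc k - j)"
        by (simp add: Suc_diff_le mult.assoc[symmetric] \<iota>_central[OF a])
    qed
    then show ?thesis by (simp add: b_def add.commute)
  qed
  have b_matrix: "b k * e j = (\<Sum>i<n. \<iota> (H k i j) * e i)"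
    and ab_matrix: "k < n \<Longrightarrow> a * b k * e j = (\<Sum>i<n. \<iota> (\<Sum>m<n. z i m * H k m j) * e i)"
    if "k \<le> n" "j < n" for k j
  proof -
    have step: "a * b k * e j = (\<Sum>i<n. \<iota> (\<Sum>m<n. z i m * H k m j) * e i)"
      if IH: "b k * e j = (\<Sum>i<n. \<iota> (H k i j) * e i)" for k
    proof -
      have "a * b k * e j = (\<Sum>m<n. \<iota> (H k m j) * (a * e m))"
        by (simp add: IH mult.assoc sum_distrib_left)
          (simp add: mult.assoc[symmetric] \<iota>_central[OF a])
      also have "\<dots> = (\<Sum>m<n. \<Sum>i<n. \<iota> (z i m * H k m j) * e i)"
        by (simp add: z sum_distrib_left mult.assoc[symmetric] \<iota>_mult[symmetric] mult.commute)
      also have "\<dots> = (\<Sum>i<n. \<iota> (\<Sum>m<n. z i m * H k m j) * e i)"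
        by (subst sum.swap) (simp add: \<iota>_sum sum_distrib_right)
      finally show ?thesis .
    qed
    show *: "b k * e j = (\<Sum>i<n. \<iota> (H k i j) * e i)" using \<open>k \<le> n\<close>
    proof (induction k)
      case 0
      have "(\<Sum>i<n. \<iota> (H 0 i j) * e i) = (\<Sum>i<n. if i = j then e i else 0)"
        using \<open>j < n\<close> by (intro sum.cong refl) (auto simp: fl(2) \<iota>_0 \<iota>_1)
      then show ?case using \<open>j < n\<close> fl(1) by (simp add: b_def \<iota>_1)
    next
      case (Suc k)
      have "(\<Sum>i<n. \<iota> (H (Suc k) i j) * e i)
          = (\<Sum>i<n. (if i = j then \<iota> (c (Suc k)) * e i else 0) + \<iota> (\<Sum>m<n. z i m * H k m j) * e i)"
        using \<open>j < n\<close> Suc.prems by (intro sum.cong refl) (auto simp: fl(3) \<iota>_0 \<iota>_add distrib_right)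
      also have "\<dots> = \<iota> (c (Suc k)) * e j + (\<Sum>i<n. \<iota> (\<Sum>m<n. z i m * H k m j) * e i)"
        using \<open>j < n\<close> by (simp add: sum.distrib)
      finally show ?case using step[OF Suc.IH] Suc.prems by (simp add: b_Suc distrib_right)
    qed
    show "a * b k * e j = (\<Sum>i<n. \<iota> (\<Sum>m<n. z i m * H k m j) * e i)" by (rule step[OF *])
  qed
  \<comment> \<open>The two claims need each other: \<open>a * b k \<in> T\<close> has a trace, this
    trace yields \<open>\<iota> (c (Suc k))\<close>, and the latter yields
    \<open>b (Suc k)\<close>.\<close>
  have bT: "b k \<in> T \<and> \<iota> (c k) \<in> T" if "k \<le> n" for k
    using that
  proof (induction k)
    case 0 then show ?case using fl(1) by (simp add: b_def \<iota>_1 T_1)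
  next
    case (Suc k)
    then have ab: "a * b k \<in> T" using a T_mult by auto
    have "(\<Sum>i<n. \<iota> (\<Sum>m<n. z i m * H k m i)) = of_nat n * tr (a * b k)"
      using Suc.prems by (intro matrix_trace ab) (auto intro: ab_matrix)
    then have "of_nat (Suc k) * \<iota> (c (Suc k)) = - (of_nat n * tr (a * b k))"
      using Suc.prems fl(5)[of k]
      by (simp only: \<iota>_sum[symmetric] \<iota>_uminus \<iota>_mult \<iota>_of_nat) (metis minus_minus)
    moreover have "- (of_nat n * tr (a * b k)) \<in> T"
      by (intro T_uminus T_of_nat_mult tr_T ab)
    ultimately have "\<iota> (c (Suc k)) \<in> T" by (metis T_div zero_less_Suc)
    then show ?case using ab by (simp add: b_Suc T_add)
  qed
  have ab: "a * b k = (\<Sum>j\<le>k. \<iota> (c j) * a ^ (Suc k - j))" for k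
    using b_Suc[of k] by (simp add: b_def add.commute)
  \<comment> \<open>The value 1 beyond \<open>n\<close> keeps \<open>c' k\<close> central and in
    \<open>T\<close> for all \<open>k\<close>.\<close>
  define c' where "c' = (\<lambda>k. if k \<le> n then \<iota> (c k) else 1)"
  show ?thesis
  proof (rule that[of c'])
    show "c' 0 = 1" by (simp add: c'_def fl \<iota>_1)
    show "c' k \<in> T" for k by (simp add: c'_def bT T_1)
    show "c' k * x = x * c' k" if "x \<in> T" for k x using that by (simp add: c'_def \<iota>_central)
    show "of_nat k * c' k = - (of_nat n * tr (\<Sum>j<k. c' j * a ^ (k - j)))" if "k \<le> n" "0 < k" for k
    proof -
      obtain m where m: "k = Suc m" using \<open>0 < k\<close> by (cases k) auto
      have abT: "a * b m \<in> T" using that a T_mult bT m by auto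
      have "(\<Sum>i<n. \<iota> (\<Sum>p<n. z i p * H m p i)) = of_nat n * tr (a * b m)"
        using that m by (intro matrix_trace abT) (auto intro: ab_matrix)
      then have "of_nat k * \<iota> (c k) = - (of_nat n * tr (a * b m))"
        using that m fl(5)[of m]
        by (simp only: \<iota>_sum[symmetric] \<iota>_uminus \<iota>_mult \<iota>_of_nat) (metis minus_minus)
      moreover have "(\<Sum>j<k. c' j * a ^ (k - j)) = a * b m"
        using that unfolding ab m lessThan_Suc_atMost by (intro sum.cong refl) (auto simp: c'_def)
      ultimately show ?thesis using that by (simp add: c'_def)
    qed
    \<comment> \<open>\<open>H n = 0\<close> makes \<open>b n\<close> annihilate every
      \<open>e j\<close>; since 1 is among them, \<open>b n\<close> itself is 0.\<close>
    obtain j where j: "j < n" "e j = 1" using e_1 by auto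
    then have "b n * e j = 0" using b_matrix[of n j] by (simp add: fl(4) \<iota>_0)
    then have "b n = 0" by (simp add: j)
    then show "(\<Sum>j\<le>n. c' j * a ^ (Suc n - j)) = 0"
      using ab[of n] by (simp add: c'_def)
  qed
qed

text \<open>For \<open>k > 0\<close> the coefficient \<open>c k\<close> is, up to integer
  denominators, a polynomial in traces of powers of \<open>a\<close> without constant term, so it
  carries \<open>P\<close> into \<open>J\<close>. Modulo \<open>J\<close> only the leading term of
  the characteristic equation times \<open>a\<close> remains.\<close>

lemma power_in_trace_ideal:
  assumes J_0: "0 \<in> J" and J_add: "\<And>x y. x \<in> J \<Longrightarrow> y \<in> J \<Longrightarrow> x + y \<in> J"
    and J_uminus: "\<And>x. x \<in> J \<Longrightarrow> - x \<in> J"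
    and J_div: "\<And>m x. 0 < m \<Longrightarrow> of_nat m * x \<in> J \<Longrightarrow> x \<in> J"
    and P: "P \<subseteq> T" and P_mult: "\<And>x y. x \<in> P \<Longrightarrow> y \<in> P \<Longrightarrow> x * y \<in> P"
    and trP: "\<And>x y. x \<in> P \<Longrightarrow> y \<in> P \<Longrightarrow> tr x * y \<in> J"
    and trJ: "\<And>x y. x \<in> P \<Longrightarrow> y \<in> J \<Longrightarrow> tr x * y \<in> J"
    and a: "a \<in> P"
  shows "a ^ Suc n \<in> J"
proof -
  have aT: "a \<in> T" using a P by auto
  obtain c where c: "c 0 = 1" "\<And>k. c k \<in> T" "\<And>k x. x \<in> T \<Longrightarrow> c k * x = x * c k"
    "\<And>k. k \<le> n \<Longrightarrow> 0 < k \<Longrightarrow> of_nat k * c k = - (of_nat n * tr (\<Sum>j<k. c j * a ^ (k - j)))"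
    "(\<Sum>j\<le>n. c j * a ^ (Suc n - j)) = 0"
    apply (rule characteristic_polynomial[OF aT])
    subgoal premises p for c by (rule p(1)) (fact p)+
    done
  have pow: "a ^ m \<in> P" if "0 < m" for m
    using that
  proof (induction m)
    case (Suc m) then show ?case using P_mult a by (cases m) auto
  qed simp
  have J_nat: "of_nat m * x \<in> J" if "x \<in> J" for m x
    using that by (induction m) (auto simp: distrib_right intro: J_0 J_add)
  have J_sum: "sum f I \<in> J" if "\<And>i. i \<in> I \<Longrightarrow> f i \<in> J" for f and I :: "nat set"
    using that by (induction I rule: infinite_finite_induct) (auto intro: J_0 J_add)
  \<comment> \<open>\<open>k * c k\<close> is an integer multiple of a trace, and traces can be
    pulled out of \<open>tr\<close>; torsion-freeness cancels \<open>k\<close>.\<close>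
  have tr_c: "tr (c k * y) = c k * tr y" if k: "k \<le> n" and y: "y \<in> T" for k y
  proof (cases "k = 0")
    case False
    define t where "t = (\<Sum>j<k. c j * a ^ (k - j))"
    have t: "t \<in> T" unfolding t_def by (intro T_sum T_mult c(2) T_power aT)
    have ck: "of_nat k * c k = - (of_nat n * tr t)" using c(4)[OF k] False by (simp add: t_def)
    have "of_nat k * tr (c k * y) = tr (of_nat k * (c k * y))"
      using c(2) y by (simp add: tr_of_nat_mult T_mult)
    also have "of_nat k * (c k * y) = - (of_nat n * (tr t * y))"
      using arg_cong[OF ck, of "\<lambda>u. u * y"] by (simp add: mult.assoc)
    also have "tr \<dots> = - (of_nat n * (tr t * tr y))"
      using t y by (simp add: tr_uminus tr_of_nat_mult T_of_nat_mult T_mult tr_T tr_tr)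
    also have "\<dots> = of_nat k * (c k * tr y)"
      using arg_cong[OF ck, of "\<lambda>u. u * tr y"] by (simp add: mult.assoc)
    finally have "of_nat k * (tr (c k * y) - c k * tr y) = 0" by (simp add: right_diff_distrib)
    then have "tr (c k * y) - c k * tr y = 0" using torsion_free False by blast
    then show ?thesis by simp
  qed (simp add: c)
  \<comment> \<open>Newton's identity turns \<open>k * c k * p\<close> into a combination of the
    elements \<open>tr (a ^ (k - j)) * (c j * p)\<close>. For \<open>j = 0\<close> this is a trace
    times \<open>p\<close>; the other summands fall under the induction hypothesis.\<close>
  have cJ: "c k * p \<in> J" if "k \<le> n" "0 < k" "p \<in> P" for k p
    using that
  proof (induction k arbitrary: p rule: less_induct)
    case (less k)
    have pT: "p \<in> T" using less P by auto
    have "of_nat k * (c k * p) = - (of_nat n * (tr (\<Sum>j<k. c j * a ^ (k - j)) * p))"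
      using arg_cong[OF c(4)[OF less.prems(1,2)], of "\<lambda>u. u * p"] by (simp add: mult.assoc)
    also have "tr (\<Sum>j<k. c j * a ^ (k - j)) * p = (\<Sum>j<k. tr (a ^ (k - j)) * (c j * p))"
    proof -
      have "tr (c j * a ^ (k - j)) * p = tr (a ^ (k - j)) * (c j * p)" if "j < k" for j
        using that less.prems T_power[OF aT] c(2)
        by (subst tr_c) (simp_all add: tr_T c(3) mult.assoc)
      then show ?thesis
        by (subst tr_sum) (auto simp: sum_distrib_right intro: T_mult c T_power aT)
    qed
    also have "- (of_nat n * \<dots>) \<in> J"
    proof (intro J_uminus J_nat J_sum)
      fix j assume "j \<in> {..<k}"
      then have j: "j < k" by simp
      show "tr (a ^ (k - j)) * (c j * p) \<in> J"
      proof (cases "j = 0")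
        case True then show ?thesis using j less.prems pow trP by (simp add: c)
      next
        case False
        then have "c j * p \<in> J" using less.IH[of j p] less.prems j by simp
        then show ?thesis using trJ pow j by auto
      qed
    qed
    finally show ?case using J_div less.prems by blast
  qed
  have "(\<Sum>j\<le>n. c j * a ^ (Suc n - j)) = a ^ Suc n + (\<Sum>j<n. c (Suc j) * a ^ (n - j))"
    by (subst sum.atMost_shift) (simp add: c)
  then have "a ^ Suc n = - (\<Sum>j<n. c (Suc j) * a ^ (n - j))"
    using c(5) by (simp add: eq_neg_iff_add_eq_0)
  also have "\<dots> \<in> J" by (intro J_uminus J_sum cJ pow) auto
  finally show ?thesis .
qed

end

section \<open>Traces of a finitely generated algebra\<close>

lemma is_subalgebra_hull: "is_subalgebra sc (is_subalgebra sc hull S)"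
  by (rule hull_in) (auto simp: is_subalgebra_def)

lemma is_subalgebraD:
  assumes "is_subalgebra sc A"
  shows "1 \<in> A" "x \<in> A \<Longrightarrow> y \<in> A \<Longrightarrow> x + y \<in> A" "x \<in> A \<Longrightarrow> y \<in> A \<Longrightarrow> x * y \<in> A"
    "x \<in> A \<Longrightarrow> sc c x \<in> A"
  using assms by (auto simp: is_subalgebra_def)

context algebra_over
begin

lemma subalgebra_subspace: "is_subalgebra sc S \<Longrightarrow> subspace S"
  unfolding is_subalgebra_def subspace_def by (metis scale_zero_left)

text \<open>These spans need not be independent for different \<open>i\<close>, since the letters
  may satisfy relations of mixed length.\<close>

definition word_span :: "'a set \<Rightarrow> nat \<Rightarrow> 'a set" where
  "word_span S i = span {prod_list w | w. set w \<subseteq> S \<and> length w = i}"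

lemma word_span_word: "set w \<subseteq> S \<Longrightarrow> prod_list w \<in> word_span S (length w)"
  unfolding word_span_def by (rule span_base) auto

lemma word_span_mult:
  assumes "x \<in> word_span S i" "y \<in> word_span S j"
  shows "x * y \<in> word_span S (i + j)"
proof -
  have "x * prod_list w \<in> word_span S (i + j)" if w: "set w \<subseteq> S" "length w = j" for w
    using assms(1) unfolding word_span_def[of S i]
  proof (induction rule: span_induct_alt)
    case base then show ?case by (simp add: word_span_def span_zero)
  next
    case (step c u y)
    then obtain w' where w': "u = prod_list w'" "set w' \<subseteq> S" "length w' = i" by auto
    have "u * prod_list w \<in> word_span S (i + j)"
      using word_span_word[of "w' @ w" S] w w' by simp
    then show ?case using step
      by (simp add: word_span_def distrib_right sc_mult_left span_add span_scale)
  qed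
  note word = this
  show ?thesis using assms(2) unfolding word_span_def[of S j]
  proof (induction rule: span_induct_alt)
    case base then show ?case by (simp add: word_span_def span_zero)
  next
    case (step c u y)
    then have "x * u \<in> word_span S (i + j)" using word by auto
    then show ?case using step
      by (simp add: word_span_def distrib_left sc_mult_right span_add span_scale)
  qed
qed

lemma subalgebra_hull_eq_span_words:
  "is_subalgebra sc hull S = span {prod_list w | w. set w \<subseteq> S}"
proof
  let ?V = "span {prod_list w | w. set w \<subseteq> S}"
  have mult: "x * y \<in> ?V" if "x \<in> ?V" "y \<in> ?V" for x y
  proof -
    have "x * prod_list w \<in> ?V" if w: "set w \<subseteq> S" for w
      using \<open>x \<in> ?V\<close>
    proof (induction rule: span_induct_alt)
      case base then show ?case by (simp add: span_zero)
    next
      case (step c u y)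
      then obtain w' where w': "u = prod_list w'" "set w' \<subseteq> S" by auto
      have "prod_list (w' @ w) \<in> ?V"
        using w w' by (intro span_base CollectI exI[of _ "w' @ w"]) auto
      then show ?case using step w' by (simp add: distrib_right sc_mult_left span_add span_scale)
    qed
    note word = this
    show ?thesis using \<open>y \<in> ?V\<close>
    proof (induction rule: span_induct_alt)
      case base then show ?case by (simp add: span_zero)
    next
      case (step c u y)
      then show ?case using word by (auto simp: distrib_left sc_mult_right intro!: span_add span_scale)
    qed
  qed
  have "prod_list [] \<in> ?V" by (intro span_base CollectI exI[of _ "[]"]) simp
  then have "is_subalgebra sc ?V"
    using mult by (auto simp: is_subalgebra_def span_add span_scale)
  moreover have "S \<subseteq> ?V"
  proof
    fix x assume "x \<in> S"
    then have "prod_list [x] \<in> ?V" by (intro span_base CollectI exI[of _ "[x]"]) simp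
    then show "x \<in> ?V" by simp
  qed
  ultimately show "is_subalgebra sc hull S \<subseteq> ?V" by (rule hull_minimal[rotated])
next
  have sub: "is_subalgebra sc (is_subalgebra sc hull S)" by (rule is_subalgebra_hull)
  have "prod_list w \<in> is_subalgebra sc hull S" if "set w \<subseteq> S" for w
    using that
  proof (induction w)
    case Nil then show ?case using is_subalgebraD(1)[OF sub] by simp
  next
    case (Cons a w)
    then show ?case using is_subalgebraD(3)[OF sub] hull_subset[of S "is_subalgebra sc"] by auto
  qed
  then show "span {prod_list w | w. set w \<subseteq> S} \<subseteq> is_subalgebra sc hull S"
    by (intro span_minimal subalgebra_subspace sub) auto
qed

end

section \<open>Power series as a record of word length\<close>

lemma fps_mult_commute_coeffs:
  fixes f g :: "'a::ring_1 fps"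
  assumes "\<And>i j. fps_nth f i * fps_nth g j = fps_nth g j * fps_nth f i"
  shows "f * g = g * f"
proof (rule fps_ext)
  fix m
  have "fps_nth (f * g) m = (\<Sum>i=0..m. fps_nth f (m - i) * fps_nth g i)"
    unfolding fps_mult_nth by (subst sum.atLeastAtMost_rev) simp
  then show "fps_nth (f * g) m = fps_nth (g * f) m" by (simp add: fps_mult_nth assms)
qed

lemma fps_nth_of_nat_mult: "fps_nth (of_nat m * f) i = of_nat m * fps_nth (f :: 'a::ring_1 fps) i"
  by (simp add: fps_of_nat[symmetric])

text \<open>Each letter \<open>a\<close> becomes the series \<open>a X\<close>, which turns the
  length of a word into the degree of a monomial.\<close>

lemma prod_list_fps_linear:
  "prod_list (map (\<lambda>a. Abs_fps (\<lambda>i. if i = 1 then a else 0)) w)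
     = Abs_fps (\<lambda>i. if i = length w then prod_list w else (0 :: 'a::ring_1))"
proof (induction w)
  case Nil
  show ?case by (rule fps_ext) simp
next
  case (Cons a w)
  show ?case
  proof (rule fps_ext)
    fix m
    have "(\<Sum>i=0..m. (if i = 1 then a else 0) * (if m - i = length w then prod_list w else 0))
        = (\<Sum>i=0..m. if i = 1 then (if m - 1 = length w then a * prod_list w else 0) else 0)"
      by (intro sum.cong) auto
    also have "\<dots> = (if m = Suc (length w) then a * prod_list w else 0)" by (cases m) auto
    finally have "fps_nth (Abs_fps (\<lambda>i. if i = 1 then a else 0)
          * Abs_fps (\<lambda>i. if i = length w then prod_list w else 0)) m
        = (if m = Suc (length w) then a * prod_list w else 0)"
      by (simp only: fps_mult_nth fps_nth_Abs_fps)
    then show "fps_nth (prod_list (map (\<lambda>a. Abs_fps (\<lambda>i. if i = 1 then a else 0)) (a # w))) m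
       = fps_nth (Abs_fps (\<lambda>i. if i = length (a # w) then prod_list (a # w) else 0)) m"
      unfolding list.map prod_list.Cons Cons by simp
  qed
qed

locale trace_algebra = algebra_over sc + trace_ring T tr \<iota> e n
  for sc :: "'k::field_char_0 \<Rightarrow> 'a::ring_1 \<Rightarrow> 'a" and T tr
    and \<iota> :: "'z::idom \<Rightarrow> 'a" and e n +
  assumes T_scale: "x \<in> T \<Longrightarrow> sc c x \<in> T"
    and tr_scale: "x \<in> T \<Longrightarrow> tr (sc c x) = sc c (tr x)"
begin

definition fps_scale :: "'k \<Rightarrow> 'a fps \<Rightarrow> 'a fps" where
  "fps_scale c p = Abs_fps (\<lambda>i. sc c (fps_nth p i))"

definition fps_T :: "'a fps set" where
  "fps_T = {p. \<forall>i. fps_nth p i \<in> T}"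

definition fps_tr :: "'a fps \<Rightarrow> 'a fps" where
  "fps_tr p = Abs_fps (\<lambda>i. tr (fps_nth p i))"

lemma fps_scale_nth [simp]: "fps_nth (fps_scale c p) i = sc c (fps_nth p i)"
  by (simp add: fps_scale_def)

lemma fps_tr_nth [simp]: "fps_nth (fps_tr p) i = tr (fps_nth p i)"
  by (simp add: fps_tr_def)

lemma fps_algebra: "algebra_over fps_scale"
  by unfold_locales
    (auto simp: fps_eq_iff scale_right_distrib scale_left_distrib fps_mult_nth
      sc_mult_left sc_mult_right scale_sum_right)

text \<open>Every axiom reduces to coefficients. A matrix for a series is assembled from one matrix
  per coefficient, so the rank \<open>n\<close>, and with it the degree in Cayley-Hamilton, stays
  the same.\<close>

lemma fps_trace_ring:
  "trace_ring fps_T fps_tr (\<lambda>u. Abs_fps (\<lambda>i. \<iota> (fps_nth u i))) (\<lambda>i. fps_const (e i)) n"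
proof
  show "1 \<in> fps_T" by (simp add: fps_T_def T_1 T_0)
  show "x + y \<in> fps_T" if "x \<in> fps_T" "y \<in> fps_T" for x y
    using that by (simp add: fps_T_def T_add)
  show T_mult': "x * y \<in> fps_T" if "x \<in> fps_T" "y \<in> fps_T" for x y
    using that by (auto simp: fps_T_def fps_mult_nth intro!: T_sum T_mult)
  show "- x \<in> fps_T" if "x \<in> fps_T" for x
    using that by (simp add: fps_T_def T_uminus)
  show "x \<in> fps_T" if "0 < m" "of_nat m * x \<in> fps_T" for m x
    using that by (auto simp: fps_T_def fps_nth_of_nat_mult intro: T_div)
  show "x = 0" if "0 < m" "of_nat m * x = 0" for m and x :: "'a fps"
  proof (rule fps_ext)
    fix i
    have "of_nat m * fps_nth x i = 0" using that(2) by (metis fps_nth_of_nat_mult fps_zero_nth)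
    then show "fps_nth x i = fps_nth 0 i" using that(1) torsion_free by simp
  qed
  show "fps_tr x \<in> fps_T" if "x \<in> fps_T" for x
    using that by (simp add: fps_T_def tr_T)
  show "fps_tr (x + y) = fps_tr x + fps_tr y" if "x \<in> fps_T" "y \<in> fps_T" for x y
    using that by (simp add: fps_T_def tr_add fps_eq_iff)
  show "fps_tr (x * y) = fps_tr (y * x)" if "x \<in> fps_T" "y \<in> fps_T" for x y
  proof (rule fps_ext)
    fix m
    have "fps_nth (fps_tr (x * y)) m = (\<Sum>i=0..m. tr (fps_nth x i * fps_nth y (m - i)))"
      using that by (auto simp: fps_T_def fps_mult_nth tr_sum T_mult)
    also have "\<dots> = (\<Sum>i=0..m. tr (fps_nth x (m - i) * fps_nth y i))"
      by (subst sum.atLeastAtMost_rev) simp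
    also have "\<dots> = fps_nth (fps_tr (y * x)) m"
      using that tr_comm by (auto simp: fps_T_def fps_mult_nth tr_sum T_mult)
    finally show "fps_nth (fps_tr (x * y)) m = fps_nth (fps_tr (y * x)) m" .
  qed
  show "fps_tr (fps_tr x * y) = fps_tr x * fps_tr y" if "x \<in> fps_T" "y \<in> fps_T" for x y
    using that by (auto simp: fps_T_def fps_mult_nth tr_sum T_mult tr_T tr_tr fps_eq_iff)
  show "fps_tr x * y = y * fps_tr x" if "x \<in> fps_T" "y \<in> fps_T" for x y
    using that by (intro fps_mult_commute_coeffs) (simp add: fps_T_def tr_central)
  fix u v :: "'z fps"
  show "Abs_fps (\<lambda>i. \<iota> (fps_nth (u + v) i)) = Abs_fps (\<lambda>i. \<iota> (fps_nth u i)) + Abs_fps (\<lambda>i. \<iota> (fps_nth v i))"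
    by (simp add: fps_eq_iff \<iota>_add)
  show "Abs_fps (\<lambda>i. \<iota> (fps_nth (u * v) i)) = Abs_fps (\<lambda>i. \<iota> (fps_nth u i)) * Abs_fps (\<lambda>i. \<iota> (fps_nth v i))"
    by (simp add: fps_eq_iff fps_mult_nth \<iota>_sum \<iota>_mult)
  show "Abs_fps (\<lambda>i. \<iota> (fps_nth 1 i)) = 1"
    by (simp add: fps_eq_iff \<iota>_1 \<iota>_0)
  show "Abs_fps (\<lambda>i. \<iota> (fps_nth u i)) * x = x * Abs_fps (\<lambda>i. \<iota> (fps_nth u i))" if "x \<in> fps_T" for x
    using that by (intro fps_mult_commute_coeffs) (simp add: fps_T_def \<iota>_central)
  obtain j where j: "j < n" "e j = 1" using e_1 by auto
  then show "1 \<in> (\<lambda>i. fps_const (e i)) ` {..<n}"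
    by (auto intro!: image_eqI[of _ _ j])
next
  fix x assume "x \<in> fps_T"
  then have x: "fps_nth x k \<in> T" for k by (simp add: fps_T_def)
  have "\<exists>z. \<forall>j<n. fps_nth x k * e j = (\<Sum>i<n. \<iota> (z i j) * e i)" for k
    by (rule matrix_exists[OF x])
  then obtain z where z: "\<And>k j. j < n \<Longrightarrow> fps_nth x k * e j = (\<Sum>i<n. \<iota> (z k i j) * e i)"
    by metis
  show "\<exists>z. \<forall>j<n. x * fps_const (e j)
      = (\<Sum>i<n. Abs_fps (\<lambda>k. \<iota> (fps_nth (z i j) k)) * fps_const (e i))"
    by (rule exI[of _ "\<lambda>i j. Abs_fps (\<lambda>k. z k i j)"])
      (simp add: fps_eq_iff z fps_sum_nth)
next
  fix x z
  assume "x \<in> fps_T" and eq: "\<And>j. j < n \<Longrightarrow> x * fps_const (e j)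
      = (\<Sum>i<n. Abs_fps (\<lambda>k. \<iota> (fps_nth (z i j) k)) * fps_const (e i))"
  then have x: "fps_nth x k \<in> T" for k by (simp add: fps_T_def)
  have "(\<Sum>i<n. \<iota> (fps_nth (z i i) k)) = of_nat n * tr (fps_nth x k)" for k
  proof (rule matrix_trace[where z = "\<lambda>i j. fps_nth (z i j) k", OF x])
    fix j assume "j < n"
    from arg_cong[OF eq[OF this], of "\<lambda>p. fps_nth p k"]
    show "fps_nth x k * e j = (\<Sum>i<n. \<iota> (fps_nth (z i j) k) * e i)"
      by (simp add: fps_sum_nth)
  qed
  then show "(\<Sum>i<n. Abs_fps (\<lambda>k. \<iota> (fps_nth (z i i) k))) = of_nat n * fps_tr x"
    by (simp add: fps_eq_iff fps_sum_nth fps_nth_of_nat_mult)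
qed

definition short_traces :: "'a set \<Rightarrow> nat \<Rightarrow> 'a set" where
  "short_traces S L = is_subalgebra sc hull (tr ` {prod_list w | w. set w \<subseteq> S \<and> length w \<le> L})"

text \<open>Power series keep track of the length of words: the ideal \<open>J\<close> below consists of the series whose
  coefficients only contribute traces of words of length at most \<open>L\<close>.\<close>

lemma trace_of_long_word:
  assumes L: "2 ^ Suc n - 1 \<le> L" and ST: "is_subalgebra sc hull S \<subseteq> T"
    and w: "set w \<subseteq> S" "length w = Suc L"
  shows "tr (prod_list w) \<in> short_traces S L"
proof -
  interpret F: algebra_over fps_scale by (rule fps_algebra)
  interpret FT: trace_ring fps_T fps_tr "\<lambda>u. Abs_fps (\<lambda>i. \<iota> (fps_nth u i))" "\<lambda>i. fps_const (e i)" n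
    by (rule fps_trace_ring)
  let ?R = "short_traces S L"
  have R: "is_subalgebra sc ?R" unfolding short_traces_def by (rule is_subalgebra_hull)
  then have R_mult: "x * y \<in> ?R" if "x \<in> ?R" "y \<in> ?R" for x y
    using that by (simp add: is_subalgebra_def)
  note Rs = subalgebra_subspace[OF R]
  have T_sub: "subspace T" by (simp add: subspace_def T_0 T_add T_scale)
  have W_T: "x \<in> T" if "x \<in> word_span S i" for x i
  proof -
    have "word_span S i \<subseteq> is_subalgebra sc hull S"
      unfolding word_span_def subalgebra_hull_eq_span_words by (rule span_mono) auto
    then show ?thesis using that ST by auto
  qed
  have "x \<in> T \<and> tr x \<in> ?R" if "x \<in> word_span S i" "i \<le> L" for x i
    using that(1) unfolding word_span_def
  proof (induction rule: span_induct_alt)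
    case base then show ?case using Rs by (simp add: T_0 tr_0 subspace_0)
  next
    case (step c u y)
    then obtain w where w: "u = prod_list w" "set w \<subseteq> S" "length w = i" by auto
    have "tr u \<in> ?R" unfolding short_traces_def using w that(2) by (intro hull_inc) auto
    moreover have "u \<in> T" using w W_T word_span_word[of w S] by auto
    ultimately show ?case using Rs step
      by (simp add: T_add tr_add tr_scale T_scale subspace_add subspace_scale)
  qed
  then have W_R: "tr x \<in> ?R" if "x \<in> word_span S i" "i \<le> L" for x i using that by blast
  \<comment> \<open>The vanishing constant term excludes multiples of the empty word: this is the
    augmentation ideal.\<close>
  define P where "P = {p. fps_nth p 0 = 0 \<and> (\<forall>i. fps_nth p i \<in> word_span S i)}"
  \<comment> \<open>The budget \<open>i + m \<le> Suc L\<close> with a nonempty test word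
    \<open>v\<close> is chosen so that both factors stay short. A trace
    \<open>tr (fps_nth x j)\<close> split off from a product leaves at least the \<open>m\<close>
    letters of \<open>v\<close>, so \<open>j \<le> L\<close>; and if \<open>j > 0\<close>, what is
    left has at most \<open>L\<close> letters too.\<close>
  define J where "J = {p. \<forall>i. fps_nth p i \<in> T \<and>
    (\<forall>m v. 1 \<le> m \<longrightarrow> v \<in> word_span S m \<longrightarrow> i + m \<le> Suc L \<longrightarrow> tr (fps_nth p i * v) \<in> ?R)}"
  have PT: "P \<subseteq> fps_T" unfolding P_def fps_T_def by (blast intro: W_T)
  have P_sub: "F.subspace P"
    by (auto simp: F.subspace_def P_def word_span_def span_zero span_add span_scale)
  have P_mult: "x * y \<in> P" if "x \<in> P" "y \<in> P" for x y
  proof -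
    have "fps_nth (x * y) i \<in> word_span S i" for i
      unfolding fps_mult_nth word_span_def
    proof (rule span_sum)
      fix j assume "j \<in> {0..i}"
      then show "fps_nth x j * fps_nth y (i - j) \<in> span {prod_list w | w. set w \<subseteq> S \<and> length w = i}"
        using that word_span_mult[of "fps_nth x j" S j "fps_nth y (i - j)" "i - j"]
        by (simp add: P_def word_span_def)
    qed
    then show ?thesis using that by (simp add: P_def fps_mult_nth)
  qed
  have J_sub: "F.subspace J"
    unfolding F.subspace_def J_def using Rs
    by (auto simp: T_0 T_add T_scale tr_0 tr_add tr_scale T_mult W_T distrib_right sc_mult_left
        subspace_0 subspace_add subspace_scale)
  have JR: "tr (fps_nth y i * v) \<in> ?R"
    if "y \<in> J" "v \<in> word_span S m" "1 \<le> m" "i + m \<le> Suc L" for y i v m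
    using that unfolding J_def by blast
  have JT: "fps_nth y i \<in> T" if "y \<in> J" for y i using that by (simp add: J_def)
  have PT': "fps_nth x i \<in> T" if "x \<in> P" for x i using that W_T by (auto simp: P_def)
  have sum_in_R: "tr (sum f {0..i}) \<in> ?R" if "\<And>j. j \<le> i \<Longrightarrow> f j \<in> T" "\<And>j. j \<le> i \<Longrightarrow> tr (f j) \<in> ?R" for f i
    using that Rs by (subst tr_sum) (auto intro: subspace_sum)
  have PJ: "x * y \<in> J" if x: "x \<in> P" and y: "y \<in> J" for x y
    unfolding J_def
  proof (intro CollectI allI conjI impI)
    fix i
    show "fps_nth (x * y) i \<in> T"
      unfolding fps_mult_nth by (intro T_sum T_mult PT'[OF x] JT[OF y])
    fix m v assume m: "1 \<le> m" "v \<in> word_span S m" "i + m \<le> Suc L"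
    show "tr (fps_nth (x * y) i * v) \<in> ?R"
      unfolding fps_mult_nth sum_distrib_right
    proof (rule sum_in_R)
      fix j assume j: "j \<le> i"
      show "fps_nth x j * fps_nth y (i - j) * v \<in> T"
        by (intro T_mult PT'[OF x] JT[OF y] W_T[OF m(2)])
      \<comment> \<open>Cyclicity of the trace moves the left factor behind \<open>v\<close>, where
        it lengthens the test word by \<open>j\<close>; the total length is unchanged.\<close>
      have "tr (fps_nth x j * (fps_nth y (i - j) * v)) = tr (fps_nth y (i - j) * (v * fps_nth x j))"
        by (subst tr_comm) (auto intro: T_mult PT'[OF x] JT[OF y] W_T[OF m(2)] simp: mult.assoc)
      moreover have "v * fps_nth x j \<in> word_span S (m + j)"
        using word_span_mult m x by (auto simp: P_def)
      ultimately show "tr (fps_nth x j * fps_nth y (i - j) * v) \<in> ?R"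
        using JR[OF y, of "v * fps_nth x j" "m + j" "i - j"] j m by (simp add: mult.assoc)
    qed
  qed
  have JP: "y * x \<in> J" if x: "x \<in> P" and y: "y \<in> J" for x y
    unfolding J_def
  proof (intro CollectI allI conjI impI)
    fix i
    show "fps_nth (y * x) i \<in> T"
      unfolding fps_mult_nth by (intro T_sum T_mult PT'[OF x] JT[OF y])
    fix m v assume m: "1 \<le> m" "v \<in> word_span S m" "i + m \<le> Suc L"
    show "tr (fps_nth (y * x) i * v) \<in> ?R"
      unfolding fps_mult_nth sum_distrib_right
    proof (rule sum_in_R)
      fix j assume j: "j \<le> i"
      show "fps_nth y j * fps_nth x (i - j) * v \<in> T"
        by (intro T_mult PT'[OF x] JT[OF y] W_T[OF m(2)])
      have "fps_nth x (i - j) * v \<in> word_span S (i - j + m)"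
        using word_span_mult m x by (auto simp: P_def)
      then show "tr (fps_nth y j * fps_nth x (i - j) * v) \<in> ?R"
        using JR[OF y, of "fps_nth x (i - j) * v" "i - j + m" j] j m by (simp add: mult.assoc)
    qed
  qed
  have trR: "tr (tr s * t * v) \<in> ?R" if "s \<in> T" "t \<in> T" "v \<in> T" "tr s \<in> ?R" "tr (t * v) \<in> ?R" for s t v
    using that by (simp add: mult.assoc tr_tr T_mult R_mult)
  have trP: "fps_tr x * y \<in> J" if x: "x \<in> P" and y: "y \<in> P" for x y
    unfolding J_def
  proof (intro CollectI allI conjI impI)
    fix i
    show "fps_nth (fps_tr x * y) i \<in> T"
      unfolding fps_mult_nth fps_tr_nth by (intro T_sum T_mult tr_T PT'[OF x] PT'[OF y])
    fix m v assume m: "1 \<le> m" "v \<in> word_span S m" "i + m \<le> Suc L"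
    show "tr (fps_nth (fps_tr x * y) i * v) \<in> ?R"
      unfolding fps_mult_nth sum_distrib_right fps_tr_nth
    proof (rule sum_in_R)
      fix j assume j: "j \<le> i"
      show "tr (fps_nth x j) * fps_nth y (i - j) * v \<in> T"
        by (intro T_mult tr_T PT'[OF x] PT'[OF y] W_T[OF m(2)])
      show "tr (tr (fps_nth x j) * fps_nth y (i - j) * v) \<in> ?R"
      proof (cases "j = 0")
        case True
        then have "fps_nth x j = 0" using x by (simp add: P_def)
        then show ?thesis using Rs by (simp add: tr_0 subspace_0)
      next
        case False
        have "fps_nth y (i - j) * v \<in> word_span S (i - j + m)"
          using word_span_mult m y by (auto simp: P_def)
        then have "tr (fps_nth y (i - j) * v) \<in> ?R" using False j m by (intro W_R) auto
        moreover have "tr (fps_nth x j) \<in> ?R" using j m x by (intro W_R[of _ j]) (auto simp: P_def)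
        ultimately show ?thesis using PT'[OF x] PT'[OF y] W_T[OF m(2)] by (intro trR) auto
      qed
    qed
  qed
  have trJ: "fps_tr x * y \<in> J" if x: "x \<in> P" and y: "y \<in> J" for x y
    unfolding J_def
  proof (intro CollectI allI conjI impI)
    fix i
    show "fps_nth (fps_tr x * y) i \<in> T"
      unfolding fps_mult_nth fps_tr_nth by (intro T_sum T_mult tr_T PT'[OF x] JT[OF y])
    fix m v assume m: "1 \<le> m" "v \<in> word_span S m" "i + m \<le> Suc L"
    show "tr (fps_nth (fps_tr x * y) i * v) \<in> ?R"
      unfolding fps_mult_nth sum_distrib_right fps_tr_nth
    proof (rule sum_in_R)
      fix j assume j: "j \<le> i"
      show "tr (fps_nth x j) * fps_nth y (i - j) * v \<in> T"
        by (intro T_mult tr_T PT'[OF x] JT[OF y] W_T[OF m(2)])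
      have "tr (fps_nth y (i - j) * v) \<in> ?R" using y m j by (auto simp: J_def)
      moreover have "tr (fps_nth x j) \<in> ?R" using j m x by (intro W_R[of _ j]) (auto simp: P_def)
      ultimately show "tr (tr (fps_nth x j) * fps_nth y (i - j) * v) \<in> ?R"
        using PT'[OF x] JT[OF y] W_T[OF m(2)] by (intro trR) auto
    qed
  qed
  have nil: "a ^ Suc n \<in> J" if "a \<in> P" for a
  proof (rule FT.power_in_trace_ideal[OF _ _ _ _ PT P_mult trP trJ that])
    show "0 \<in> J" "\<And>x y. x \<in> J \<Longrightarrow> y \<in> J \<Longrightarrow> x + y \<in> J" "\<And>x. x \<in> J \<Longrightarrow> - x \<in> J"
      using J_sub by (auto intro: F.subspace_0 F.subspace_add F.subspace_neg)
    fix m :: nat and x assume m: "0 < m" "of_nat m * x \<in> J"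
    have "fps_scale (inverse (of_nat m)) (of_nat m * x) \<in> J"
      by (rule F.subspace_scale[OF J_sub m(2)])
    also have "fps_scale (inverse (of_nat m)) (of_nat m * x) = x"
      using m(1) by (simp add: F.sc_of_nat[symmetric])
    finally show "x \<in> J" .
  qed
  \<comment> \<open>Nagata-Higman for nil index \<open>Suc n\<close> consumes a prefix of exactly
    this length. The hypothesis on \<open>L\<close> leaves a nonempty rest \<open>v\<close>, as the
    definition of \<open>J\<close> requires.\<close>
  define N where "N = (2::nat) ^ Suc n - 1"
  define u where "u = take N w"
  define v where "v = drop N w"
  have uv: "w = u @ v" "length u = N" "length v = Suc L - N" "set u \<subseteq> S" "set v \<subseteq> S"
    using w L set_take_subset[of N w] set_drop_subset[of N w] by (auto simp: u_def v_def N_def)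
  have lin: "Abs_fps (\<lambda>i. if i = 1 then a else 0) \<in> P" if "a \<in> S" for a
    using that word_span_word[of "[a]" S] by (auto simp: P_def word_span_def span_zero)
  have "prod_list (map (\<lambda>a. Abs_fps (\<lambda>i. if i = 1 then a else 0)) u) \<in> J"
  proof (rule F.nagata_higman[OF _ P_sub P_mult J_sub PJ JP nil])
    show "set (map (\<lambda>a. Abs_fps (\<lambda>i. if i = 1 then a else 0)) u) \<subseteq> P" using lin uv by auto
  qed (auto simp: uv N_def)
  then have "Abs_fps (\<lambda>i. if i = length u then prod_list u else 0) \<in> J"
    by (simp only: prod_list_fps_linear)
  moreover have "prod_list v \<in> word_span S (length v)" by (rule word_span_word[OF uv(5)])
  moreover have "1 \<le> length v" "length u + length v \<le> Suc L"
    using uv L by (auto simp: N_def)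
  ultimately have "tr (fps_nth (Abs_fps (\<lambda>i. if i = length u then prod_list u else 0)) (length u) * prod_list v) \<in> ?R"
    unfolding J_def by blast
  then show ?thesis by (simp add: uv(1))
qed

text \<open>Traces of words of length \<open>N + k + 1\<close> lie in the algebra generated by
  traces of words of length at most \<open>N + k\<close>, and induction on \<open>k\<close> brings
  everything down to length \<open>N\<close>. That \<open>tr\<close> maps \<open>A\<close> into
  itself makes the set of traces closed under products, by
  \<open>tr a * tr b = tr (tr a * b)\<close>.\<close>

theorem finitely_generated_traces:
  assumes A: "finitely_generated_algebra sc A" and AT: "A \<subseteq> T" and trA: "tr ` A \<subseteq> A"
  shows "finitely_generated_algebra sc (tr ` A)"
proof -
  obtain S where S: "finite S" "is_subalgebra sc hull S = A"
    using A by (auto simp: finitely_generated_algebra_def)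
  have A_alg: "is_subalgebra sc A" using is_subalgebra_hull S(2) by metis
  define N where "N = (2::nat) ^ Suc n - 1"
  let ?R = "short_traces S N"
  have R: "is_subalgebra sc ?R" unfolding short_traces_def by (rule is_subalgebra_hull)
  have word_A: "prod_list w \<in> A" if "set w \<subseteq> S" for w
    using that unfolding S(2)[symmetric] subalgebra_hull_eq_span_words by (intro span_base) auto
  have short: "tr (prod_list w) \<in> ?R" if "set w \<subseteq> S" "length w \<le> N" for w
    using that unfolding short_traces_def by (intro hull_inc) auto
  have long: "tr (prod_list w) \<in> ?R" if "set w \<subseteq> S" "length w \<le> N + k" for w k
    using that
  proof (induction k arbitrary: w)
    case (Suc k)
    show ?case
    proof (cases "length w \<le> N + k")
      case False
      then have "tr (prod_list w) \<in> short_traces S (N + k)"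
        using Suc.prems S AT by (intro trace_of_long_word) (auto simp: N_def)
      also have "short_traces S (N + k) \<subseteq> ?R"
        unfolding short_traces_def[of S "N + k"]
      proof (rule hull_minimal)
        show "is_subalgebra sc ?R" by (rule R)
      qed (auto intro: Suc.IH)
      finally show ?thesis .
    qed (use Suc in auto)
  qed (use short in auto)
  have "x \<in> T \<and> tr x \<in> ?R" if "x \<in> A" for x
    using that unfolding S(2)[symmetric] subalgebra_hull_eq_span_words
  proof (induction rule: span_induct_alt)
    case base then show ?case using subalgebra_subspace[OF R] by (simp add: T_0 tr_0 subspace_0)
  next
    case (step c u y)
    then obtain w where w: "u = prod_list w" "set w \<subseteq> S" by auto
    have "tr u \<in> ?R" using long[of w "length w"] w by simp
    moreover have "u \<in> T" using w word_A AT by auto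
    ultimately show ?case using subalgebra_subspace[OF R] step
      by (simp add: T_add tr_add tr_scale T_scale subspace_add subspace_scale)
  qed
  moreover have "?R \<subseteq> tr ` A"
    unfolding short_traces_def
  proof (rule hull_minimal)
    show "tr ` {prod_list w | w. set w \<subseteq> S \<and> length w \<le> N} \<subseteq> tr ` A" using word_A by auto
    \<comment> \<open>This is not an axiom of \<open>trace_ring\<close>; it comes from
      \<open>matrix_trace\<close> for the identity matrix.\<close>
    have tr_1: "tr 1 = 1"
    proof -
      have "1 * e j = (\<Sum>i<n. \<iota> (if i = j then 1 else 0) * e i)" if "j < n" for j
      proof -
        have "(\<Sum>i<n. \<iota> (if i = j then 1 else 0) * e i) = (\<Sum>i<n. if i = j then e i else 0)"
          by (intro sum.cong) (auto simp: \<iota>_0 \<iota>_1)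
        then show ?thesis using that by simp
      qed
      from matrix_trace[OF T_1 this] have "of_nat n * (tr 1 - 1) = 0"
        by (simp add: \<iota>_1 right_diff_distrib)
      then have "tr 1 - 1 = 0" using torsion_free n_pos by blast
      then show ?thesis by simp
    qed
    show "is_subalgebra sc (tr ` A)"
      unfolding is_subalgebra_def
    proof (intro conjI ballI allI)
      show "1 \<in> tr ` A" using A_alg tr_1 by (auto simp: is_subalgebra_def image_iff intro!: bexI[of _ 1])
      fix x y assume "x \<in> tr ` A" "y \<in> tr ` A"
      then obtain a b where ab: "x = tr a" "y = tr b" "a \<in> A" "b \<in> A" by auto
      have "x + y = tr (a + b)" using ab AT by (simp add: tr_add subset_iff)
      then show "x + y \<in> tr ` A" using ab A_alg by (auto simp: is_subalgebra_def)
      have "x * y = tr (tr a * b)" using ab AT by (simp add: tr_tr subset_iff)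
      then show "x * y \<in> tr ` A" using ab A_alg trA by (auto simp: is_subalgebra_def image_subset_iff)
    next
      fix c x assume "x \<in> tr ` A"
      then obtain a where a: "x = tr a" "a \<in> A" by auto
      then have "sc c x = tr (sc c a)" using AT by (simp add: tr_scale subset_iff)
      then show "sc c x \<in> tr ` A" using a A_alg by (auto simp: is_subalgebra_def)
    qed
  qed
  moreover have "finite {w. set w \<subseteq> S \<and> length w \<le> N}"
    by (rule finite_lists_length_le[OF S(1)])
  then have "finite (tr ` {prod_list w | w. set w \<subseteq> S \<and> length w \<le> N})"
    by (intro finite_imageI) (simp add: setcompr_eq_image)
  ultimately show ?thesis
    unfolding finitely_generated_algebra_def short_traces_def by blast
qed

end

section \<open>Bicharacters and roots of unity\<close>

lemma bichar_add_left: "bichar L (f + g) h = bichar L f h + bichar L g h"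
  by (simp add: bichar_def algebra_simps sum.distrib)

lemma bichar_add_right: "bichar L f (g + h) = bichar L f g + bichar L f h"
  by (simp add: bichar_def algebra_simps sum.distrib)

lemma bichar_uminus_left: "bichar L (- f) g = - bichar L f g"
  by (simp add: bichar_def sum_negf)

lemma bichar_uminus_right: "bichar L f (- g) = - bichar L f g"
  by (simp add: bichar_def sum_negf)

lemma bichar_diff_left: "bichar L (f - g) h = bichar L f h - bichar L g h"
  using bichar_add_left[of L f "- g" h] by (simp add: bichar_uminus_left)

lemma bichar_0_left [simp]: "bichar L 0 g = 0"
  by (simp add: bichar_def)

lemma bichar_0_right [simp]: "bichar L f 0 = 0"
  by (simp add: bichar_def)

lemma bichar_scale_left: "bichar L (c *s f) g = c * bichar L f g"
  by (simp add: bichar_def sum_distrib_left mult.assoc)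

lemma bichar_scale_right: "bichar L f (c *s g) = c * bichar L f g"
  by (simp add: bichar_def sum_distrib_left algebra_simps)

lemma sum_axis_scale: "(\<Sum>i\<in>UNIV. (if i = k then c else 0) * f i) = (c::int) * f (k::'n::finite)"
proof -
  have "(\<Sum>i\<in>UNIV. (if i = k then c else 0) * f i) = (\<Sum>i\<in>UNIV. if i = k then c * f i else 0)"
    by (intro sum.cong) auto
  then show ?thesis by simp
qed

lemma bichar_axis_left: "bichar L (axis i 1) g = (\<Sum>j\<in>UNIV. L$i$j * g$j)"
  using sum_axis_scale[of i 1 "\<lambda>i. \<Sum>j\<in>UNIV. L$i$j * g$j"]
  by (simp add: bichar_def axis_def sum_distrib_left mult.assoc)

lemma bichar_axis_right: "bichar L f (axis j 1) = (\<Sum>i\<in>UNIV. f$i * L$i$j)"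
proof -
  have "(\<Sum>j'\<in>UNIV. f$i * L$i$j' * axis j 1 $ j') = f$i * L$i$j" for i
    using sum_axis_scale[of j 1 "\<lambda>j'. f$i * L$i$j'"] by (simp add: axis_def mult.commute)
  then show ?thesis by (simp add: bichar_def)
qed

lemma bichar_axis_axis: "bichar L (axis i 1) (axis j 1) = L$i$j"
  unfolding bichar_axis_left using sum_axis_scale[of j 1 "\<lambda>j'. L$i$j'"]
  by (simp add: axis_def mult.commute)

lemma bichar_expand_left: "bichar L f g = (\<Sum>i\<in>UNIV. f$i * bichar L (axis i 1) g)"
  by (simp add: bichar_axis_left) (simp add: bichar_def sum_distrib_left mult.assoc)

lemma bichar_expand_right: "bichar L f g = (\<Sum>j\<in>UNIV. g$j * bichar L f (axis j 1))"
  unfolding bichar_axis_right unfolding bichar_def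
  by (subst sum.swap) (simp add: sum_distrib_left mult_ac)

lemma bichar_expand: "bichar L f g = (\<Sum>i\<in>UNIV. f$i * (\<Sum>j\<in>UNIV. g$j * L$i$j))"
  by (subst bichar_expand_left, subst bichar_expand_right) (simp add: bichar_axis_axis)

lemma bichar_skew:
  assumes "skew_mod l L"
  shows "[bichar L f g = - bichar L g f] (mod int l)"
proof -
  have "bichar L g f = (\<Sum>i\<in>UNIV. \<Sum>j\<in>UNIV. f$i * (L$j$i * g$j))"
    unfolding bichar_def by (subst sum.swap) (simp add: mult_ac)
  then have "- bichar L g f = (\<Sum>i\<in>UNIV. \<Sum>j\<in>UNIV. f$i * (- L$j$i) * g$j)"
    by (simp add: sum_negf[symmetric] mult_ac)
  then show ?thesis
    using assms unfolding bichar_def skew_mod_def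
    by (simp only:) (intro cong_sum cong_mult cong_refl, auto)
qed

text \<open>Skew-symmetry modulo \<open>l\<close> gives only twice the claim; as \<open>l\<close> is
  odd, the factor 2 cancels.\<close>

lemma bichar_self:
  assumes "skew_mod l L" "odd l"
  shows "[bichar L f f = 0] (mod int l)"
proof -
  have "[2 * bichar L f f = 2 * 0] (mod int l)"
    using bichar_skew[OF assms(1), of f f] by (simp add: cong_iff_dvd_diff)
  then show ?thesis
    by (rule cong_mult_lcancel[THEN iffD1, rotated])
      (use \<open>odd l\<close> in \<open>simp add: coprime_left_2_iff_odd\<close>)
qed

text \<open>The sublattice of exponents whose monomials are central in the torus, whatever the
  bicharacter.\<close>

definition dvd_vec :: "nat \<Rightarrow> int^'n::finite \<Rightarrow> bool" where
  "dvd_vec l f \<longleftrightarrow> (\<forall>i. int l dvd f$i)"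

lemma dvd_vec_scale: "dvd_vec l (int l *s f)"
  by (simp add: dvd_vec_def)

lemma dvd_vec_0 [simp]: "dvd_vec l 0"
  by (simp add: dvd_vec_def)

lemma dvd_vec_add_right: "dvd_vec l f \<Longrightarrow> dvd_vec l (f + g) \<longleftrightarrow> dvd_vec l g"
  by (simp add: dvd_vec_def dvd_add_right_iff)

lemma dvd_vecE:
  assumes "dvd_vec l f"
  obtains g where "f = int l *s g"
proof
  show "f = int l *s (\<chi> i. f$i div int l)"
    using assms by (simp add: dvd_vec_def Finite_Cartesian_Product.vec_eq_iff)
qed

lemma bichar_dvd_left: "dvd_vec l f \<Longrightarrow> [bichar L f g = 0] (mod int l)"
  by (elim dvd_vecE) (simp add: bichar_scale_left cong_0_iff)

lemma bichar_dvd_right: "dvd_vec l g \<Longrightarrow> [bichar L f g = 0] (mod int l)"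
  by (elim dvd_vecE) (simp add: bichar_scale_right cong_0_iff)

text \<open>Induction on the sum of absolute values. Restricting the steps to \<open>U\<close> and
  \<open>V\<close> permits an induction that stays inside a coordinate hyperplane, where two
  adjacent frames agree.\<close>

lemma int_vec_induct [case_names zero add diff]:
  fixes f :: "int^'n::finite"
  assumes zero: "P 0"
    and add: "\<And>f i. i \<in> U \<Longrightarrow> P f \<Longrightarrow> P (f + axis i 1)"
    and diff: "\<And>f i. i \<in> V \<Longrightarrow> P f \<Longrightarrow> P (f - axis i 1)"
    and f: "\<And>i. i \<notin> U \<Longrightarrow> f$i \<le> 0" "\<And>i. i \<notin> V \<Longrightarrow> f$i \<ge> 0"
  shows "P f"
  using f
proof (induction "\<Sum>i\<in>UNIV. nat \<bar>f$i\<bar>" arbitrary: f rule: less_induct)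
  case less
  show ?case
  proof (cases "f = 0")
    case False
    then obtain i where i: "f$i \<noteq> 0" by (auto simp: Finite_Cartesian_Product.vec_eq_iff)
    have smaller: "(\<Sum>j\<in>UNIV. nat \<bar>g$j\<bar>) < (\<Sum>j\<in>UNIV. nat \<bar>f$j\<bar>)"
      if "\<And>j. j \<noteq> i \<Longrightarrow> g$j = f$j" "nat \<bar>g$i\<bar> < nat \<bar>f$i\<bar>" for g
    proof (rule sum_strict_mono_ex1)
      have "nat \<bar>g$j\<bar> \<le> nat \<bar>f$j\<bar>" for j using that by (cases "j = i") auto
      then show "\<forall>j\<in>UNIV. nat \<bar>g$j\<bar> \<le> nat \<bar>f$j\<bar>" by blast
    qed (use that in auto)
    consider "f$i > 0" | "f$i < 0" using i by linarith
    then show ?thesis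
    proof cases
      case 1
      then have "i \<in> U" using less.prems(1)[of i] by force
      have "P (f - axis i 1)"
      proof (rule less.hyps)
        show "(\<Sum>j\<in>UNIV. nat \<bar>(f - axis i 1)$j\<bar>) < (\<Sum>j\<in>UNIV. nat \<bar>f$j\<bar>)"
          using 1 by (intro smaller) (auto simp: axis_def)
      qed (use 1 less.prems in \<open>force simp: axis_def\<close>)+
      from add[OF \<open>i \<in> U\<close> this] show ?thesis by simp
    next
      case 2
      then have "i \<in> V" using less.prems(2)[of i] by force
      have "P (f + axis i 1)"
      proof (rule less.hyps)
        show "(\<Sum>j\<in>UNIV. nat \<bar>(f + axis i 1)$j\<bar>) < (\<Sum>j\<in>UNIV. nat \<bar>f$j\<bar>)"
          using 2 by (intro smaller) (auto simp: axis_def)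
      qed (use 2 less.prems in \<open>force simp: axis_def\<close>)+
      from diff[OF \<open>i \<in> V\<close> this] show ?thesis by simp
    qed
  qed (simp add: zero)
qed

section \<open>Powers of a primitive root of unity\<close>

context
  fixes l :: nat and q :: "'k::field"
  assumes prim: "primitive_root_of_unity l q"
begin

lemma root_of_unity_nonzero: "q \<noteq> 0"
  using prim by (auto simp: primitive_root_of_unity_def power_0_left)

lemma powi_eq_1_iff: "q powi a = 1 \<longleftrightarrow> int l dvd a"
proof -
  have l: "l > 0" and ql: "q ^ l = 1" and m: "\<And>m. 0 < m \<Longrightarrow> m < l \<Longrightarrow> q ^ m \<noteq> 1"
    using prim by (auto simp: primitive_root_of_unity_def)
  define r where "r = nat (a mod int l)"
  have r: "int r = a mod int l" "r < l" using l by (auto simp: r_def nat_less_iff)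
  have "q powi a = q powi (int l * (a div int l) + int r)" by (simp add: r)
  also have "\<dots> = (q powi int l) powi (a div int l) * q ^ r"
    by (subst power_int_add) (auto simp: root_of_unity_nonzero power_int_mult)
  also have "\<dots> = q ^ r" by (simp add: ql)
  finally have "q powi a = q ^ r" .
  moreover have "q ^ r = 1 \<longleftrightarrow> r = 0" using m[of r] r(2) by (cases "r = 0") auto
  moreover have "r = 0 \<longleftrightarrow> int l dvd a" using r(1) by (metis dvd_eq_mod_eq_0 of_nat_0 of_nat_eq_iff)
  ultimately show ?thesis by simp
qed

lemma powi_eq_iff_cong: "q powi a = q powi b \<longleftrightarrow> [a = b] (mod int l)"
proof -
  have "q powi a = q powi b \<longleftrightarrow> q powi (a - b) = 1"
    by (simp add: power_int_diff root_of_unity_nonzero)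
  then show ?thesis by (simp add: powi_eq_1_iff cong_iff_dvd_diff)
qed

end

section \<open>The Frobenius identity\<close>

text \<open>Gaussian binomial coefficients, given by the Pascal rule because the quotient formula
  would divide by zero at a root of unity.\<close>

primrec gauss_coeff :: "'k::field \<Rightarrow> nat \<Rightarrow> nat \<Rightarrow> 'k" where
  "gauss_coeff z 0 i = (if i = 0 then 1 else 0)"
| "gauss_coeff z (Suc m) i = (if i = 0 then 0 else gauss_coeff z m (i - 1)) + z ^ i * gauss_coeff z m i"

lemma gauss_coeff_eq_0: "m < i \<Longrightarrow> gauss_coeff z m i = 0"
  by (induction m arbitrary: i) auto

lemma gauss_coeff_0 [simp]: "gauss_coeff z m 0 = 1"
  by (induction m) auto

lemma gauss_coeff_diag [simp]: "gauss_coeff z m m = 1"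
  by (induction m) (auto simp: gauss_coeff_eq_0)

text \<open>The quotient formula with denominators cleared. In the induction step both sides are
  equal to \<open>(1 - z ^ Suc m) * gauss_coeff z m i\<close>.\<close>

lemma gauss_coeff_step:
  "i \<le> m \<Longrightarrow> (1 - z ^ Suc i) * gauss_coeff z m (Suc i) = (1 - z ^ (m - i)) * gauss_coeff z m i"
proof (induction m arbitrary: i)
  case (Suc m)
  show ?case
  proof (cases "i = Suc m")
    case False
    then have i: "i \<le> m" using Suc.prems by simp
    have zi: "z ^ Suc i * z ^ (m - i) = z ^ Suc m"
      using i by (simp add: power_add[symmetric])
    have "(1 - z ^ Suc i) * gauss_coeff z (Suc m) (Suc i)
        = (1 - z ^ Suc i) * gauss_coeff z m i + z ^ Suc i * ((1 - z ^ Suc i) * gauss_coeff z m (Suc i))"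
      by (simp add: algebra_simps)
    also have "\<dots> = (1 - z ^ Suc m) * gauss_coeff z m i"
      unfolding Suc.IH[OF i] zi[symmetric] by (simp add: algebra_simps)
    also have "\<dots> = (1 - z ^ (Suc m - i)) * gauss_coeff z (Suc m) i"
    proof (cases i)
      case 0
      then show ?thesis by simp
    next
      case (Suc j)
      have "m - j = Suc m - i" using Suc by simp
      then have IH: "(1 - z ^ (Suc m - i)) * gauss_coeff z m j = (1 - z ^ i) * gauss_coeff z m i"
        using Suc.IH[of j] Suc i by simp
      have zi': "z ^ i * z ^ (Suc m - i) = z ^ Suc m"
        using i by (simp add: power_add[symmetric])
      have "(1 - z ^ (Suc m - i)) * gauss_coeff z (Suc m) i
          = (1 - z ^ (Suc m - i)) * gauss_coeff z m j + (z ^ i - z ^ i * z ^ (Suc m - i)) * gauss_coeff z m i"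
        using Suc by (simp add: algebra_simps)
      also have "\<dots> = (1 - z ^ Suc m) * gauss_coeff z m i"
        unfolding IH zi' by (simp add: algebra_simps)
      finally show ?thesis by simp
    qed
    finally show ?thesis .
  qed (simp add: gauss_coeff_eq_0)
qed (simp)

text \<open>For \<open>m = l\<close> the factor \<open>1 - z ^ l\<close> kills the coefficient at 1.
  The zero propagates up to \<open>l - 1\<close>, because \<open>1 - z ^ i\<close> is nonzero on
  that range.\<close>

lemma gauss_coeff_root_of_unity:
  assumes "primitive_root_of_unity l z" "0 < i" "i < l"
  shows "gauss_coeff z l i = 0"
  using assms(2,3)
proof (induction i)
  case (Suc i)
  have z: "z ^ l = 1" "z ^ Suc i \<noteq> 1"
    using assms(1) Suc.prems by (auto simp: primitive_root_of_unity_def)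
  have "(1 - z ^ Suc i) * gauss_coeff z l (Suc i) = 0"
    using gauss_coeff_step[of i l z] Suc z(1) by (cases "i = 0") auto
  then show ?case using z(2) by simp
qed simp

context algebra_over
begin

lemma quantum_binomial:
  assumes yx: "y * x = sc z (x * y)"
  shows "(x + y) ^ m = (\<Sum>i\<le>m. sc (gauss_coeff z m i) (x ^ i * y ^ (m - i)))"
proof (induction m)
  case (Suc m)
  have yxi: "y * x ^ i = sc (z ^ i) (x ^ i * y)" for i
  proof (induction i)
    case (Suc i)
    have "y * x ^ Suc i = sc z (x * (y * x ^ i))"
      by (simp add: mult.assoc[symmetric] yx sc_mult_left)
    then show ?case by (simp add: Suc sc_mult_right mult.assoc)
  qed simp
  have x: "x * (\<Sum>i\<le>m. sc (gauss_coeff z m i) (x ^ i * y ^ (m - i)))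
    = (\<Sum>i\<le>Suc m. sc (if i = 0 then 0 else gauss_coeff z m (i - 1)) (x ^ i * y ^ (Suc m - i)))"
    by (subst sum.atMost_Suc_shift) (simp add: sum_distrib_left sc_mult_right mult.assoc)
  have y: "y * (\<Sum>i\<le>m. sc (gauss_coeff z m i) (x ^ i * y ^ (m - i)))
    = (\<Sum>i\<le>Suc m. sc (z ^ i * gauss_coeff z m i) (x ^ i * y ^ (Suc m - i)))"
  proof -
    have "y * sc (gauss_coeff z m i) (x ^ i * y ^ (m - i)) = sc (z ^ i * gauss_coeff z m i) (x ^ i * y ^ (Suc m - i))"
      if "i \<le> m" for i
      using that
      by (simp add: sc_mult_right sc_mult_left mult.assoc[symmetric] yxi Suc_diff_le mult.commute)
    then show ?thesis by (simp add: sum_distrib_left gauss_coeff_eq_0)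
  qed
  show ?case
    unfolding power_Suc Suc distrib_right x y
    by (simp add: scale_left_distrib sum.distrib[symmetric] gauss_coeff.simps(2) del: sum.atMost_Suc)
qed simp

lemma frobenius:
  assumes "y * x = sc z (x * y)" "primitive_root_of_unity l z"
  shows "(x + y) ^ l = x ^ l + y ^ l"
proof -
  have l: "l > 0" using assms(2) by (simp add: primitive_root_of_unity_def)
  have "(x + y) ^ l = (\<Sum>i\<le>l. sc (gauss_coeff z l i) (x ^ i * y ^ (l - i)))"
    by (rule quantum_binomial[OF assms(1)])
  also have "\<dots> = (\<Sum>i\<in>{0, l}. sc (gauss_coeff z l i) (x ^ i * y ^ (l - i)))"
    using l gauss_coeff_root_of_unity[OF assms(2)]
    by (intro sum.mono_neutral_right) (auto simp: le_less)
  also have "\<dots> = x ^ l + y ^ l" using l by simp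
  finally show ?thesis .
qed

end

section \<open>Toric frames\<close>

lemma poly_mapping_sum_single:
  "(\<Sum>f\<in>Poly_Mapping.keys a. Poly_Mapping.single f (Poly_Mapping.lookup a f)) = a"
proof (rule poly_mapping_eqI)
  fix g
  have "(\<Sum>f\<in>Poly_Mapping.keys a. Poly_Mapping.lookup (Poly_Mapping.single f (Poly_Mapping.lookup a f)) g)
      = (\<Sum>f\<in>Poly_Mapping.keys a. if f = g then Poly_Mapping.lookup a g else 0)"
    by (intro sum.cong) (auto simp: lookup_single when_def)
  then show "Poly_Mapping.lookup (\<Sum>f\<in>Poly_Mapping.keys a. Poly_Mapping.single f (Poly_Mapping.lookup a f)) g
      = Poly_Mapping.lookup a g"
    by (simp add: lookup_sum in_keys_iff)
qed

locale div_algebra = algebra_over sc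
  for sc :: "'k::field \<Rightarrow> 'd::division_ring \<Rightarrow> 'd"
begin

lemma frame_extension_superset:
  assumes "finite A" "Poly_Mapping.keys a \<subseteq> A"
  shows "frame_extension sc M a = (\<Sum>f\<in>A. sc (Poly_Mapping.lookup a f) (M f))"
  unfolding frame_extension_def using assms
  by (intro sum.mono_neutral_left) (auto simp: in_keys_iff)

lemma frame_extension_0 [simp]: "frame_extension sc M 0 = 0"
  by (simp add: frame_extension_def)

lemma frame_extension_add:
  "frame_extension sc M (a + b) = frame_extension sc M a + frame_extension sc M b"
  by (subst (1 2 3) frame_extension_superset[of "Poly_Mapping.keys a \<union> Poly_Mapping.keys b"])
    (auto simp: lookup_add scale_left_distrib sum.distrib dest: Poly_Mapping.keys_add[THEN subsetD])

lemma frame_extension_sum: "frame_extension sc M (sum a I) = (\<Sum>i\<in>I. frame_extension sc M (a i))"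
  by (induction I rule: infinite_finite_induct) (auto simp: frame_extension_add)

lemma frame_extension_single [simp]: "frame_extension sc M (Poly_Mapping.single f c) = sc c (M f)"
  by (subst frame_extension_superset[of "{f}"]) auto

lemma frame_extension_scale:
  "frame_extension sc M (Poly_Mapping.map ((*) c) a) = sc c (frame_extension sc M a)"
proof -
  have "Poly_Mapping.lookup (Poly_Mapping.map ((*) c) a) f = c * Poly_Mapping.lookup a f" for f
    by (simp add: Poly_Mapping.map.rep_eq when_def)
  then show ?thesis
    by (subst frame_extension_superset[of "Poly_Mapping.keys a"])
      (auto simp: frame_extension_def scale_sum_right in_keys_iff)
qed

lemma range_frame_extension: "range (frame_extension sc M) = span (range M)"
proof
  show "range (frame_extension sc M) \<subseteq> span (range M)"
  proof
    fix x assume "x \<in> range (frame_extension sc M)"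
    then obtain a where "x = (\<Sum>f\<in>Poly_Mapping.keys a. sc (Poly_Mapping.lookup a f) (M f))"
      by (auto simp: frame_extension_def)
    moreover have "(\<Sum>f\<in>Poly_Mapping.keys a. sc (Poly_Mapping.lookup a f) (M f)) \<in> span (range M)"
      by (intro span_sum span_scale span_base) auto
    ultimately show "x \<in> span (range M)" by simp
  qed
  show "span (range M) \<subseteq> range (frame_extension sc M)"
  proof
    fix x assume "x \<in> span (range M)"
    then show "x \<in> range (frame_extension sc M)"
    proof (induction rule: span_induct_alt)
      case base then show ?case by (metis frame_extension_0 rangeI)
    next
      case (step c u y)
      then obtain f a where "u = M f" "y = frame_extension sc M a" by auto
      then have "sc c u + y = frame_extension sc M (Poly_Mapping.single f c + a)"
        by (simp add: frame_extension_add)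
      then show ?case by simp
    qed
  qed
qed

lemma frame_extension_qtorus_mult:
  assumes "\<And>f g. M f * M g = sc (q powi bichar L f g) (M (f + g))"
  shows "frame_extension sc M (qtorus_mult q L a b) = frame_extension sc M a * frame_extension sc M b"
  unfolding qtorus_mult_def frame_extension_sum frame_extension_single
  by (simp add: frame_extension_def sum_product sc_mult_left sc_mult_right assms mult_ac)

lemma frame_extension_mult:
  assumes "\<And>f g. M f * M g = M (f + g)"
  shows "frame_extension sc M (a * b) = frame_extension sc M a * frame_extension sc M b"
proof -
  have "a * b = (\<Sum>f\<in>Poly_Mapping.keys a. Poly_Mapping.single f (Poly_Mapping.lookup a f))
      * (\<Sum>g\<in>Poly_Mapping.keys b. Poly_Mapping.single g (Poly_Mapping.lookup b g))"
    by (simp add: poly_mapping_sum_single)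
  also have "\<dots> = (\<Sum>f\<in>Poly_Mapping.keys a. \<Sum>g\<in>Poly_Mapping.keys b.
      Poly_Mapping.single (f + g) (Poly_Mapping.lookup a f * Poly_Mapping.lookup b g))"
    by (simp add: sum_product mult_single)
  finally show ?thesis
    by (simp add: frame_extension_sum) (simp add: frame_extension_def sum_product sc_mult_left sc_mult_right assms mult_ac)
qed

text \<open>Bilinear induction. The cases retain membership in the spans because projections of a
  torus are known to be linear only there.\<close>

lemma span_induct2 [consumes 2, case_names base zero_left zero_right add_left add_right scale_left scale_right]:
  assumes "x \<in> span A" "y \<in> span B"
    and "\<And>a b. a \<in> A \<Longrightarrow> b \<in> B \<Longrightarrow> P a b"
    and "\<And>y. y \<in> span B \<Longrightarrow> P 0 y" "\<And>x. x \<in> span A \<Longrightarrow> P x 0"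
    and "\<And>x x' y. x \<in> span A \<Longrightarrow> x' \<in> span A \<Longrightarrow> y \<in> span B \<Longrightarrow> P x y \<Longrightarrow> P x' y \<Longrightarrow> P (x + x') y"
    and "\<And>x y y'. x \<in> span A \<Longrightarrow> y \<in> span B \<Longrightarrow> y' \<in> span B \<Longrightarrow> P x y \<Longrightarrow> P x y' \<Longrightarrow> P x (y + y')"
    and "\<And>c x y. x \<in> span A \<Longrightarrow> y \<in> span B \<Longrightarrow> P x y \<Longrightarrow> P (sc c x) y"
    and "\<And>c x y. x \<in> span A \<Longrightarrow> y \<in> span B \<Longrightarrow> P x y \<Longrightarrow> P x (sc c y)"
  shows "P x y"
proof -
  have "y \<in> span B \<and> P a y" if a: "a \<in> A" for a
    using assms(2)
  proof (induction rule: span_induct_alt)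
    case base show ?case using assms(5) a by (auto intro: span_base span_zero)
  next
    case (step c u y)
    then have "u \<in> span B" "P a u" using a assms(3) by (auto intro: span_base)
    then have "sc c u \<in> span B" "P a (sc c u)" using a assms(9) by (auto intro: span_base span_scale)
    then show ?case using a assms(7) step by (auto intro: span_base span_add)
  qed
  then have y: "\<And>a. a \<in> A \<Longrightarrow> P a y" by blast
  have "x \<in> span A \<and> P x y"
    using assms(1)
  proof (induction rule: span_induct_alt)
    case base show ?case using assms(2,4) by (auto intro: span_zero)
  next
    case (step c u x)
    then have "u \<in> span A" "P u y" using y by (auto intro: span_base)
    then have "sc c u \<in> span A" "P (sc c u) y" using assms(2,8) by (auto intro: span_scale)
    then show ?case using assms(2,6) step by (auto intro: span_add)
  qed
  then show ?thesis by blast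
qed

end

section \<open>Projections along an independent family of monomials\<close>

locale independent_family = div_algebra sc
  for sc :: "'k::field \<Rightarrow> 'd::division_ring \<Rightarrow> 'd" +
  fixes M :: "int^'n::finite \<Rightarrow> 'd"
  assumes inj_frame: "inj (frame_extension sc M)"
begin

lemma frame_extension_eq_0_iff [simp]: "frame_extension sc M a = 0 \<longleftrightarrow> a = 0"
  using inj_frame by (metis frame_extension_0 injD)

lemma M_nonzero: "M f \<noteq> 0"
proof -
  have "Poly_Mapping.lookup (Poly_Mapping.single f (1::'k)) f \<noteq> Poly_Mapping.lookup 0 f"
    by (simp add: lookup_single)
  then have "Poly_Mapping.single f (1::'k) \<noteq> 0" by metis
  then show ?thesis using frame_extension_eq_0_iff[of "Poly_Mapping.single f 1"]
    by (simp del: frame_extension_eq_0_iff)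
qed

text \<open>Meaningful only on the span of the family, since elsewhere \<open>inv_into\<close> has
  no preimage to return; hence the span hypotheses of the linearity lemmas.\<close>

definition proj :: "(int^'n \<Rightarrow> bool) \<Rightarrow> 'd \<Rightarrow> 'd" where
  "proj Q x = frame_extension sc M
     (Poly_Mapping.mapp (\<lambda>f c. if Q f then c else 0) (inv_into UNIV (frame_extension sc M) x))"

lemma proj_frame_extension:
  "proj Q (frame_extension sc M a) = frame_extension sc M (Poly_Mapping.mapp (\<lambda>f c. if Q f then c else 0) a)"
  by (simp add: proj_def inv_f_f[OF inj_frame])

lemma proj_add:
  assumes "x \<in> span (range M)" "y \<in> span (range M)"
  shows "proj Q (x + y) = proj Q x + proj Q y"
proof -
  obtain a b where ab: "x = frame_extension sc M a" "y = frame_extension sc M b"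
    using assms by (auto simp: range_frame_extension[symmetric])
  have "Poly_Mapping.mapp (\<lambda>f c. if Q f then c else 0) (a + b)
      = Poly_Mapping.mapp (\<lambda>f c. if Q f then c else 0) a + Poly_Mapping.mapp (\<lambda>f c. if Q f then c else 0) b"
    by (rule poly_mapping_eqI) (auto simp: lookup_mapp lookup_add when_def in_keys_iff)
  then show ?thesis
    by (simp add: ab frame_extension_add[symmetric] proj_frame_extension)
qed

lemma proj_scale:
  assumes "x \<in> span (range M)"
  shows "proj Q (sc c x) = sc c (proj Q x)"
proof -
  obtain a where a: "x = frame_extension sc M a"
    using assms by (auto simp: range_frame_extension[symmetric])
  have "Poly_Mapping.mapp (\<lambda>f c. if Q f then c else 0) (Poly_Mapping.map ((*) c) a)
      = Poly_Mapping.map ((*) c) (Poly_Mapping.mapp (\<lambda>f c. if Q f then c else 0) a)"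
    by (rule poly_mapping_eqI) (auto simp: lookup_mapp Poly_Mapping.map.rep_eq when_def in_keys_iff)
  then show ?thesis
    by (simp add: a frame_extension_scale[symmetric] proj_frame_extension)
qed

lemma proj_M: "proj Q (M f) = (if Q f then M f else 0)"
proof -
  have "Poly_Mapping.mapp (\<lambda>f c. if Q f then c else 0) (Poly_Mapping.single f 1)
      = (if Q f then Poly_Mapping.single f 1 else (0 :: (int^'n) \<Rightarrow>\<^sub>0 'k))"
    by (rule poly_mapping_eqI) (auto simp: lookup_mapp lookup_single when_def in_keys_iff)
  then show ?thesis
    using proj_frame_extension[of Q "Poly_Mapping.single f 1"] by simp
qed

lemma proj_0 [simp]: "proj Q 0 = 0"
  using proj_scale[OF span_zero, of Q 0] by simp

lemma proj_sum:
  "(\<And>i. i \<in> I \<Longrightarrow> f i \<in> span (range M)) \<Longrightarrow> proj Q (sum f I) = (\<Sum>i\<in>I. proj Q (f i))"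
  by (induction I rule: infinite_finite_induct) (auto simp: proj_add span_sum)

lemma span_subset_torus: "span {M f | f. P f} \<subseteq> span (range M)"
  by (rule span_mono) auto

lemma proj_in_span:
  assumes "x \<in> span {M f | f. P f}"
  shows "proj Q x \<in> span {M f | f. P f \<and> Q f}"
proof -
  have "x \<in> span (range M) \<and> proj Q x \<in> span {M f | f. P f \<and> Q f}"
    using assms
  proof (induction rule: span_induct_alt)
    case base show ?case by (simp add: span_zero)
  next
    case (step c u y)
    then obtain f where f: "u = M f" "P f" by auto
    have "proj Q u \<in> span {M f | f. P f \<and> Q f}"
      using f by (auto simp: proj_M intro: span_zero span_base)
    then show ?case using step f
      by (auto simp: proj_add proj_scale span_scale span_base intro!: span_add span_scale)
  qed
  then show ?thesis by blast
qed

lemma proj_id: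
  assumes "x \<in> span {M f | f. P f}" "\<And>f. P f \<Longrightarrow> Q f"
  shows "proj Q x = x"
proof -
  have "x \<in> span (range M) \<and> proj Q x = x"
    using assms(1)
  proof (induction rule: span_induct_alt)
    case (step c u y)
    then show ?case using assms(2)
      by (auto simp: proj_add proj_scale proj_M span_base span_scale intro!: span_add)
  qed (simp add: span_zero)
  then show ?thesis by blast
qed

lemma proj_eq_0:
  assumes "x \<in> span {M f | f. P f}" "\<And>f. P f \<Longrightarrow> \<not> Q f"
  shows "proj Q x = 0"
proof -
  have "{M f | f. P f \<and> Q f} = {}" using assms(2) by auto
  with proj_in_span[OF assms(1), of Q] show ?thesis by (simp del: empty_Collect_eq)
qed

end

section \<open>The quantum torus of a frame and its normalised trace\<close>

locale frame = div_algebra sc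
  for sc :: "'k::field_char_0 \<Rightarrow> 'd::division_ring \<Rightarrow> 'd" +
  fixes q :: 'k and l :: nat and L :: "int^'n::finite^'n" and M :: "int^'n \<Rightarrow> 'd"
  assumes prim: "primitive_root_of_unity l q" and odd: "odd l"
    and toric: "toric_frame sc q l L M"
begin

sublocale independent_family sc M
  using toric by unfold_locales (simp add: toric_frame_def)

lemma l_pos: "l > 0"
  using odd by (cases l) auto

lemma skew: "skew_mod l L"
  using toric by (simp add: toric_frame_def)

lemma M_0 [simp]: "M 0 = 1"
proof -
  have "frame_extension sc M (Poly_Mapping.single 0 1) = 1"
    using toric unfolding toric_frame_def by blast
  then show ?thesis unfolding frame_extension_single by simp
qed

lemma M_mult: "M f * M g = sc (q powi bichar L f g) (M (f + g))"
proof -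
  have "frame_extension sc M (qtorus_mult q L (Poly_Mapping.single f 1) (Poly_Mapping.single g 1))
     = frame_extension sc M (Poly_Mapping.single f 1) * frame_extension sc M (Poly_Mapping.single g 1)"
    using toric unfolding toric_frame_def by blast
  then show ?thesis by (simp add: qtorus_mult_def)
qed

lemma fractions: "\<exists>a b. frame_extension sc M b \<noteq> 0
    \<and> y = frame_extension sc M a * inverse (frame_extension sc M b)"
  using toric unfolding toric_frame_def by blast

lemma q_nonzero: "q \<noteq> 0"
  by (rule root_of_unity_nonzero[OF prim])

lemma powi_cong: "[a = b] (mod int l) \<Longrightarrow> q powi a = q powi b"
  using powi_eq_iff_cong[OF prim] by blast

lemma powi_0_cong: "[a = 0] (mod int l) \<Longrightarrow> q powi a = 1"
  using powi_cong[of a 0] by simp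

lemma M_mult_dvd_left: "dvd_vec l f \<Longrightarrow> M f * M g = M (f + g)"
  by (simp add: M_mult powi_0_cong bichar_dvd_left)

lemma M_mult_dvd_right: "dvd_vec l g \<Longrightarrow> M f * M g = M (f + g)"
  by (simp add: M_mult powi_0_cong bichar_dvd_right)

lemma M_add: "M (f + g) = sc (q powi (- bichar L f g)) (M f * M g)"
  by (simp add: M_mult power_int_minus q_nonzero)

text \<open>By oddness of \<open>l\<close> the bicharacter vanishes on the diagonal modulo
  \<open>l\<close>, so no power of \<open>q\<close> accumulates.\<close>

lemma M_power: "M f ^ m = M (int m *s f)"
proof (induction m)
  case (Suc m)
  have "[bichar L f (int m *s f) = 0] (mod int l)"
    using cong_mult[OF cong_refl bichar_self[OF skew odd], of "int m" f]
    by (simp add: bichar_scale_right)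
  moreover have "f + int m *s f = int (Suc m) *s f"
    by (simp add: Finite_Cartesian_Product.vec_eq_iff distrib_right)
  ultimately show ?case by (simp add: Suc M_mult powi_0_cong)
next
  case 0
  have "(0::int) *s f = 0" by (simp add: Finite_Cartesian_Product.vec_eq_iff)
  then show ?case by simp
qed

lemma M_uminus: "M (- f) = inverse (M f)"
proof -
  have "[- bichar L f f = 0] (mod int l)"
    using bichar_self[OF skew odd, of f] by (simp add: cong_0_iff)
  then have "M f * M (- f) = 1"
    by (simp add: M_mult bichar_uminus_right powi_0_cong)
  then show ?thesis by (simp add: inverse_unique)
qed

abbreviation torus :: "'d set" where
  "torus \<equiv> span (range M)"

lemma M_in_torus [simp]: "M f \<in> torus"
  by (simp add: span_base)

lemma span_M_mult:
  assumes "x \<in> span {M f | f. P f}" "y \<in> span {M f | f. Q f}" "\<And>f g. P f \<Longrightarrow> Q g \<Longrightarrow> R (f + g)"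
  shows "x * y \<in> span {M f | f. R f}"
  using assms(1,2)
proof (induction rule: span_induct2)
  case (base a b)
  then obtain f g where "a = M f" "P f" "b = M g" "Q g" by auto
  then have "M (f + g) \<in> {M f | f. R f}" "a * b = sc (q powi bichar L f g) (M (f + g))"
    using assms(3) by (auto simp: M_mult)
  then show ?case by (auto intro: span_scale span_base)
qed (auto simp: span_zero distrib_left distrib_right sc_mult_left sc_mult_right intro: span_add span_scale)

lemma torus_mult: "x \<in> torus \<Longrightarrow> y \<in> torus \<Longrightarrow> x * y \<in> torus"
  using span_M_mult[of x "\<lambda>_. True" y "\<lambda>_. True" "\<lambda>_. True"] by (simp add: full_SetCompr_eq)

abbreviation central_torus :: "'d set" where
  "central_torus \<equiv> span {M f | f. dvd_vec l f}"

abbreviation tr :: "'d \<Rightarrow> 'd" where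
  "tr \<equiv> proj (dvd_vec l)"

lemma central_torus_central:
  assumes "z \<in> central_torus" "x \<in> torus"
  shows "z * x = x * z"
  using assms
proof (induction rule: span_induct2)
  case (base a b)
  then show ?case by (auto simp: M_mult_dvd_left M_mult_dvd_right add.commute)
qed (auto simp: distrib_left distrib_right sc_mult_left sc_mult_right)

lemma tr_central_mult:
  assumes "z \<in> central_torus" "x \<in> torus"
  shows "tr (z * x) = z * tr x"
proof -
  have "z * x \<in> torus \<and> tr (z * x) = z * tr x"
    using assms
  proof (induction rule: span_induct2)
    case (base a b)
    then show ?case
      by (auto simp: M_mult_dvd_left proj_M dvd_vec_add_right)
  qed (auto simp: distrib_left distrib_right sc_mult_left sc_mult_right proj_add proj_scale
      intro: span_zero span_add span_scale)
  then show ?thesis by blast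
qed

lemma tr_in_central_torus: "x \<in> torus \<Longrightarrow> tr x \<in> central_torus"
  using proj_in_span[of x "\<lambda>_. True" "dvd_vec l"] by (simp add: full_SetCompr_eq)

lemma central_torus_subset: "central_torus \<subseteq> torus"
  by (rule span_subset_torus)

text \<open>On monomials both traces vanish unless \<open>f + g\<close> is a multiple of
  \<open>l\<close>. In that case pairing \<open>f\<close> with \<open>f + g\<close> on either side
  gives 0, so \<open>bichar L f g\<close> and \<open>bichar L g f\<close> agree modulo
  \<open>l\<close> and the two products coincide.\<close>

lemma tr_comm:
  assumes "x \<in> torus" "y \<in> torus"
  shows "tr (x * y) = tr (y * x)"
proof -
  have "x * y \<in> torus \<and> y * x \<in> torus \<and> tr (x * y) = tr (y * x)"
    using assms
  proof (induction rule: span_induct2)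
    case (base a b)
    then obtain f g where fg: "a = M f" "b = M g" by auto
    have "q powi bichar L f g = q powi bichar L g f" if "dvd_vec l (f + g)"
    proof -
      have "[bichar L f (f + g) = 0] (mod int l)" "[bichar L (f + g) f = 0] (mod int l)"
        using that by (simp_all add: bichar_dvd_left bichar_dvd_right)
      then have "[bichar L f f + bichar L f g = bichar L f f + bichar L g f] (mod int l)"
        unfolding bichar_add_left bichar_add_right using cong_sym cong_trans by blast
      then show ?thesis by (intro powi_cong) (simp add: cong_add_lcancel)
    qed
    then show ?case
      by (simp add: fg torus_mult) (simp add: M_mult proj_scale proj_M add.commute)
  qed (auto simp: distrib_left distrib_right sc_mult_left sc_mult_right proj_add proj_scale
      intro: span_zero span_add span_scale)
  then show ?thesis by blast
qed

end

lemma toric_frameI: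
  assumes "algebra_over sc" "skew_mod l L" "inj (frame_extension sc M)" "M 0 = 1"
    "\<And>f g. M f * M g = sc (q powi bichar L f g) (M (f + g))"
    "\<And>y. \<exists>a\<in>module.span sc (range M). \<exists>b\<in>module.span sc (range M). b \<noteq> 0 \<and> y = a * inverse b"
  shows "toric_frame sc q l L M"
proof -
  interpret div_algebra sc using assms(1) by (simp add: div_algebra_def)
  show ?thesis
    unfolding toric_frame_def
  proof (intro conjI allI)
    show "frame_extension sc M (Poly_Mapping.single 0 1) = 1"
      unfolding frame_extension_single by (simp add: assms(4))
    show "\<exists>a b. frame_extension sc M b \<noteq> 0
        \<and> y = frame_extension sc M a * inverse (frame_extension sc M b)" for y
      using assms(6)[of y] unfolding range_frame_extension[symmetric] by blast
  qed (use assms(2,3) frame_extension_qtorus_mult[OF assms(5)] in auto)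
qed

section \<open>Mutation of exchange matrices\<close>

text \<open>The sign of \<open>y\<close> decides whether the positive or the negative part of
  \<open>x\<close> contributes, always twice, so the division by 2 is exact.\<close>

lemma mutation_increment:
  "(\<bar>x\<bar> * y + x * \<bar>y\<bar>) div 2 = y * (if 0 \<le> y then max x 0 else max (- x) (0::int))"
proof (cases "0 \<le> y")
  case True
  then have "\<bar>x\<bar> * y + x * \<bar>y\<bar> = 2 * (y * max x 0)"
    by (cases "0 \<le> x") (simp_all add: max_def algebra_simps)
  then show ?thesis using True by simp
next
  case False
  then have "\<bar>x\<bar> * y + x * \<bar>y\<bar> = 2 * (y * max (- x) 0)"
    by (cases "0 \<le> x") (simp_all add: max_def algebra_simps)
  then show ?thesis using False by simp
qed

lemma mutate_matrix_other:
  assumes "i \<noteq> k" "j \<noteq> k"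
  shows "mutate_matrix k B $ i $ j
    = B$i$j + B$k$j * (if 0 \<le> B$k$j then max (B$i$k) 0 else max (- (B$i$k)) 0)"
  using assms by (simp add: mutate_matrix_def mutation_increment)

lemma mutate_matrix_row_or_column:
  assumes "i = k \<or> j = k"
  shows "mutate_matrix k B $ i $ j = - B$i$j"
  using assms by (simp add: mutate_matrix_def)

lemma skew_symmetrizerD:
  assumes "skew_symmetrizer ex d B" "i \<in> ex"
  shows "0 < d i" "j \<in> ex \<Longrightarrow> int (d i) * B$i$j = - (int (d j) * B$j$i)"
  using assms unfolding skew_symmetrizer_def by blast+

lemma skew_symmetrizer_diag:
  assumes "skew_symmetrizer ex d B" "k \<in> ex"
  shows "B$k$k = 0"
  using skew_symmetrizerD[OF assms] assms(2) by fastforce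

lemma skew_symmetrizer_sign:
  assumes "skew_symmetrizer ex d B" "i \<in> ex" "j \<in> ex"
  shows "0 \<le> B$i$j \<longleftrightarrow> B$j$i \<le> 0" "0 < B$i$j \<longleftrightarrow> B$j$i < 0"
proof -
  have d: "0 < int (d i)" "0 < int (d j)" and eq: "int (d i) * B$i$j = - (int (d j) * B$j$i)"
    using skew_symmetrizerD(1)[OF assms(1)] skew_symmetrizerD(2)[OF assms] assms(2,3) by simp_all
  have i: "0 \<le> B$i$j \<longleftrightarrow> 0 \<le> int (d i) * B$i$j" "0 < B$i$j \<longleftrightarrow> 0 < int (d i) * B$i$j"
    using d by (simp_all add: zero_le_mult_iff zero_less_mult_iff)
  have j: "B$j$i \<le> 0 \<longleftrightarrow> int (d j) * B$j$i \<le> 0" "B$j$i < 0 \<longleftrightarrow> int (d j) * B$j$i < 0"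
    using d by (simp_all add: mult_le_0_iff mult_less_0_iff)
  show "0 \<le> B$i$j \<longleftrightarrow> B$j$i \<le> 0"
    unfolding i(1) j(1) eq by (rule neg_0_le_iff_le)
  show "0 < B$i$j \<longleftrightarrow> B$j$i < 0"
    unfolding i(2) j(2) eq by (rule neg_0_less_iff_less)
qed

lemma skew_symmetrizer_mutate:
  assumes B: "skew_symmetrizer ex d B" and k: "k \<in> ex"
  shows "skew_symmetrizer ex d (mutate_matrix k B)"
  unfolding skew_symmetrizer_def
proof (intro conjI ballI)
  show "0 < d j" if "j \<in> ex" for j by (rule skew_symmetrizerD(1)[OF B that])
  have skew: "int (d i) * B$i$j = - (int (d j) * B$j$i)" if "i \<in> ex" "j \<in> ex" for i j
    by (rule skew_symmetrizerD(2)[OF B that])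
  fix i j assume ij: "i \<in> ex" "j \<in> ex"
  show "int (d i) * mutate_matrix k B $ i $ j = - (int (d j) * mutate_matrix k B $ j $ i)"
  proof (cases "i = k \<or> j = k")
    case True
    then have "mutate_matrix k B $ i $ j = - B$i$j" "mutate_matrix k B $ j $ i = - B$j$i"
      using mutate_matrix_row_or_column by blast+
    then show ?thesis using skew[OF ij] by simp
  next
    case False
    define x y x' y' where xy: "x = B$i$k" "y = B$k$j" "x' = B$k$i" "y' = B$j$k"
    have "int (d i) * (x * y) = int (d i) * x * y" by simp
    also have "\<dots> = - x' * (int (d k) * y)" using skew[OF ij(1) k] by (simp add: xy)
    also have "\<dots> = int (d j) * (x' * y')" using skew[OF k ij(2)] by (simp add: xy)
    \<comment> \<open>Skew-symmetry is used twice and the signs cancel. Each mutation increment,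
      weighted by its \<open>d\<close>, is 0 or plus or minus this product.\<close>
    finally have prod: "int (d i) * (x * y) = int (d j) * (x' * y')" .
    note sx = skew_symmetrizer_sign[OF B ij(1) k, folded xy]
    note sy = skew_symmetrizer_sign[OF B k ij(2), folded xy]
    have "int (d i) * (y * (if 0 \<le> y then max x 0 else max (- x) 0))
        = - (int (d j) * (x' * (if 0 \<le> x' then max y' 0 else max (- y') 0)))"
    proof -
      consider "x = 0" "x' = 0" | "y = 0" "y' = 0" | "0 < x" "0 < y" "x' < 0" "y' < 0"
        | "0 < x" "y < 0" "x' < 0" "0 < y'" | "x < 0" "0 < y" "0 < x'" "y' < 0"
        | "x < 0" "y < 0" "0 < x'" "0 < y'"
      proof -
        have "x = 0 \<and> x' = 0 \<or> 0 < x \<and> x' < 0 \<or> x < 0 \<and> 0 < x'"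
          using sx by (cases x "0::int" rule: linorder_cases) auto
        moreover have "y = 0 \<and> y' = 0 \<or> 0 < y \<and> y' < 0 \<or> y < 0 \<and> 0 < y'"
          using sy by (cases y "0::int" rule: linorder_cases) auto
        ultimately show thesis using that by blast
      qed
      then show ?thesis
        by cases (use prod in \<open>simp_all add: max_def mult.commute\<close>)
    qed
    moreover have "mutate_matrix k B $ i $ j = B$i$j + y * (if 0 \<le> y then max x 0 else max (- x) 0)"
      "mutate_matrix k B $ j $ i = B$j$i + x' * (if 0 \<le> x' then max y' 0 else max (- y') 0)"
      using False unfolding xy by (intro mutate_matrix_other; blast)+
    ultimately show ?thesis
      using skew[OF ij] by (simp only: distrib_left minus_add_distrib)
  qed
qed

section \<open>Compatible pairs and their mutation\<close>

definition compatible :: "nat \<Rightarrow> 'n::finite set \<Rightarrow> ('n \<Rightarrow> nat) \<Rightarrow> int^'n^'n \<Rightarrow> int^'n^'n \<Rightarrow> bool" where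
  "compatible l ex d L B \<longleftrightarrow>
     (\<forall>j\<in>ex. \<forall>g. [bichar L (column j B) g = int (d j) * g$j] (mod int l))"

lemma compatible_iff:
  "compatible l ex d L B \<longleftrightarrow>
     (\<forall>i. \<forall>j\<in>ex. [(Finite_Cartesian_Product.transpose L ** B)$i$j = (if i = j then int (d j) else 0)] (mod int l))"
proof -
  have entry: "(Finite_Cartesian_Product.transpose L ** B)$i$j = bichar L (column j B) (axis i 1)" for i j
    by (simp add: bichar_axis_right matrix_matrix_mult_def Finite_Cartesian_Product.transpose_def column_def mult.commute)
  have "(\<forall>g. [bichar L (column j B) g = int (d j) * g$j] (mod int l)) \<longleftrightarrow>
      (\<forall>i. [bichar L (column j B) (axis i 1) = (if i = j then int (d j) else 0)] (mod int l))"
    (is "?A \<longleftrightarrow> ?B") for j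
  proof
    assume A: ?A
    show ?B
    proof
      fix i show "[bichar L (column j B) (axis i 1) = (if i = j then int (d j) else 0)] (mod int l)"
        using A[rule_format, of "axis i 1"] by (auto simp: axis_def)
    qed
  next
    assume B: ?B
    show ?A
    proof
      fix g :: "int^'a"
      have "[bichar L (column j B) g = (\<Sum>i\<in>UNIV. g$i * (if i = j then int (d j) else 0))] (mod int l)"
        by (subst bichar_expand_right) (intro cong_sum cong_mult cong_refl B[rule_format])
      also have "(\<Sum>i\<in>UNIV. g$i * (if i = j then int (d j) else 0)) = int (d j) * g$j"
        using sum_axis_scale[of j "int (d j)" "\<lambda>i. g$i"] by (simp add: mult.commute)
      finally show "[bichar L (column j B) g = int (d j) * g$j] (mod int l)" .
    qed
  qed
  then show ?thesis unfolding compatible_def entry by blast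
qed

definition forget :: "'n::finite \<Rightarrow> int^'n \<Rightarrow> int^'n" where
  "forget k f = f - f$k *s axis k 1"

definition mutation_vec :: "'n::finite \<Rightarrow> int^'n^'n \<Rightarrow> int^'n" where
  "mutation_vec k B = - axis k 1 + pos_part (column k B)"

text \<open>The linear map \<open>E\<close> with \<open>\<Lambda>' = E\<^sup>T \<Lambda> E\<close>.\<close>

definition mutation_map :: "'n::finite \<Rightarrow> int^'n^'n \<Rightarrow> int^'n \<Rightarrow> int^'n" where
  "mutation_map k B f = forget k f + f$k *s mutation_vec k B"

lemma forget_nth: "forget k f $ i = (if i = k then 0 else f$i)"
  by (simp add: forget_def axis_def)

lemma forget_add: "forget k (f + g) = forget k f + forget k g"
  by (simp add: forget_nth Finite_Cartesian_Product.vec_eq_iff)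

lemma forget_id: "f$k = 0 \<Longrightarrow> forget k f = f"
  by (simp add: forget_nth Finite_Cartesian_Product.vec_eq_iff)

lemma forget_decompose: "forget k f + f$k *s axis k 1 = f"
  by (simp add: forget_def)

lemma mutation_map_axis: "mutation_map k B (axis i 1) = (if i = k then mutation_vec k B else axis i 1)"
  by (auto simp: mutation_map_def forget_nth axis_def Finite_Cartesian_Product.vec_eq_iff)

lemma mutation_map_expand:
  "bichar L (mutation_map k B f) h = (\<Sum>i\<in>UNIV. f$i * bichar L (mutation_map k B (axis i 1)) h)"
proof -
  define D where "D = mutation_vec k B - axis k 1"
  have E: "mutation_map k B f = f + f$k *s D" for f
    by (simp add: mutation_map_def forget_def D_def Finite_Cartesian_Product.vec_eq_iff algebra_simps)
  have "(\<Sum>i\<in>UNIV. f$i * (bichar L (axis i 1) h + axis i 1 $ k * bichar L D h))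
      = bichar L f h + (\<Sum>i\<in>UNIV. (if i = k then f$k * bichar L D h else 0))"
    unfolding bichar_expand_left[of L f h] sum.distrib[symmetric]
    by (intro sum.cong) (auto simp: axis_def distrib_left)
  then show ?thesis unfolding E bichar_add_left bichar_scale_left by simp
qed

lemma mutation_map_expand_right:
  "bichar L h (mutation_map k B f) = (\<Sum>i\<in>UNIV. f$i * bichar L h (mutation_map k B (axis i 1)))"
proof -
  have "bichar L h g = bichar (Finite_Cartesian_Product.transpose L) g h" for g
    unfolding bichar_def by (subst sum.swap) (simp add: Finite_Cartesian_Product.transpose_def mult_ac)
  then show ?thesis using mutation_map_expand[of "Finite_Cartesian_Product.transpose L" k B f h] by simp
qed

text \<open>The modulus is arbitrary because modulus 0 turns the congruence into an equality, which
  holds for the lift constructed later.\<close>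

lemma bichar_mutation:
  assumes "\<And>i j. [L'$i$j = bichar L (mutation_map k B (axis i 1)) (mutation_map k B (axis j 1))] (mod m)"
  shows "[bichar L' f g = bichar L (mutation_map k B f) (mutation_map k B g)] (mod m)"
proof -
  have "bichar L (mutation_map k B f) (mutation_map k B g) = (\<Sum>i\<in>UNIV. f$i * (\<Sum>j\<in>UNIV. g$j *
      bichar L (mutation_map k B (axis i 1)) (mutation_map k B (axis j 1))))"
    by (subst mutation_map_expand, subst mutation_map_expand_right) (rule refl)
  then show ?thesis
    by (simp only:) (subst bichar_expand, intro cong_sum cong_mult cong_refl assms)
qed

text \<open>The mutation rule prescribes only the entries outside row \<open>k\<close>. Row
  \<open>k\<close> follows by skew-symmetry, and its diagonal entry by oddness of
  \<open>l\<close>.\<close>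

lemma bichar_mutation_entries:
  assumes "skew_mod l L" "skew_mod l L'" "odd l"
    and same: "\<And>i j. i \<noteq> k \<Longrightarrow> j \<noteq> k \<Longrightarrow> [L'$i$j = L$i$j] (mod int l)"
    and new: "\<And>i. i \<noteq> k \<Longrightarrow> [L'$i$k = bichar L (axis i 1) (mutation_vec k B)] (mod int l)"
  shows "[L'$i$j = bichar L (mutation_map k B (axis i 1)) (mutation_map k B (axis j 1))] (mod int l)"
proof -
  have diag: "[L'$k$k = 0] (mod int l)"
    using bichar_self[OF assms(2,3), of "axis k 1"] by (simp add: bichar_axis_axis)
  have diag': "[bichar L (mutation_vec k B) (mutation_vec k B) = 0] (mod int l)"
    by (rule bichar_self[OF assms(1,3)])
  have "[L'$k$j = bichar L (mutation_vec k B) (axis j 1)] (mod int l)" if "j \<noteq> k" for j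
  proof -
    have "[L'$k$j = - L'$j$k] (mod int l)" using assms(2) by (simp add: skew_mod_def)
    also have "[- L'$j$k = - bichar L (axis j 1) (mutation_vec k B)] (mod int l)"
      using new[OF that] by (simp add: cong_minus_minus_iff)
    also have "[- bichar L (axis j 1) (mutation_vec k B) = bichar L (mutation_vec k B) (axis j 1)] (mod int l)"
      using bichar_skew[OF assms(1)] cong_sym by blast
    finally show ?thesis .
  qed
  then show ?thesis
    using same new diag diag' cong_trans[OF diag cong_sym[OF diag']]
    by (auto simp: mutation_map_axis bichar_axis_axis)
qed

lemma mutation_map_nth:
  assumes "B$k$k = 0"
  shows "mutation_map k B g $ i = (if i = k then - g$k else g$i + g$k * max (B$i$k) 0)"
  using assms
  by (simp add: mutation_map_def forget_nth mutation_vec_def pos_part_def column_def axis_def)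

text \<open>The substitution undoes the matrix mutation up to sign and multiples of column
  \<open>k\<close>, so pairings with mutated columns reduce to pairings with columns of
  \<open>B\<close>.\<close>

lemma mutation_map_column:
  assumes "B$k$k = 0"
  shows "mutation_map k B (column j (mutate_matrix k B)) =
    (if j = k then - column k B
     else if 0 \<le> B$k$j then column j B else column j B - B$k$j *s column k B)"
proof -
  have "mutation_map k B (column j (mutate_matrix k B)) $ i =
    (if j = k then - column k B
     else if 0 \<le> B$k$j then column j B else column j B - B$k$j *s column k B) $ i" for i
  proof (cases "i = k \<or> j = k")
    case True
    then show ?thesis using assms
      by (auto simp: mutation_map_nth column_def mutate_matrix_row_or_column)
  next
    case False
    then show ?thesis using assms
      by (auto simp: mutation_map_nth column_def mutate_matrix_row_or_column mutate_matrix_other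
          max_def algebra_simps)
  qed
  then show ?thesis by (simp only: Finite_Cartesian_Product.vec_eq_iff) simp
qed

lemma compatible_mutate:
  assumes B: "skew_symmetrizer ex d B" and k: "k \<in> ex" and comp: "compatible l ex d L B"
    and L': "\<And>i j. [L'$i$j = bichar L (mutation_map k B (axis i 1)) (mutation_map k B (axis j 1))] (mod int l)"
  shows "compatible l ex d L' (mutate_matrix k B)"
  unfolding compatible_def
proof (intro ballI allI)
  fix j g assume j: "j \<in> ex"
  let ?E = "mutation_map k B"
  have bkk: "B$k$k = 0" by (rule skew_symmetrizer_diag[OF B k])
  have comp': "[bichar L (column j B) g = int (d j) * g$j] (mod int l)" if "j \<in> ex" for j g
    using comp that by (simp add: compatible_def)
  have "[bichar L' (column j (mutate_matrix k B)) g
      = bichar L (?E (column j (mutate_matrix k B))) (?E g)] (mod int l)"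
    by (rule bichar_mutation[OF L'])
  also have "[bichar L (?E (column j (mutate_matrix k B))) (?E g) = int (d j) * g$j] (mod int l)"
  proof (cases "j = k")
    case True
    have "[- bichar L (column k B) (?E g) = - (int (d k) * ?E g $ k)] (mod int l)"
      using comp'[OF k] by (simp add: cong_minus_minus_iff)
    then show ?thesis using True
      by (simp add: mutation_map_column[OF bkk] bichar_uminus_left mutation_map_nth[OF bkk])
  next
    case False
    have eq: "int (d j) * B$j$k = - (int (d k) * B$k$j)"
      by (rule skew_symmetrizerD(2)[OF B j k])
    note sign = skew_symmetrizer_sign[OF B k j]
    show ?thesis
    proof (cases "0 \<le> B$k$j")
      case True
      have "[bichar L (column j B) (?E g) = int (d j) * ?E g $ j] (mod int l)"
        by (rule comp'[OF j])
      then show ?thesis using False True sign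
        by (simp add: mutation_map_column[OF bkk] mutation_map_nth[OF bkk])
    next
      case neg: False
      have "[bichar L (column j B) (?E g) - B$k$j * bichar L (column k B) (?E g)
          = int (d j) * ?E g $ j - B$k$j * (int (d k) * ?E g $ k)] (mod int l)"
        by (intro cong_diff cong_mult cong_refl comp' j k)
      \<comment> \<open>Since \<open>B$k$j\<close> is negative, \<open>B$j$k\<close> is positive and
        enters \<open>?E g $ j\<close>. The resulting coefficient of \<open>g$k\<close> is the
        skew-symmetry relation between \<open>j\<close> and \<open>k\<close>, hence 0.\<close>
      moreover have "int (d j) * ?E g $ j - B$k$j * (int (d k) * ?E g $ k)
          = int (d j) * g$j + g$k * (int (d j) * B$j$k + int (d k) * B$k$j)"
        using False neg sign by (simp add: mutation_map_nth[OF bkk] algebra_simps)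
      ultimately show ?thesis using False neg eq
        by (simp add: mutation_map_column[OF bkk] bichar_diff_left bichar_scale_left)
    qed
  qed
  finally show "[bichar L' (column j (mutate_matrix k B)) g = int (d j) * g$j] (mod int l)" .
qed

section \<open>Mutation of toric frames\<close>

lemma (in div_algebra) powi_quasi_commute:
  assumes y: "y \<noteq> 0" and c: "c \<noteq> 0" and yg: "y * g = sc c (g * y)"
  shows "y powi m * g = sc (c powi m) (g * y powi m)"
proof -
  have nat: "y ^ n * g = sc (c ^ n) (g * y ^ n)" for n
  proof (induction n)
    case (Suc n)
    have "y ^ Suc n * g = y ^ n * (y * g)" by (simp only: power_Suc2 mult.assoc)
    also have "\<dots> = sc c ((y ^ n * g) * y)" by (simp add: yg sc_mult_right mult.assoc)
    also have "\<dots> = sc (c ^ Suc n) (g * y ^ Suc n)"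
      by (simp only: Suc) (simp add: sc_mult_left mult.assoc power_Suc2 power_commutes)
    finally show ?case .
  qed simp
  show ?thesis
  proof (cases "0 \<le> m")
    case True
    then show ?thesis using nat[of "nat m"] by (simp add: power_int_def)
  next
    case False
    define n where "n = nat (- m)"
    have m: "m = - int n" using False by (simp add: n_def)
    have yn: "y ^ n \<noteq> 0" "c ^ n \<noteq> 0" using y c by auto
    have "inverse (y ^ n) * (y ^ n * g) * inverse (y ^ n)
        = inverse (y ^ n) * sc (c ^ n) (g * y ^ n) * inverse (y ^ n)" by (simp add: nat)
    then have "g * inverse (y ^ n) = sc (c ^ n) (inverse (y ^ n) * g)"
      using yn by (simp add: mult.assoc[symmetric] sc_mult_left sc_mult_right)
        (simp add: mult.assoc)
    then have "inverse (y ^ n) * g = sc (inverse (c ^ n)) (g * inverse (y ^ n))"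
      using yn by simp
    then show ?thesis by (simp add: m power_int_minus)
  qed
qed

lemma (in div_algebra) span_mult_closed:
  assumes "\<And>a b. a \<in> A \<Longrightarrow> b \<in> A \<Longrightarrow> a * b \<in> span A" "x \<in> span A" "y \<in> span A"
  shows "x * y \<in> span A"
  using assms(2,3)
proof (induction rule: span_induct2)
  case (base a b)
  then show ?case by (rule assms(1))
qed (auto simp: span_zero distrib_left distrib_right sc_mult_left sc_mult_right intro: span_add span_scale)

section \<open>Construction of the mutated toric frame\<close>

locale frame_mutator = frame sc q l L M
  for sc :: "'k::field_char_0 \<Rightarrow> 'd::division_ring \<Rightarrow> 'd" and q l
    and L :: "int^'n::finite^'n" and M +
  fixes B :: "int^'n^'n" and k :: 'n and dk :: nat
  assumes compat: "\<And>g. [bichar L (column k B) g = int dk * g$k] (mod int l)"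
    and coprime_dk: "coprime l dk"
    and Bkk: "B$k$k = 0"
begin

abbreviation u :: "int^'n" where "u \<equiv> mutation_vec k B"

definition v :: "int^'n" where "v = - axis k 1 - neg_part (column k B)"

definition y :: 'd where "y = M u + M v"

lemma u_eq: "u = v + column k B"
  by (simp add: mutation_vec_def v_def pos_part_def neg_part_def Finite_Cartesian_Product.vec_eq_iff
      max_def min_def)

lemma u_k: "u$k = -1" and v_k: "v$k = -1"
  using Bkk by (simp_all add: mutation_vec_def v_def pos_part_def neg_part_def column_def axis_def)

text \<open>If \<open>u\<close> and \<open>v\<close> coincide, the two monomials add up to
  coefficient 2, which is nonzero in characteristic 0.\<close>

lemma y_nonzero: "y \<noteq> 0"
proof -
  have "Poly_Mapping.lookup (Poly_Mapping.single u (1::'k) + Poly_Mapping.single v 1) u \<noteq> 0"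
    by (simp add: lookup_add lookup_single when_def)
  then have "Poly_Mapping.single u (1::'k) + Poly_Mapping.single v 1 \<noteq> 0"
    by (metis lookup_zero)
  then have "frame_extension sc M (Poly_Mapping.single u 1 + Poly_Mapping.single v 1) \<noteq> 0"
    by simp
  then show ?thesis by (simp only: frame_extension_add frame_extension_single scale_one y_def not_False_eq_True)
qed

lemma skew_dvd: "int l dvd bichar L f g + bichar L g f"
  using bichar_skew[OF skew, of f g] by (simp add: cong_iff_dvd_diff)

lemma self_dvd: "int l dvd bichar L f f"
  using bichar_self[OF skew odd, of f] by (simp add: cong_0_iff)

lemma M_commute: "M f * M g = sc (q powi (- 2 * bichar L g f)) (M g * M f)"
proof -
  have "[bichar L f g = - 2 * bichar L g f + bichar L g f] (mod int l)"
    using skew_dvd[of f g] by (simp add: cong_iff_dvd_diff)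
  then have "q powi bichar L f g = q powi (- 2 * bichar L g f + bichar L g f)" by (rule powi_cong)
  also have "\<dots> = q powi (- 2 * bichar L g f) * q powi bichar L g f"
    by (rule power_int_add) (simp add: q_nonzero)
  finally show ?thesis by (simp only: M_mult scale_scale add.commute[of g f])
qed

text \<open>Both summands of \<open>y\<close> commute with \<open>M g\<close> up to the same scalar:
  \<open>u\<close> and \<open>v\<close> differ by column \<open>k\<close>, whose pairing with
  \<open>g\<close> is a multiple of \<open>g$k = 0\<close> modulo \<open>l\<close>.\<close>

lemma y_commute:
  assumes "g$k = 0"
  shows "y * M g = sc (q powi (- 2 * bichar L g u)) (M g * y)"
proof -
  have "[- 2 * bichar L g v = - 2 * bichar L g u] (mod int l)"
  proof -
    have "[bichar L g (column k B) = - bichar L (column k B) g] (mod int l)"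
      by (rule bichar_skew[OF skew])
    also have "[- bichar L (column k B) g = - (int dk * g$k)] (mod int l)"
      using compat by (simp add: cong_minus_minus_iff)
    finally have "int l dvd bichar L g (column k B)" using assms by (simp add: cong_0_iff)
    then show ?thesis by (simp add: u_eq bichar_add_right cong_iff_dvd_diff algebra_simps)
  qed
  from powi_cong[OF this] show ?thesis
    by (simp add: y_def distrib_left distrib_right M_commute[of u g] M_commute[of v g] scale_right_distrib
        del: mult_minus_left)
qed

text \<open>The summands quasi-commute with parameter \<open>q powi (2 * dk)\<close>, because
  \<open>bichar L u v\<close> reduces to the pairing of column \<open>k\<close> with
  \<open>v\<close>, which is \<open>- dk\<close> modulo \<open>l\<close>. As \<open>l\<close> is odd
  and coprime to \<open>dk\<close>, the parameter is again a primitive \<open>l\<close>-th root of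
  unity, so the middle Gaussian binomials vanish.\<close>

lemma y_frobenius: "y ^ l = M (int l *s u) + M (int l *s v)"
proof -
  define z where "z = q powi (2 * int dk)"
  have "[- 2 * bichar L u v = 2 * int dk] (mod int l)"
  proof -
    have "[bichar L u v = int dk * v$k + 0] (mod int l)"
      unfolding u_eq bichar_add_left
      by (subst add.commute) (intro cong_add compat, use self_dvd in \<open>simp add: cong_0_iff\<close>)
    then have "[- 2 * bichar L u v = - 2 * (int dk * v$k + 0)] (mod int l)"
      by (intro cong_mult cong_refl)
    then show ?thesis by (simp add: v_k)
  qed
  from powi_cong[OF this] have "M v * M u = sc z (M u * M v)"
    unfolding z_def M_commute[of v u] by simp
  moreover have "primitive_root_of_unity l z"
  proof -
    have pow: "z ^ m = 1 \<longleftrightarrow> l dvd m" for m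
    proof -
      have "z ^ m = q powi (2 * int dk * int m)" by (simp add: z_def power_int_mult)
      then have "z ^ m = 1 \<longleftrightarrow> int l dvd 2 * int dk * int m"
        by (simp only: powi_eq_1_iff[OF prim])
      also have "\<dots> \<longleftrightarrow> l dvd 2 * dk * m"
        by (metis of_nat_dvd_iff of_nat_mult of_nat_numeral)
      also have "\<dots> \<longleftrightarrow> l dvd m"
        using odd coprime_dk by (simp add: coprime_dvd_mult_right_iff coprime_right_2_iff_odd)
      finally show ?thesis .
    qed
    then show ?thesis using l_pos nat_dvd_not_less by (auto simp: primitive_root_of_unity_def)
  qed
  ultimately show ?thesis unfolding y_def M_power[symmetric] by (rule frobenius)
qed

text \<open>Homogeneity in coordinate \<open>k\<close>. This grading separates the powers of
  \<open>y\<close>, both in the proof of independence and in the computation of traces.\<close>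

lemma y_power_in_span: "y ^ m \<in> span {M h | h. h$k = - int m}"
proof (induction m)
  case 0
  have "M 0 \<in> span {M h | h. h$k = - int 0}" by (intro span_base) (auto intro!: exI[of _ 0])
  then show ?case by simp
next
  case (Suc m)
  have "y \<in> span {M h | h. h$k = -1}"
    unfolding y_def using u_k v_k by (intro span_add span_base) auto
  from span_M_mult[OF this Suc, of "\<lambda>h. h$k = - int (Suc m)"] show ?case by simp
qed

text \<open>The scalar is forced by the twisted multiplication: under the mutated bicharacter,
  \<open>forget k f\<close> pairs with \<open>f$k *s axis k 1\<close> to
  \<open>f$k * bichar L (forget k f) u\<close>.\<close>

definition M' :: "int^'n \<Rightarrow> 'd" where
  "M' f = sc (q powi (- f$k * bichar L (forget k f) u)) (M (forget k f) * y powi f$k)"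

definition L' :: "int^'n^'n" where
  "L' = (\<chi> i j. bichar L (mutation_map k B (axis i 1)) (mutation_map k B (axis j 1)))"

lemma M'_eq_M: "f$k = 0 \<Longrightarrow> M' f = M f"
  by (simp add: M'_def forget_id)

lemma M'_axis: "M' (c *s axis k 1) = y powi c"
proof -
  have "forget k (c *s axis k 1) = 0" "(c *s axis k 1) $ k = c"
    by (simp_all add: forget_nth Finite_Cartesian_Product.vec_eq_iff axis_def)
  then show ?thesis by (simp add: M'_def)
qed

lemma M'_mult: "M' f * M' g = sc (q powi bichar L' f g) (M' (f + g))"
proof -
  define \<beta> where "\<beta> = (\<lambda>f. bichar L (forget k f) u)"
  have fold_\<beta>: "bichar L (forget k f) u = \<beta> f" for f by (simp add: \<beta>_def)
  have commute: "y powi f$k * M (forget k g) = sc (q powi (- 2 * \<beta> g * f$k)) (M (forget k g) * y powi f$k)"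
  proof -
    have "y * M (forget k g) = sc (q powi (- 2 * \<beta> g)) (M (forget k g) * y)"
      unfolding \<beta>_def by (rule y_commute) (simp add: forget_nth)
    from powi_quasi_commute[OF y_nonzero _ this, of "f$k"] show ?thesis
      by (simp only: power_int_mult[symmetric]) (simp add: q_nonzero)
  qed
  have "M' f * M' g = sc (q powi (- f$k * \<beta> f) * q powi (- g$k * \<beta> g))
      (M (forget k f) * (y powi f$k * M (forget k g)) * y powi g$k)"
    by (simp add: M'_def \<beta>_def sc_mult_left sc_mult_right mult.assoc mult.commute)
  also have "\<dots> = sc (q powi (- f$k * \<beta> f) * q powi (- g$k * \<beta> g) * q powi (- 2 * \<beta> g * f$k)
        * q powi bichar L (forget k f) (forget k g))
      (M (forget k (f + g)) * y powi ((f + g)$k))"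
    unfolding commute
    by (simp add: sc_mult_left sc_mult_right mult.assoc[symmetric] M_mult forget_add
        power_int_add y_nonzero del: mult_minus_left)
  also have "\<dots> = sc (q powi bichar L' f g) (M' (f + g))"
  proof -
    have "bichar L' f g = bichar L (mutation_map k B f) (mutation_map k B g)"
      using bichar_mutation[of L' L k B 0 f g] by (simp add: L'_def)
    also have "\<dots> = bichar L (forget k f) (forget k g) + g$k * \<beta> f + f$k * bichar L u (forget k g)
        + f$k * g$k * bichar L u u"
      by (simp add: mutation_map_def bichar_add_left bichar_add_right bichar_scale_left
          bichar_scale_right \<beta>_def algebra_simps)
    finally have L'fg: "bichar L' f g = \<dots>" .
    \<comment> \<open>The two exponents differ by a multiple of a sum
      \<open>bichar L u h + bichar L h u\<close> and a multiple of \<open>bichar L u u\<close>, both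
      of which are 0 modulo \<open>l\<close>.\<close>
    have "[- f$k * \<beta> f + - g$k * \<beta> g + - 2 * \<beta> g * f$k + bichar L (forget k f) (forget k g)
        = bichar L' f g + - (f + g)$k * \<beta> (f + g)] (mod int l)"
    proof -
      have "\<beta> (f + g) = \<beta> f + \<beta> g" by (simp add: \<beta>_def forget_add bichar_add_left)
      then have "bichar L' f g + - (f + g)$k * \<beta> (f + g)
          - (- f$k * \<beta> f + - g$k * \<beta> g + - 2 * \<beta> g * f$k + bichar L (forget k f) (forget k g))
        = f$k * (bichar L u (forget k g) + bichar L (forget k g) u) + f$k * g$k * bichar L u u"
        unfolding L'fg by (simp add: \<beta>_def algebra_simps)
      also have "int l dvd \<dots>"
        by (rule dvd_add[OF dvd_mult[OF skew_dvd] dvd_mult[OF self_dvd]])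
      finally show ?thesis by (simp add: cong_iff_dvd_diff dvd_diff_commute)
    qed
    from powi_cong[OF this] show ?thesis
      by (simp add: M'_def fold_\<beta> power_int_add q_nonzero del: mult_minus_left)
  qed
  finally show ?thesis .
qed

text \<open>A relation is multiplied by \<open>y ^ r\<close> to clear negative powers of
  \<open>y\<close>. As \<open>y ^ m\<close> is homogeneous of degree \<open>- m\<close> in
  coordinate \<open>k\<close>, the part with \<open>f$k = f0$k\<close> can be projected out; there
  the common power of \<open>y\<close> cancels, and independence of the \<open>M f\<close>
  applies.\<close>

lemma inj_M': "inj (frame_extension sc M')"
proof -
  have kernel: "a = 0" if a: "frame_extension sc M' a = 0" for a
  proof (rule ccontr)
    assume "a \<noteq> 0"
    let ?K = "Poly_Mapping.keys a"
    have "?K \<noteq> {}" using \<open>a \<noteq> 0\<close> by simp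
    then obtain f0 where f0: "f0 \<in> ?K" by blast
    define r where "r = (\<Sum>f\<in>?K. nat \<bar>f$k\<bar>)"
    have r: "0 \<le> f$k + int r" if "f \<in> ?K" for f
    proof -
      have "nat \<bar>f$k\<bar> \<le> r" unfolding r_def using that by (intro member_le_sum) auto
      then show ?thesis by linarith
    qed
    define c where "c = (\<lambda>f. Poly_Mapping.lookup a f * q powi (- f$k * bichar L (forget k f) u))"
    define t where "t = (\<lambda>f. sc (c f) (M (forget k f) * y powi (f$k + int r)))"
    have "(\<Sum>f\<in>?K. t f) = frame_extension sc M' a * y ^ r"
      by (simp add: t_def c_def frame_extension_def M'_def sum_distrib_right sc_mult_left
          power_int_add y_nonzero mult.assoc)
    then have sum_t: "(\<Sum>f\<in>?K. t f) = 0" using a by simp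
    have t_span: "t f \<in> span {M h | h. h$k = - (f$k + int r)}" if "f \<in> ?K" for f
    proof -
      have "M (forget k f) \<in> span {M h | h. h$k = 0}"
        by (rule span_base) (auto simp: forget_nth)
      moreover have "y powi (f$k + int r) \<in> span {M h | h. h$k = - (f$k + int r)}"
        using y_power_in_span[of "nat (f$k + int r)"] r[OF that] by (simp add: power_int_def)
      ultimately have "M (forget k f) * y powi (f$k + int r) \<in> span {M h | h. h$k = - (f$k + int r)}"
        by (rule span_M_mult) simp
      then show ?thesis unfolding t_def by (rule span_scale)
    qed
    let ?Q = "\<lambda>h :: int^'n. h$k = - (f0$k + int r)"
    let ?K' = "{f \<in> ?K. f$k = f0$k}"
    have "proj ?Q (t f) = (if f$k = f0$k then t f else 0)" if "f \<in> ?K" for f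
      using proj_id[OF t_span[OF that], of ?Q] proj_eq_0[OF t_span[OF that], of ?Q] by auto
    then have "(\<Sum>f\<in>?K. if f$k = f0$k then t f else 0) = proj ?Q (\<Sum>f\<in>?K. t f)"
      using subsetD[OF span_subset_torus t_span] by (subst proj_sum) (auto intro!: sum.cong)
    then have "(\<Sum>f\<in>?K'. t f) = 0" using sum_t by (simp add: sum.inter_filter)
    moreover have "(\<Sum>f\<in>?K'. t f) = (\<Sum>f\<in>?K'. sc (c f) (M (forget k f))) * y powi (f0$k + int r)"
      by (simp add: t_def sum_distrib_right sc_mult_left)
    ultimately have "(\<Sum>f\<in>?K'. sc (c f) (M (forget k f))) * y powi (f0$k + int r) = 0"
      by (simp only:)
    moreover have "y powi (f0$k + int r) \<noteq> 0" using y_nonzero by simp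
    ultimately have "(\<Sum>f\<in>?K'. sc (c f) (M (forget k f))) = 0" by (simp only: mult_eq_0_iff simp_thms)
    moreover have "(\<Sum>f\<in>?K'. sc (c f) (M (forget k f)))
        = frame_extension sc M (\<Sum>f\<in>?K'. Poly_Mapping.single (forget k f) (c f))"
      by (simp add: frame_extension_sum)
    ultimately have "(\<Sum>f\<in>?K'. Poly_Mapping.single (forget k f) (c f)) = 0" by simp
    then have "Poly_Mapping.lookup (\<Sum>f\<in>?K'. Poly_Mapping.single (forget k f) (c f)) (forget k f0) = 0"
      by simp
    then have "(\<Sum>f\<in>?K'. if forget k f = forget k f0 then c f else 0) = 0"
      by (simp add: lookup_sum lookup_single when_def)
    moreover have "(\<Sum>f\<in>?K'. if forget k f = forget k f0 then c f else 0) = (\<Sum>f\<in>?K'. if f = f0 then c f0 else 0)"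
    proof (intro sum.cong refl)
      fix f assume f: "f \<in> ?K'"
      then have fk: "f$k = f0$k" by simp
      have "f = f0" if "forget k f = forget k f0"
        using forget_decompose[of k f, unfolded that fk] forget_decompose[of k f0] by (rule trans[OF sym])
      then show "(if forget k f = forget k f0 then c f else 0) = (if f = f0 then c f0 else 0)" by auto
    qed
    ultimately have "c f0 = 0" using f0 by simp
    then show False using f0 q_nonzero by (simp add: c_def in_keys_iff)
  qed
  show ?thesis
  proof (rule injI)
    fix a b assume "frame_extension sc M' a = frame_extension sc M' b"
    then have "frame_extension sc M' (a - b) = 0"
      using frame_extension_add[of M' "a - b" b] by simp
    then show "a = b" using kernel[of "a - b"] by simp
  qed
qed

lemma M'_torus_mult: "x \<in> span (range M') \<Longrightarrow> x' \<in> span (range M') \<Longrightarrow> x * x' \<in> span (range M')"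
proof (rule span_mult_closed)
  fix a b assume "a \<in> range M'" "b \<in> range M'"
  then obtain f g where "a = M' f" "b = M' g" by auto
  then show "a * b \<in> span (range M')" by (simp add: M'_mult span_scale span_base)
qed

text \<open>The old variable is \<open>inverse y * (y * M (axis k 1))\<close>, and the second factor
  involves only exponents with k-th coordinate 0, where both frames agree. The inverse of the old
  variable need not be a Laurent polynomial in the new frame, hence the sign condition.\<close>

lemma M_in_M'_torus:
  assumes "0 \<le> f$k"
  shows "M f \<in> span (range M')"
proof -
  have M'_in: "M' f \<in> span (range M')" for f by (simp add: span_base)
  have zero: "M g \<in> span (range M')" if "g$k = 0" for g
    using M'_in[of g] M'_eq_M[OF that] by simp
  have inv_y: "inverse y \<in> span (range M')"
    using M'_in[of "-1 *s axis k 1"] unfolding M'_axis by simp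
  have "M w * M (axis k 1) \<in> span (range M')" if "w$k = -1" for w
    unfolding M_mult using that by (intro span_scale zero) (simp add: axis_def)
  then have "y * M (axis k 1) \<in> span (range M')"
    by (simp add: y_def distrib_right u_k v_k span_add)
  from M'_torus_mult[OF inv_y this] have axis: "M (axis k 1) \<in> span (range M')"
    by (simp add: mult.assoc[symmetric] y_nonzero)
  have "M f \<in> span (range M')" if "f$k = int n" for n f
    using that
  proof (induction n arbitrary: f)
    case (Suc n)
    have "M f = M ((f - axis k 1) + axis k 1)" by simp
    also have "\<dots> \<in> span (range M')"
      unfolding M_add
      by (intro span_scale M'_torus_mult axis Suc.IH) (simp add: Suc.prems axis_def)
    finally show ?case .
  qed (simp add: zero)
  from this[of f "nat (f$k)"] show ?thesis using assms by simp
qed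

text \<open>A power of the old variable clears its negative powers. All large \<open>s\<close> work,
  so that numerator and denominator of a fraction can be multiplied by the same power.\<close>

lemma torus_absorb:
  assumes "x \<in> torus"
  shows "\<exists>r. \<forall>s\<ge>r. x * M (int s *s axis k 1) \<in> span (range M')"
  using assms
proof (induction rule: span_induct_alt)
  case base
  then show ?case by (auto simp: span_zero)
next
  case (step c w x)
  then obtain f r where f: "w = M f" and r: "\<And>s. r \<le> s \<Longrightarrow> x * M (int s *s axis k 1) \<in> span (range M')"
    by auto
  show ?case
  proof (intro exI allI impI)
    fix s assume s: "max r (nat \<bar>f$k\<bar>) \<le> s"
    have "0 \<le> (f + int s *s axis k 1) $ k" using s by (simp add: axis_def) linarith
    then have "M f * M (int s *s axis k 1) \<in> span (range M')"
      unfolding M_mult by (intro span_scale M_in_M'_torus)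
    then show "(sc c w + x) * M (int s *s axis k 1) \<in> span (range M')"
      using r[of s] s by (auto simp: f distrib_right sc_mult_left intro!: span_add span_scale)
  qed
qed

lemma toric_frame_M': "toric_frame sc q l L' M'"
proof (rule toric_frameI)
  show "algebra_over sc" by unfold_locales
  show "skew_mod l L'"
    using bichar_skew[OF skew] by (simp add: skew_mod_def L'_def)
  show "inj (frame_extension sc M')" by (rule inj_M')
  show "M' 0 = 1" by (simp add: M'_eq_M)
  show "M' f * M' g = sc (q powi bichar L' f g) (M' (f + g))" for f g by (rule M'_mult)
  fix x
  obtain a b where ab: "frame_extension sc M b \<noteq> 0"
    "x = frame_extension sc M a * inverse (frame_extension sc M b)" using fractions by blast
  have "frame_extension sc M a \<in> torus" "frame_extension sc M b \<in> torus"
    using range_frame_extension[of M] by blast+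
  from this[THEN torus_absorb] obtain ra rb where
    r: "\<And>s. ra \<le> s \<Longrightarrow> frame_extension sc M a * M (int s *s axis k 1) \<in> span (range M')"
       "\<And>s. rb \<le> s \<Longrightarrow> frame_extension sc M b * M (int s *s axis k 1) \<in> span (range M')"
    by auto
  define m where "m = M (int (max ra rb) *s axis k 1)"
  have m: "m \<noteq> 0" by (simp add: m_def M_nonzero)
  show "\<exists>a\<in>span (range M'). \<exists>b\<in>span (range M'). b \<noteq> 0 \<and> x = a * inverse b"
  proof (intro bexI conjI)
    show "frame_extension sc M b * m \<noteq> 0" using ab m by simp
    have "frame_extension sc M a * m * inverse (frame_extension sc M b * m)
        = frame_extension sc M a * (m * inverse m) * inverse (frame_extension sc M b)"
      using ab m by (simp add: nonzero_inverse_mult_distrib mult.assoc del: right_inverse)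
    then show "x = frame_extension sc M a * m * inverse (frame_extension sc M b * m)"
      using ab m by simp
    show "frame_extension sc M a * m \<in> span (range M')" "frame_extension sc M b * m \<in> span (range M')"
      unfolding m_def by (rule r; simp)+
  qed
qed

theorem frame_mutation_exists: "frame_mutation sc q l k B M M'"
  unfolding frame_mutation_def
proof (intro exI conjI allI impI)
  show "toric_frame sc q l L M" by (rule toric)
  show "toric_frame sc q l L' M'" by (rule toric_frame_M')
  show "[L'$i$j = L$i$j] (mod int l)" if "i \<noteq> k" "j \<noteq> k" for i j
    using that by (simp add: L'_def mutation_map_axis bichar_axis_axis)
  show "[L'$i$k = bichar L (axis i 1) (- axis k 1 + pos_part (column k B))] (mod int l)" if "i \<noteq> k" for i
    using that by (simp add: L'_def mutation_map_axis mutation_vec_def)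
  show "M' (axis i 1) = M (axis i 1)" if "i \<noteq> k" for i
    using that by (intro M'_eq_M) (simp add: axis_def)
  have "1 *s axis k 1 = (axis k 1 :: int^'n)" by (simp add: Finite_Cartesian_Product.vec_eq_iff)
  then show "M' (axis k 1) = M (- axis k 1 + pos_part (column k B)) + M (- axis k 1 - neg_part (column k B))"
    using M'_axis[of 1] by (simp add: y_def v_def mutation_vec_def)
qed

end

section \<open>Invariance of the trace under mutation\<close>

text \<open>\<open>M2\<close> is any frame satisfying the mutation relation, not only the
  constructed \<open>M'\<close>, because reachability quantifies over all such frames.\<close>

locale frame_mutation_pair = frame_mutator sc q l L M B k dk + N: frame sc q l L2 M2
  for sc :: "'k::field_char_0 \<Rightarrow> 'd::division_ring \<Rightarrow> 'd" and q l
    and L :: "int^'n::finite^'n" and M B k dk and L2 :: "int^'n^'n" and M2 +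
  assumes M2_axis: "i \<noteq> k \<Longrightarrow> M2 (axis i 1) = M (axis i 1)"
    and M2_axis_k: "M2 (axis k 1) = y"
    and L2: "[L2$i$j = bichar L (mutation_map k B (axis i 1)) (mutation_map k B (axis j 1))] (mod int l)"
begin

lemma M2_eq_M:
  assumes "f$k = 0"
  shows "M2 f = M f"
proof -
  have step: "(f + g)$k = 0 \<and> M2 (f + g) = M (f + g)"
    if "f$k = 0" "g$k = 0" "M2 f = M f" "M2 g = M g" for f g
  proof -
    have "mutation_map k B h = h" if "h$k = 0" for h
      using that by (simp add: mutation_map_def forget_id)
    then have "[bichar L2 f g = bichar L f g] (mod int l)"
      using bichar_mutation[OF L2, of f g] that by simp
    then have "q powi (- bichar L2 f g) = q powi (- bichar L f g)"
      by (intro powi_cong) (simp add: cong_minus_minus_iff)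
    then show ?thesis using that by (simp add: M_add N.M_add)
  qed
  have "f$k = 0 \<and> M2 f = M f"
  proof (induction f rule: int_vec_induct[where U = "- {k}" and V = "- {k}"])
    case zero
    then show ?case by simp
  next
    case (add f i)
    then show ?case using step[of f "axis i 1"] M2_axis by (simp add: axis_def)
  next
    case (diff f i)
    then show ?case using step[of f "- axis i 1"] M2_axis
      by (simp add: axis_def M_uminus N.M_uminus)
  qed (use assms in auto)
  then show ?thesis by simp
qed

lemma M2_multiple: "M2 (int m *s axis k 1) = y ^ m"
  using N.M_power[of "axis k 1" m] by (simp add: M2_axis_k)

lemma M2_frobenius: "M2 (int l *s axis k 1) = M (int l *s u) + M (int l *s v)"
  by (simp add: M2_multiple y_frobenius)

lemma y_power_central: "y ^ (l * r) \<in> central_torus"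
proof (induction r)
  case 0
  have "M 0 \<in> central_torus" by (rule span_base) (auto intro!: exI[of _ 0])
  then show ?case by simp
next
  case (Suc r)
  have "y ^ l \<in> central_torus"
    unfolding y_frobenius by (intro span_add span_base) (auto simp: dvd_vec_scale)
  from span_M_mult[OF this Suc, of "dvd_vec l"] show ?case
    by (simp add: power_add dvd_vec_add_right)
qed

lemma M2_decompose:
  assumes "0 \<le> f$k"
  obtains c where "M2 f = sc c (M (forget k f) * y ^ nat (f$k))"
proof
  have "f = forget k f + int (nat (f$k)) *s axis k 1"
    using forget_decompose[of k f] assms by simp
  then have "M2 f = M2 (forget k f + int (nat (f$k)) *s axis k 1)" by (rule arg_cong)
  also have "\<dots> = sc (q powi (- bichar L2 (forget k f) (int (nat (f$k)) *s axis k 1)))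
      (M (forget k f) * y ^ nat (f$k))"
    unfolding N.M_add M2_multiple by (simp add: M2_eq_M forget_nth)
  finally show "M2 f = \<dots>" .
qed

lemma M2_in_torus:
  assumes "0 \<le> f$k"
  shows "M2 f \<in> torus"
proof -
  have "y ^ m \<in> torus" for m
    by (rule subsetD[OF span_subset_torus y_power_in_span])
  with M2_decompose[OF assms] show ?thesis by (metis span_scale torus_mult M_in_torus)
qed

text \<open>\<open>M2 f\<close> is a scalar times \<open>M g * y ^ m\<close>. If \<open>l\<close>
  divides \<open>m\<close>, the power of \<open>y\<close> is central and the question passes to
  \<open>g\<close>. Otherwise all monomials of the product have k-th coordinate \<open>- m\<close>,
  which \<open>l\<close> does not divide, and the trace is 0.\<close>

lemma tr_M2:
  assumes "0 \<le> f$k"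
  shows "tr (M2 f) = (if dvd_vec l f then M2 f else 0)"
proof -
  define m where "m = nat (f$k)"
  define g where "g = forget k f"
  obtain c where c: "M2 f = sc c (M g * y ^ m)"
    using M2_decompose[OF assms] unfolding m_def g_def by blast
  have y_torus: "y ^ m \<in> torus" by (rule subsetD[OF span_subset_torus y_power_in_span])
  show ?thesis
  proof (cases "l dvd m")
    case True
    then obtain r where r: "m = l * r" by (auto simp: dvd_def)
    have z: "y ^ m \<in> central_torus" unfolding r by (rule y_power_central)
    have "int l dvd f$k" using True assms by (metis int_nat_eq m_def of_nat_dvd_iff)
    then have "dvd_vec l f \<longleftrightarrow> dvd_vec l g"
      by (auto simp: dvd_vec_def g_def forget_nth)
    moreover have "tr (M g * y ^ m) = (if dvd_vec l g then M g * y ^ m else 0)"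
      using tr_central_mult[OF z, of "M g"] central_torus_central[OF z, of "M g"]
      by (simp add: proj_M)
    ultimately show ?thesis using y_torus by (simp add: c proj_scale torus_mult)
  next
    case False
    have "M g \<in> span {M h | h. h$k = 0}" by (rule span_base) (auto simp: g_def forget_nth)
    from span_M_mult[OF this y_power_in_span[of m], of "\<lambda>h. h$k = - int m"]
    have span: "M g * y ^ m \<in> span {M h | h. h$k = - int m}" by simp
    have "\<not> dvd_vec l h" if "h$k = - int m" for h :: "int^'n"
      using that False by (metis dvd_minus_iff dvd_vec_def of_nat_dvd_iff)
    then have "tr (M g * y ^ m) = 0" using proj_eq_0[OF span] by blast
    moreover have "\<not> dvd_vec l f"
      using False assms by (metis dvd_vec_def int_nat_eq m_def of_nat_dvd_iff)
    ultimately show ?thesis using y_torus by (simp add: c proj_scale torus_mult)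
  qed
qed

text \<open>The exponent is a multiple of \<open>l\<close> so that the multiplier is central in both
  tori and can be pulled out of both traces.\<close>

lemma N_torus_absorb:
  assumes "x \<in> N.torus"
  shows "\<exists>r. \<forall>s\<ge>r. y ^ (l * s) * x \<in> span {M2 f | f. 0 \<le> f$k}"
  using assms
proof (induction rule: span_induct_alt)
  case base
  then show ?case by (auto simp: span_zero)
next
  case (step c w x)
  then obtain f r where f: "w = M2 f"
    and r: "\<And>s. r \<le> s \<Longrightarrow> y ^ (l * s) * x \<in> span {M2 f | f. 0 \<le> f$k}"
    by auto
  show ?case
  proof (intro exI allI impI)
    fix s assume s: "max r (nat \<bar>f$k\<bar>) \<le> s"
    have "s \<le> l * s" using l_pos by simp
    then have "int s \<le> int (l * s)" by (simp only: of_nat_le_iff)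
    then have "0 \<le> int (l * s) + f $ k" using s by linarith
    then have "0 \<le> (int (l * s) *s axis k 1 + f) $ k" by (simp add: axis_def)
    then have "M2 (int (l * s) *s axis k 1) * M2 f \<in> span {M2 f | f. 0 \<le> f$k}"
      unfolding N.M_mult by (intro span_scale span_base) blast
    then show "y ^ (l * s) * (sc c w + x) \<in> span {M2 f | f. 0 \<le> f$k}"
      using r[of s] s unfolding M2_multiple
      by (auto simp: f distrib_left sc_mult_right intro!: span_add span_scale)
  qed
qed

text \<open>After multiplication by \<open>y ^ (l * s)\<close> the element is a combination of
  \<open>M2 f\<close> with \<open>f$k \<ge> 0\<close>. These lie in both tori, and
  \<open>tr_M2\<close> shows that their traces agree. The nonzero multiplier is then
  cancelled.\<close>

theorem tr_eq:
  assumes "x \<in> torus" "x \<in> N.torus"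
  shows "tr x = N.tr x"
proof -
  obtain s where s: "y ^ (l * s) * x \<in> span {M2 f | f. 0 \<le> f$k}"
    using N_torus_absorb[OF assms(2)] by blast
  have "w \<in> torus \<and> w \<in> N.torus \<and> tr w = N.tr w" if "w \<in> span {M2 f | f. 0 \<le> f$k}" for w
    using that
  proof (induction rule: span_induct_alt)
    case base
    then show ?case by (simp add: span_zero)
  next
    case (step c w x)
    then obtain f where f: "w = M2 f" "0 \<le> f$k" by auto
    then have "w \<in> torus" "w \<in> N.torus" "tr w = N.tr w"
      using M2_in_torus tr_M2 by (auto simp: N.proj_M)
    then show ?case using step
      by (auto simp: proj_add proj_scale N.proj_add N.proj_scale span_scale intro: span_add span_scale)
  qed
  from this[OF s] have "tr (y ^ (l * s) * x) = N.tr (y ^ (l * s) * x)" by blast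
  moreover have "tr (y ^ (l * s) * x) = y ^ (l * s) * tr x"
    by (rule tr_central_mult[OF y_power_central assms(1)])
  moreover have "N.tr (y ^ (l * s) * x) = y ^ (l * s) * N.tr x"
  proof (rule N.tr_central_mult[OF _ assms(2)])
    have "dvd_vec l (int (l * s) *s axis k 1 :: int^'n)" by (auto simp: dvd_vec_def)
    then show "y ^ (l * s) \<in> N.central_torus"
      unfolding M2_multiple[symmetric] by (auto intro: span_base)
  qed
  ultimately show ?thesis using y_nonzero by simp
qed

end

lemma quantum_seed_iff:
  "quantum_seed sc q l ex d (M, B) \<longleftrightarrow>
     skew_symmetrizer ex d B \<and> (\<exists>L. toric_frame sc q l L M \<and> compatible l ex d L B)"
  by (simp add: quantum_seed_def compatible_iff)

section \<open>Quantum seeds and traces along mutation sequences\<close>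

locale root_of_unity_algebra = div_algebra sc
  for sc :: "'k::field_char_0 \<Rightarrow> 'd::division_ring \<Rightarrow> 'd" +
  fixes q :: 'k and l :: nat and ex :: "'n::finite set" and d :: "'n \<Rightarrow> nat"
  assumes prim: "primitive_root_of_unity l q" and odd: "odd l"
    and coprime_d: "\<And>j. j \<in> ex \<Longrightarrow> coprime l (d j)"
begin

lemma frameI: "toric_frame sc q l L M \<Longrightarrow> frame sc q l L M"
  by unfold_locales (auto simp: prim odd)

text \<open>A mutation comes with its own lift of the bicharacter, possibly different from the one
  witnessing compatibility of the seed; the frame determines both modulo \<open>l\<close>.\<close>

lemma lift_unique:
  assumes "toric_frame sc q l L1 M" "toric_frame sc q l L2 M"
  shows "[bichar L1 f g = bichar L2 f g] (mod int l)"
proof -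
  interpret F: frame sc q l L1 M by (rule frameI[OF assms(1)])
  interpret G: frame sc q l L2 M by (rule frameI[OF assms(2)])
  have "sc (q powi bichar L1 f g) (M (f + g)) = sc (q powi bichar L2 f g) (M (f + g))"
    by (rule trans[OF sym[OF F.M_mult] G.M_mult])
  then have "q powi bichar L1 f g = q powi bichar L2 f g"
    using F.M_nonzero by (simp only: scale_cancel_right simp_thms)
  then show ?thesis by (simp only: powi_eq_iff_cong[OF prim])
qed

lemma frame_mutatorI:
  assumes "toric_frame sc q l L M" "skew_symmetrizer ex d B" "compatible l ex d L B" "k \<in> ex"
  shows "frame_mutator sc q l L M B k (d k)"
proof -
  interpret frame sc q l L M by (rule frameI[OF assms(1)])
  show ?thesis
    using assms coprime_d skew_symmetrizer_diag by unfold_locales (auto simp: compatible_def)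
qed

lemma quantum_mutation_exists:
  assumes "quantum_seed sc q l ex d (M, B)" "k \<in> ex"
  shows "\<exists>M'. frame_mutation sc q l k B M M'"
  using assms frame_mutatorI frame_mutator.frame_mutation_exists
  unfolding quantum_seed_iff by blast

lemma quantum_mutation:
  assumes seed: "quantum_seed sc q l ex d (M, B)" and k: "k \<in> ex" and mut: "frame_mutation sc q l k B M M2"
  obtains L L2 where "frame_mutation_pair sc q l L M B k (d k) L2 M2"
    "quantum_seed sc q l ex d (M2, mutate_matrix k B)"
proof -
  obtain L0 where L0: "toric_frame sc q l L0 M" "compatible l ex d L0 B" and B: "skew_symmetrizer ex d B"
    using seed by (auto simp: quantum_seed_iff)
  obtain L L2 where L: "toric_frame sc q l L M" "toric_frame sc q l L2 M2"
      "\<And>i j. i \<noteq> k \<Longrightarrow> j \<noteq> k \<Longrightarrow> [L2$i$j = L$i$j] (mod int l)"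
      "\<And>i. i \<noteq> k \<Longrightarrow> [L2$i$k = bichar L (axis i 1) (mutation_vec k B)] (mod int l)"
      "\<And>i. i \<noteq> k \<Longrightarrow> M2 (axis i 1) = M (axis i 1)"
      "M2 (axis k 1) = M (mutation_vec k B) + M (- axis k 1 - neg_part (column k B))"
    using mut unfolding frame_mutation_def mutation_vec_def by blast
  have comp: "compatible l ex d L B"
    using L0(2) lift_unique[OF L(1) L0(1)] cong_trans unfolding compatible_def by blast
  interpret P: frame_mutator sc q l L M B k "d k" by (rule frame_mutatorI[OF L(1) B comp k])
  interpret N: frame sc q l L2 M2 by (rule frameI[OF L(2)])
  have entries: "[L2$i$j = bichar L (mutation_map k B (axis i 1)) (mutation_map k B (axis j 1))] (mod int l)" for i j
    by (rule bichar_mutation_entries[OF P.skew N.skew odd L(3,4)])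
  show ?thesis
  proof (rule that[of L L2])
    show "frame_mutation_pair sc q l L M B k (d k) L2 M2"
      by unfold_locales (auto simp: L(5,6) P.y_def P.v_def entries)
    show "quantum_seed sc q l ex d (M2, mutate_matrix k B)"
      using skew_symmetrizer_mutate[OF B k] compatible_mutate[OF B k comp entries] L(2)
      by (auto simp: quantum_seed_iff)
  qed
qed

definition frame_tr :: "(int^'n \<Rightarrow> 'd) \<Rightarrow> 'd \<Rightarrow> 'd" where
  "frame_tr M = independent_family.proj sc M (dvd_vec l)"

lemma mixed_quantum_torus_eq:
  "mixed_quantum_torus sc U M = span {M f | f. \<forall>j. j \<notin> U \<longrightarrow> 0 \<le> f$j}"
  by (simp add: mixed_quantum_torus_def)

lemma upper_quantum_subset:
  assumes "(quantum_seed_mutation sc q l ex)\<^sup>*\<^sup>* (M, B) (M2, B2)"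
    "x \<in> upper_quantum_cluster_algebra sc q l ex invt M B"
  shows "x \<in> mixed_quantum_torus sc (ex \<union> invt) M2"
  using assms by (auto simp: upper_quantum_cluster_algebra_def)

lemma frame_tr_mutation_invariant:
  assumes "quantum_seed sc q l ex d (M, B)"
    and "(quantum_seed_mutation sc q l ex)\<^sup>*\<^sup>* (M, B) (M2, B2)"
    and x: "x \<in> upper_quantum_cluster_algebra sc q l ex invt M B"
  shows "quantum_seed sc q l ex d (M2, B2)" "frame_tr M2 x = frame_tr M x"
proof -
  have "quantum_seed sc q l ex d S \<and> frame_tr (fst S) x = frame_tr M x"
    if "(quantum_seed_mutation sc q l ex)\<^sup>*\<^sup>* (M, B) S" for S
    using that
  proof (induction rule: rtranclp_induct)
    case base
    then show ?case using assms(1) by simp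
  next
    case (step S S')
    obtain M1 B1 M2 B2 where S: "S = (M1, B1)" "S' = (M2, B2)" by (metis surj_pair)
    obtain k where k: "k \<in> ex" "frame_mutation sc q l k B1 M1 M2" "B2 = mutate_matrix k B1"
      using step(2) by (auto simp: S quantum_seed_mutation_def)
    obtain L L2 where pair: "frame_mutation_pair sc q l L M1 B1 k (d k) L2 M2"
        and seed: "quantum_seed sc q l ex d (M2, mutate_matrix k B1)"
      using quantum_mutation[of M1 B1 k M2] step.IH k by (auto simp: S)
    interpret P: frame_mutation_pair sc q l L M1 B1 k "d k" L2 M2 by (rule pair)
    have mixed: "x \<in> mixed_quantum_torus sc (ex \<union> invt) M1" "x \<in> mixed_quantum_torus sc (ex \<union> invt) M2"
      using upper_quantum_subset[OF _ x] step(1,2) S by (metis, metis rtranclp.rtrancl_into_rtrancl)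
    have "x \<in> P.torus"
      by (rule subsetD[OF P.span_subset_torus mixed(1)[unfolded mixed_quantum_torus_eq]])
    moreover have "x \<in> P.N.torus"
      by (rule subsetD[OF P.N.span_subset_torus mixed(2)[unfolded mixed_quantum_torus_eq]])
    ultimately show ?case using P.tr_eq step.IH seed k(3) by (simp add: S frame_tr_def)
  qed
  from this[OF assms(2)] show "quantum_seed sc q l ex d (M2, B2)" "frame_tr M2 x = frame_tr M x"
    by auto
qed

lemma quantum_seed_reachable:
  assumes "quantum_seed sc q l ex d (M, B)"
    and "(quantum_seed_mutation sc q l ex)\<^sup>*\<^sup>* (M, B) (M2, B2)"
  shows "quantum_seed sc q l ex d (M2, B2)"
proof -
  \<comment> \<open>Preservation of seeds was proved jointly with the invariance of the trace of
    some element \<open>x\<close>; 0 serves as a placeholder for it.\<close>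
  have "0 \<in> upper_quantum_cluster_algebra sc q l ex {} M B"
    by (auto simp: upper_quantum_cluster_algebra_def mixed_quantum_torus_eq span_zero)
  from frame_tr_mutation_invariant(1)[OF assms this] show ?thesis .
qed

text \<open>By invariance the trace may be computed in the frame of any reachable seed, where it
  merely deletes monomials and so stays in the mixed torus.\<close>

lemma frame_tr_in_upper_quantum:
  assumes seed: "quantum_seed sc q l ex d (M, B)"
    and x: "x \<in> upper_quantum_cluster_algebra sc q l ex invt M B"
  shows "frame_tr M x \<in> upper_quantum_cluster_algebra sc q l ex invt M B"
  unfolding upper_quantum_cluster_algebra_def
proof (safe)
  fix M2 B2 assume reach: "(quantum_seed_mutation sc q l ex)\<^sup>*\<^sup>* (M, B) (M2, B2)"
  obtain L where "toric_frame sc q l L M2"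
    using quantum_seed_reachable[OF seed reach] by (auto simp: quantum_seed_iff)
  then interpret F: frame sc q l L M2 by (rule frameI)
  let ?P = "\<lambda>f :: int^'n. \<forall>j. j \<notin> ex \<union> invt \<longrightarrow> 0 \<le> f$j"
  have "x \<in> span {M2 f | f. ?P f}"
    using upper_quantum_subset[OF reach x] by (simp add: mixed_quantum_torus_eq)
  then have "F.tr x \<in> span {M2 f | f. ?P f \<and> dvd_vec l f}" by (rule F.proj_in_span)
  also have "\<dots> \<subseteq> span {M2 f | f. ?P f}" by (rule span_mono) auto
  finally show "frame_tr M x \<in> mixed_quantum_torus sc (ex \<union> invt) M2"
    using frame_tr_mutation_invariant(2)[OF seed reach x]
    by (simp add: mixed_quantum_torus_eq frame_tr_def)
qed

end

section \<open>The central subfield\<close>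

text \<open>One commutative ring of Laurent polynomials will be mapped both into the classical field
  and into the division ring. Equality of fractions is decided in the source, so fractions on the
  two sides correspond. Absence of zero divisors in \<open>'g\<close> is inherited from the
  target.\<close>

locale domain_hom =
  fixes h :: "'g::comm_ring_1 \<Rightarrow> 'd::division_ring"
  assumes h_add: "h (a + b) = h a + h b" and h_mult: "h (a * b) = h a * h b"
    and h_1: "h 1 = 1" and h_eq_0_iff: "h a = 0 \<longleftrightarrow> a = 0"
begin

definition frac :: "'g \<Rightarrow> 'g \<Rightarrow> 'd" where
  "frac a b = h a * inverse (h b)"

lemma mult_nonzero:
  fixes b b' :: 'g
  assumes "b \<noteq> 0" "b' \<noteq> 0"
  shows "b * b' \<noteq> 0"
proof -
  have "h (b * b') \<noteq> 0" unfolding h_mult using assms by (simp add: h_eq_0_iff)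
  then show ?thesis by (simp only: h_eq_0_iff not_False_eq_True)
qed

lemma frac_cancel: "b \<noteq> 0 \<Longrightarrow> frac a b * h b = h a"
  by (simp add: frac_def mult.assoc h_eq_0_iff)

lemma frac_cancel_mult:
  assumes "b \<noteq> 0"
  shows "frac a b * h (b * b') = h (a * b')" "frac a b * h (b' * b) = h (a * b')"
proof -
  show *: "frac a b * h (b * b') = h (a * b')"
    using frac_cancel[OF assms, of a] by (simp add: h_mult mult.assoc[symmetric])
  then show "frac a b * h (b' * b) = h (a * b')"
    by (simp only: mult.commute[of b' b])
qed

lemma frac_unique:
  assumes "b \<noteq> 0" "z * h b = h a"
  shows "z = frac a b"
proof -
  have "z * h b = frac a b * h b" using frac_cancel[OF assms(1)] assms(2) by simp
  then show ?thesis using assms(1) by (simp add: h_eq_0_iff)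
qed

lemma frac_eq_iff:
  assumes "b \<noteq> 0" "b' \<noteq> 0"
  shows "frac a b = frac a' b' \<longleftrightarrow> a * b' = a' * b"
proof -
  have "h (b * b') \<noteq> 0" using mult_nonzero[OF assms] by (simp add: h_eq_0_iff)
  then have "frac a b = frac a' b' \<longleftrightarrow> frac a b * h (b * b') = frac a' b' * h (b * b')"
    by simp
  also have "\<dots> \<longleftrightarrow> h (a * b') = h (a' * b)"
    by (simp only: frac_cancel_mult[OF assms(1)] frac_cancel_mult[OF assms(2)])
  also have "\<dots> \<longleftrightarrow> a * b' = a' * b"
  proof
    assume "h (a * b') = h (a' * b)"
    then have "h (a * b' - a' * b) = 0" using h_add[of "a * b' - a' * b" "a' * b"] by simp
    then show "a * b' = a' * b" by (simp add: h_eq_0_iff)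
  qed simp
  finally show ?thesis .
qed

lemma frac_add:
  assumes "b \<noteq> 0" "b' \<noteq> 0"
  shows "frac a b + frac a' b' = frac (a * b' + a' * b) (b * b')"
  by (rule frac_unique)
    (simp_all only: mult_nonzero assms distrib_right frac_cancel_mult[OF assms(1)]
      frac_cancel_mult[OF assms(2)] h_add not_False_eq_True)

lemma frac_mult:
  assumes "b \<noteq> 0" "b' \<noteq> 0"
  shows "frac a b * frac a' b' = frac (a * a') (b * b')"
proof (rule frac_unique)
  have "frac a b * frac a' b' * h (b * b') = frac a b * (frac a' b' * h (b * b'))"
    by (rule mult.assoc)
  also have "\<dots> = frac a b * h (b * a')"
    by (simp only: frac_cancel_mult[OF assms(2)] mult.commute[of a' b])
  also have "\<dots> = h (a * a')" by (rule frac_cancel_mult(1)[OF assms(1)])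
  finally show "frac a b * frac a' b' * h (b * b') = h (a * a')" .
qed (rule mult_nonzero[OF assms])

lemma frac_inverse: "a \<noteq> 0 \<Longrightarrow> b \<noteq> 0 \<Longrightarrow> inverse (frac a b) = frac b a"
  by (simp add: frac_def nonzero_inverse_mult_distrib h_eq_0_iff)

lemma frac_1: "frac a 1 = h a"
  by (simp add: frac_def h_1)

end

lemma (in div_algebra) domain_hom_frame_extension:
  assumes "inj (frame_extension sc N)" "\<And>f g. N f * N g = N (f + g)" "N 0 = 1"
  shows "domain_hom (frame_extension sc N)"
proof
  have "frame_extension sc N (Poly_Mapping.single 0 1) = 1"
    unfolding frame_extension_single by (simp add: assms(3))
  then show "frame_extension sc N 1 = 1" by simp
  show "frame_extension sc N a = 0 \<longleftrightarrow> a = 0" for a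
    using assms(1) by (metis frame_extension_0 injD)
qed (simp_all add: frame_extension_add frame_extension_mult assms)

lemma (in independent_family) inj_frame_extension_comp:
  fixes \<phi> :: "int^'m::finite \<Rightarrow> int^'n"
  assumes "inj \<phi>"
  shows "inj (frame_extension sc (\<lambda>f. M (\<phi> f)))"
proof (rule injI)
  fix a b assume eq: "frame_extension sc (\<lambda>f. M (\<phi> f)) a = frame_extension sc (\<lambda>f. M (\<phi> f)) b"
  define push where "push = (\<lambda>a :: (int^'m) \<Rightarrow>\<^sub>0 'k. \<Sum>f\<in>Poly_Mapping.keys a. Poly_Mapping.single (\<phi> f) (Poly_Mapping.lookup a f))"
  have "frame_extension sc M (push a) = frame_extension sc (\<lambda>f. M (\<phi> f)) a" for a
    by (simp add: push_def frame_extension_sum) (simp add: frame_extension_def)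
  with eq have push: "push a = push b" using inj_frame by (metis injD)
  have "Poly_Mapping.lookup (push a) (\<phi> f) = Poly_Mapping.lookup a f" for a f
  proof -
    have "Poly_Mapping.lookup (push a) (\<phi> f)
        = (\<Sum>g\<in>Poly_Mapping.keys a. if g = f then Poly_Mapping.lookup a f else 0)"
      using assms by (auto simp: push_def lookup_sum lookup_single when_def inj_eq intro!: sum.cong)
    then show ?thesis by (simp add: in_keys_iff)
  qed
  then show "a = b" using push by (metis poly_mapping_eqI)
qed

section \<open>Laurent monomials\<close>

definition laurent_monomial :: "('n::finite \<Rightarrow> 'f::field) \<Rightarrow> int^'n \<Rightarrow> 'f" where
  "laurent_monomial x f = (\<Prod>i\<in>UNIV. x i powi f$i)"

lemma laurent_monomial_add:
  assumes "\<And>i. x i \<noteq> 0"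
  shows "laurent_monomial x (f + g) = laurent_monomial x f * laurent_monomial x g"
  using assms by (simp add: laurent_monomial_def power_int_add prod.distrib)

lemma laurent_monomial_0 [simp]: "laurent_monomial x 0 = 1"
  by (simp add: laurent_monomial_def)

lemma laurent_monomial_axis [simp]: "laurent_monomial x (axis j 1) = x j"
proof -
  have "(\<Prod>i\<in>UNIV. x i powi axis j 1 $ i) = (\<Prod>i\<in>UNIV. if i = j then x j else 1)"
    by (intro prod.cong) (auto simp: axis_def)
  then show ?thesis by (simp add: laurent_monomial_def)
qed

lemma laurent_monomial_uminus: "laurent_monomial x (- f) = inverse (laurent_monomial x f)"
  by (simp add: laurent_monomial_def power_int_minus prod_inversef[symmetric] o_def)

text \<open>Brings the classical exchange relation to the shape of the quantum one: two Laurent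
  monomials with the same exponents as in the frame mutation.\<close>

lemma mutate_cluster_eq:
  assumes "\<And>i. x i \<noteq> 0"
  shows "mutate_cluster k B x k = laurent_monomial x (- axis k 1 + pos_part (column k B))
     + laurent_monomial x (- axis k 1 - neg_part (column k B))"
proof -
  have "laurent_monomial x (pos_part (column k B)) = (\<Prod>i\<in>UNIV. if B$i$k > 0 then x i ^ nat (B$i$k) else 1)"
    unfolding laurent_monomial_def
    by (intro prod.cong) (auto simp: pos_part_def column_def power_int_def max_def)
  moreover have "laurent_monomial x (- neg_part (column k B)) = (\<Prod>i\<in>UNIV. if B$i$k < 0 then x i ^ nat (- B$i$k) else 1)"
    unfolding laurent_monomial_def
    by (intro prod.cong) (auto simp: neg_part_def column_def power_int_def min_def)
  moreover have "laurent_monomial x (- axis k 1 - neg_part (column k B))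
      = inverse (x k) * laurent_monomial x (- neg_part (column k B))"
    using laurent_monomial_add[where f = "- axis k 1" and g = "- neg_part (column k B)", OF assms]
    by (simp add: laurent_monomial_uminus[of x "axis k 1"])
  moreover have "laurent_monomial x (- axis k 1 + pos_part (column k B))
      = inverse (x k) * laurent_monomial x (pos_part (column k B))"
    using laurent_monomial_add[where f = "- axis k 1" and g = "pos_part (column k B)", OF assms]
    by (simp add: laurent_monomial_uminus[of x "axis k 1"])
  ultimately show ?thesis
    by (simp add: mutate_cluster_def prod.inter_filter[symmetric] divide_inverse distrib_left mult.commute)
qed

lemma eval_mpoly_single: "algebra_over sc \<Longrightarrow> eval_mpoly sc x (Poly_Mapping.single m c)
    = sc c (\<Prod>i\<in>UNIV. x i ^ Poly_Mapping.lookup m i)"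
proof -
  assume "algebra_over sc"
  then interpret algebra_over sc .
  show ?thesis by (cases "c = 0") (simp_all add: eval_mpoly_def)
qed

lemma eval_mpoly_sum:
  assumes "algebra_over sc"
  shows "eval_mpoly sc x (sum p I) = (\<Sum>i\<in>I. eval_mpoly sc x (p i))"
proof -
  interpret algebra_over sc by (rule assms)
  have superset: "eval_mpoly sc x p = (\<Sum>m\<in>A. sc (Poly_Mapping.lookup p m) (\<Prod>i\<in>UNIV. x i ^ Poly_Mapping.lookup m i))"
    if "finite A" "Poly_Mapping.keys p \<subseteq> A" for A p
    unfolding eval_mpoly_def using that by (intro sum.mono_neutral_left) (auto simp: in_keys_iff)
  have add: "eval_mpoly sc x (p + p') = eval_mpoly sc x p + eval_mpoly sc x p'" for p p'
    by (subst (1 2 3) superset[of "Poly_Mapping.keys p \<union> Poly_Mapping.keys p'"])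
      (auto simp: lookup_add scale_left_distrib sum.distrib dest: Poly_Mapping.keys_add[THEN subsetD])
  show ?thesis
    by (induction I rule: infinite_finite_induct) (auto simp: add, auto simp: eval_mpoly_def)
qed

lemma algebraically_independent_nonzero:
  fixes sc :: "'k::field \<Rightarrow> 'f::field \<Rightarrow> 'f" and x :: "'n::finite \<Rightarrow> 'f"
  assumes "algebra_over sc" "algebraically_independent sc x"
  shows "x j \<noteq> 0"
proof
  interpret algebra_over sc by (rule assms(1))
  assume "x j = 0"
  define m where "m = Poly_Mapping.single j (1::nat)"
  have "eval_mpoly sc x (Poly_Mapping.single m 1) = 0"
    unfolding eval_mpoly_single[OF assms(1)] using \<open>x j = 0\<close>
    by (auto intro!: bexI[of _ j] simp: m_def lookup_single)
  then have "Poly_Mapping.single m 1 = (0 :: ('n \<Rightarrow>\<^sub>0 nat) \<Rightarrow>\<^sub>0 'k)"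
    using assms(2) by (auto simp: algebraically_independent_def)
  then have "Poly_Mapping.lookup (Poly_Mapping.single m (1::'k)) m = 0" by simp
  then show False by (simp add: lookup_single)
qed

text \<open>Algebraic independence concerns polynomials, so a Laurent relation is first multiplied
  by a high power of the product of all variables.\<close>

lemma laurent_monomials_independent:
  fixes x :: "'n::finite \<Rightarrow> 'f::field"
  assumes sc: "algebra_over sc" and x: "algebraically_independent sc x"
  shows "inj (frame_extension sc (laurent_monomial x))"
proof -
  interpret div_algebra sc using sc by (simp add: div_algebra_def)
  note nz = algebraically_independent_nonzero[OF sc x]
  have kernel: "a = 0" if a: "frame_extension sc (laurent_monomial x) a = 0" for a
  proof (rule poly_mapping_eqI)
    fix f0 :: "int^'n"
    \<comment> \<open>\<open>f0\<close> is adjoined so that its coefficient can be read off whether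
      or not it belongs to the support.\<close>
    let ?K = "insert f0 (Poly_Mapping.keys a)"
    define r where "r = (\<Sum>f\<in>?K. \<Sum>i\<in>UNIV. nat \<bar>f$i\<bar>)"
    have r: "0 \<le> f$i + int r" if "f \<in> ?K" for f i
    proof -
      have "nat \<bar>f$i\<bar> \<le> (\<Sum>i\<in>UNIV. nat \<bar>f$i\<bar>)" by (rule member_le_sum) auto
      also have "\<dots> \<le> r" unfolding r_def using that by (intro member_le_sum) auto
      finally show ?thesis by linarith
    qed
    define \<nu> where "\<nu> = (\<lambda>f :: int^'n. Abs_poly_mapping (\<lambda>i. nat (f$i + int r)))"
    have \<nu>: "Poly_Mapping.lookup (\<nu> f) i = nat (f$i + int r)" for f i
      unfolding \<nu>_def by (subst Abs_poly_mapping_inverse) auto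
    have \<nu>_inj: "f = f0" if "\<nu> f = \<nu> f0" "f \<in> ?K" for f
    proof -
      have "f$i = f0$i" for i
        using arg_cong[OF that(1), of "\<lambda>p. Poly_Mapping.lookup p i"] r[OF that(2), of i] r[of f0 i]
        by (simp add: \<nu>)
      then show ?thesis by (simp add: Finite_Cartesian_Product.vec_eq_iff)
    qed
    define p where "p = (\<Sum>f\<in>?K. Poly_Mapping.single (\<nu> f) (Poly_Mapping.lookup a f))"
    have "eval_mpoly sc x p = (\<Sum>f\<in>?K. sc (Poly_Mapping.lookup a f) (\<Prod>i\<in>UNIV. x i ^ nat (f$i + int r)))"
      by (simp only: p_def eval_mpoly_sum[OF sc] eval_mpoly_single[OF sc] \<nu>)
    also have "\<dots> = (\<Sum>f\<in>?K. sc (Poly_Mapping.lookup a f) (laurent_monomial x f)) * (\<Prod>i\<in>UNIV. x i ^ r)"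
      unfolding sum_distrib_right
    proof (intro sum.cong refl)
      fix f assume f: "f \<in> ?K"
      have "x i ^ nat (f$i + int r) = x i powi f$i * x i ^ r" for i
        using r[OF f, of i] nz[of i]
        by (simp add: power_int_def[of _ "f$i + int r", symmetric] power_int_add flip: power_int_of_nat)
      then show "sc (Poly_Mapping.lookup a f) (\<Prod>i\<in>UNIV. x i ^ nat (f$i + int r))
          = sc (Poly_Mapping.lookup a f) (laurent_monomial x f) * (\<Prod>i\<in>UNIV. x i ^ r)"
        by (simp add: laurent_monomial_def prod.distrib sc_mult_left)
    qed
    also have "(\<Sum>f\<in>?K. sc (Poly_Mapping.lookup a f) (laurent_monomial x f)) = 0"
      using a by (subst frame_extension_superset[symmetric]) auto
    finally have "p = 0" using x by (simp add: algebraically_independent_def)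
    then have "Poly_Mapping.lookup p (\<nu> f0) = 0" by simp
    moreover have "Poly_Mapping.lookup p (\<nu> f0) = (\<Sum>f\<in>?K. if f = f0 then Poly_Mapping.lookup a f0 else 0)"
      unfolding p_def lookup_sum
      by (intro sum.cong refl) (use \<nu>_inj in \<open>auto simp: lookup_single when_def\<close>)
    ultimately show "Poly_Mapping.lookup a f0 = Poly_Mapping.lookup 0 f0" by simp
  qed
  show ?thesis
  proof (rule injI)
    fix a b assume "frame_extension sc (laurent_monomial x) a = frame_extension sc (laurent_monomial x) b"
    then have "frame_extension sc (laurent_monomial x) (a - b) = 0"
      using frame_extension_add[of "laurent_monomial x" "a - b" b] by simp
    then show "a = b" using kernel[of "a - b"] by simp
  qed
qed

lemma mixed_laurent_ring_monomial:
  assumes sc: "algebra_over sc" and f: "\<And>j. j \<notin> U \<Longrightarrow> 0 \<le> f$j"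
  shows "laurent_monomial x f \<in> mixed_laurent_ring sc U x"
proof -
  let ?R = "mixed_laurent_ring sc U x"
  have R: "is_subalgebra sc ?R" unfolding mixed_laurent_ring_def by (rule is_subalgebra_hull)
  have gen: "x i \<in> ?R" "i \<in> U \<Longrightarrow> inverse (x i) \<in> ?R" for i
    unfolding mixed_laurent_ring_def by (auto intro: hull_inc)
  have pow: "z ^ n \<in> ?R" if "z \<in> ?R" for z n
    using that by (induction n) (auto intro: is_subalgebraD[OF R])
  have "x i powi f$i \<in> ?R" for i
  proof (cases "0 \<le> f$i")
    case True
    then show ?thesis by (simp add: power_int_def pow gen)
  next
    case False
    then have "i \<in> U" using f by auto
    then show ?thesis using False by (simp add: power_int_def pow gen)
  qed
  then have "(\<Prod>i\<in>I. x i powi f$i) \<in> ?R" for I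
    by (induction I rule: infinite_finite_induct) (auto intro: is_subalgebraD[OF R])
  then show ?thesis by (simp add: laurent_monomial_def)
qed

section \<open>The classical field inside the division ring\<close>

locale central_field = frame sc q l L M + F: div_algebra scF
  for sc :: "'k::field_char_0 \<Rightarrow> 'd::division_ring \<Rightarrow> 'd" and q l
    and L :: "int^'n::finite^'n" and M and scF :: "'k \<Rightarrow> 'f::field \<Rightarrow> 'f" +
  fixes x :: "'n \<Rightarrow> 'f"
  assumes independent: "algebraically_independent scF x"
    and generating: "is_intermediate_field scF hull (range x) = UNIV"
begin

lemma x_nonzero: "x i \<noteq> 0"
  by (rule algebraically_independent_nonzero[OF F.algebra_over_axioms independent])

abbreviation N :: "int^'n \<Rightarrow> 'd" where
  "N f \<equiv> M (int l *s f)"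

lemma N_mult: "N f * N g = N (f + g)"
proof -
  have "int l *s f + int l *s g = int l *s (f + g)"
    by (simp add: Finite_Cartesian_Product.vec_eq_iff distrib_left)
  then show ?thesis by (simp add: M_mult_dvd_left dvd_vec_scale)
qed

lemma N_0: "N 0 = 1"
proof -
  have "int l *s (0 :: int^'n) = 0" by (simp add: Finite_Cartesian_Product.vec_eq_iff)
  then show ?thesis by simp
qed

lemma N_uminus: "N (- f) = inverse (N f)"
proof -
  have "int l *s (- f) = - (int l *s f)" by (simp add: Finite_Cartesian_Product.vec_eq_iff)
  then show ?thesis by (simp add: M_uminus)
qed

abbreviation evN :: "((int^'n) \<Rightarrow>\<^sub>0 'k) \<Rightarrow> 'd" where
  "evN \<equiv> frame_extension sc (\<lambda>f. N f)"

abbreviation evX :: "((int^'n) \<Rightarrow>\<^sub>0 'k) \<Rightarrow> 'f" where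
  "evX \<equiv> frame_extension scF (laurent_monomial x)"

sublocale NH: domain_hom evN
proof (rule domain_hom_frame_extension)
  have "inj (\<lambda>f :: int^'n. int l *s f)"
    using l_pos by (auto simp: inj_def Finite_Cartesian_Product.vec_eq_iff)
  then show "inj evN" by (rule inj_frame_extension_comp)
qed (simp_all only: N_mult N_0)

sublocale XH: domain_hom evX
  by (rule F.domain_hom_frame_extension)
    (simp_all add: laurent_monomials_independent[OF F.algebra_over_axioms independent]
      laurent_monomial_add x_nonzero)

lemma evN_central: "evN a \<in> central_torus"
  unfolding frame_extension_def by (intro span_sum span_scale span_base) (auto simp: dvd_vec_scale)

text \<open>The embedding that sends \<open>x i\<close> to \<open>M (int l *s axis i 1)\<close>,
  extended to fractions. Independence of the chosen fraction is \<open>frac_eq_iff\<close> applied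
  on both sides.\<close>

definition \<Phi> :: "'f \<Rightarrow> 'd" where
  "\<Phi> y = (THE z. \<exists>a b. b \<noteq> 0 \<and> y = XH.frac a b \<and> z = NH.frac a b)"

lemma \<Phi>_frac:
  assumes "b \<noteq> 0"
  shows "\<Phi> (XH.frac a b) = NH.frac a b"
  unfolding \<Phi>_def
proof (rule the_equality)
  fix z assume "\<exists>a' b'. b' \<noteq> 0 \<and> XH.frac a b = XH.frac a' b' \<and> z = NH.frac a' b'"
  then obtain a' b' where b': "b' \<noteq> 0" "XH.frac a b = XH.frac a' b'" and z: "z = NH.frac a' b'" by blast
  show "z = NH.frac a b"
    using b'(2) unfolding z XH.frac_eq_iff[OF assms b'(1)] NH.frac_eq_iff[OF b'(1) assms] by (rule sym)
qed (use assms in blast)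

lemma one_nonzero_G: "(1 :: (int^'n) \<Rightarrow>\<^sub>0 'k) \<noteq> 0"
  using XH.h_eq_0_iff[of 1] XH.h_1 by auto

lemma frac_exists: "\<exists>a b. b \<noteq> 0 \<and> y = XH.frac a b"
proof -
  let ?K = "{y. \<exists>a b. b \<noteq> 0 \<and> y = XH.frac a b}"
  have "is_intermediate_field scF hull (range x) \<subseteq> ?K"
  proof (rule hull_minimal)
    have monomial: "laurent_monomial x f \<in> ?K" for f
    proof -
      have "laurent_monomial x f = XH.frac (Poly_Mapping.single f 1) 1" by (simp add: XH.frac_1)
      then show ?thesis using one_nonzero_G by blast
    qed
    show "range x \<subseteq> ?K" using monomial[of "axis _ 1"] by auto
    have scale: "scF c (XH.frac a b) = XH.frac (Poly_Mapping.single 0 c * a) b" for c a b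
    proof -
      have "evX (Poly_Mapping.single 0 c * a) = scF c (evX a)"
        by (simp add: XH.h_mult F.sc_mult_left)
      then show ?thesis by (simp add: XH.frac_def F.sc_mult_left)
    qed
    show "is_intermediate_field scF ?K"
      unfolding is_intermediate_field_def is_subalgebra_def
    proof (intro conjI ballI allI)
      show "1 \<in> ?K" using monomial[of 0] by simp
    next
      fix y z assume "y \<in> ?K" "z \<in> ?K"
      then obtain a b a' b' where *: "b \<noteq> 0" "b' \<noteq> 0" "y = XH.frac a b" "z = XH.frac a' b'" by blast
      then show "y + z \<in> ?K" "y * z \<in> ?K"
        using XH.mult_nonzero[OF *(1,2)] XH.frac_add[OF *(1,2)] XH.frac_mult[OF *(1,2)] by blast+
    next
      fix c y assume "y \<in> ?K"
      then show "scF c y \<in> ?K" using scale by blast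
    next
      fix y assume "y \<in> ?K"
      then obtain a b where *: "b \<noteq> 0" "y = XH.frac a b" by blast
      show "inverse y \<in> ?K"
      proof (cases "a = 0")
        case True
        \<comment> \<open>Here \<open>y = 0\<close>, and the convention \<open>inverse 0 = 0\<close>
          keeps the inverse in the set.\<close>
        then have "inverse y = y" using *(2) XH.h_eq_0_iff[of 0] by (simp add: XH.frac_def)
        then show ?thesis using \<open>y \<in> ?K\<close> by simp
      next
        case False
        then show ?thesis using * XH.frac_inverse[of a b] by blast
      qed
    qed
  qed
  then show ?thesis using generating by blast
qed

lemma \<Phi>_add: "\<Phi> (y + z) = \<Phi> y + \<Phi> z"
proof -
  obtain a b a' b' where *: "b \<noteq> 0" "b' \<noteq> 0" "y = XH.frac a b" "z = XH.frac a' b'"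
    using frac_exists by metis
  show ?thesis
    unfolding *(3,4) XH.frac_add[OF *(1,2)] \<Phi>_frac[OF *(1)] \<Phi>_frac[OF *(2)]
      \<Phi>_frac[OF XH.mult_nonzero[OF *(1,2)]] NH.frac_add[OF *(1,2)] ..
qed

lemma \<Phi>_mult: "\<Phi> (y * z) = \<Phi> y * \<Phi> z"
proof -
  obtain a b a' b' where *: "b \<noteq> 0" "b' \<noteq> 0" "y = XH.frac a b" "z = XH.frac a' b'"
    using frac_exists by metis
  show ?thesis
    unfolding *(3,4) XH.frac_mult[OF *(1,2)] \<Phi>_frac[OF *(1)] \<Phi>_frac[OF *(2)]
      \<Phi>_frac[OF XH.mult_nonzero[OF *(1,2)]] NH.frac_mult[OF *(1,2)] ..
qed

lemma \<Phi>_ev: "\<Phi> (evX a) = evN a"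
  using \<Phi>_frac[OF one_nonzero_G, of a] by (simp add: XH.frac_1 NH.frac_1)

lemma \<Phi>_monomial: "\<Phi> (laurent_monomial x f) = N f"
  using \<Phi>_ev[of "Poly_Mapping.single f 1"] by simp

lemma \<Phi>_1: "\<Phi> 1 = 1"
  using \<Phi>_monomial[of 0] N_0 by simp

lemma \<Phi>_0: "\<Phi> 0 = 0"
  using \<Phi>_add[of 0 0] by simp

lemma \<Phi>_eq_0_iff: "\<Phi> y = 0 \<longleftrightarrow> y = 0"
proof
  assume "\<Phi> y = 0"
  then have "\<Phi> (y * inverse y) = 0" by (simp add: \<Phi>_mult)
  then show "y = 0" using \<Phi>_1 by (cases "y = 0") auto
qed (simp add: \<Phi>_0)

lemma \<Phi>_inj: "\<Phi> y = \<Phi> z \<Longrightarrow> y = z"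
  using \<Phi>_add[of "y - z" z] \<Phi>_eq_0_iff[of "y - z"] by simp

lemma \<Phi>_inverse: "\<Phi> (inverse y) = inverse (\<Phi> y)"
proof (cases "y = 0")
  case False
  then have "\<Phi> y * \<Phi> (inverse y) = 1" by (simp add: \<Phi>_mult[symmetric] \<Phi>_1)
  then show ?thesis by (simp add: inverse_unique)
qed (simp add: \<Phi>_0)

lemma \<Phi>_scale: "\<Phi> (scF c y) = sc c (\<Phi> y)"
proof -
  have "\<Phi> (scF c 1) = sc c 1"
    using \<Phi>_ev[of "Poly_Mapping.single 0 c"] N_0 by simp
  then show ?thesis
    by (metis F.sc_eq_mult(1) sc_eq_mult(1) \<Phi>_mult)
qed

lemma \<Phi>_central:
  assumes "w \<in> torus"
  shows "\<Phi> y * w = w * \<Phi> y"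
proof -
  obtain a b where *: "b \<noteq> 0" "y = XH.frac a b" using frac_exists by metis
  have c: "evN a * w = w * evN a" "evN b * w = w * evN b"
    using central_torus_central[OF evN_central assms] by blast+
  have inv: "inverse (evN b) * w = w * inverse (evN b)"
    by (rule mult_commute_imp_mult_inverse_commute) (rule c(2))
  then show ?thesis
    unfolding *(2) \<Phi>_frac[OF *(1)] NH.frac_def
    by (simp only: mult.assoc inv) (simp only: mult.assoc[symmetric] c(1))
qed

section \<open>Left multiplication on the monomials of residue exponents\<close>

definition residues :: "(int^'n) set" where
  "residues = {f. \<forall>i. 0 \<le> f$i \<and> f$i < int l}"

lemma finite_residues: "finite residues"
proof -
  have "finite ((\<lambda>f. \<chi> i. f i) ` (PiE UNIV (\<lambda>_ :: 'n. {0..<int l})))"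
    by (intro finite_imageI finite_PiE) auto
  moreover have "residues \<subseteq> (\<lambda>f. \<chi> i. f i) ` (PiE UNIV (\<lambda>_ :: 'n. {0..<int l}))"
  proof
    fix f :: "int^'n" assume "f \<in> residues"
    then have "(\<lambda>i. f$i) \<in> PiE UNIV (\<lambda>_. {0..<int l})" by (auto simp: residues_def)
    moreover have "f = (\<chi> i. f$i)" by (simp add: Finite_Cartesian_Product.vec_eq_iff)
    ultimately show "f \<in> (\<lambda>f. \<chi> i. f i) ` (PiE UNIV (\<lambda>_. {0..<int l}))" by blast
  qed
  ultimately show ?thesis by (rule finite_subset[rotated])
qed

lemma residues_cong:
  assumes "f \<in> residues" "g \<in> residues" "dvd_vec l (f - g)"
  shows "f = g"
proof -
  have "f$i = g$i" for i
  proof -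
    have "[f$i = g$i] (mod int l)" using assms(3) by (simp add: dvd_vec_def cong_iff_dvd_diff)
    then show ?thesis using assms(1,2) by (intro cong_less_imp_eq_int) (auto simp: residues_def)
  qed
  then show ?thesis by (simp add: Finite_Cartesian_Product.vec_eq_iff)
qed

lemma torus_expand:
  assumes "w \<in> torus"
  shows "\<exists>z. w = (\<Sum>f\<in>residues. \<Phi> (z f) * M f)"
  using assms
proof (induction rule: span_induct_alt)
  case base
  show ?case by (rule exI[of _ "\<lambda>_. 0"]) (simp add: \<Phi>_0)
next
  case (step c u w)
  then obtain h z where h: "u = M h" and z: "w = (\<Sum>f\<in>residues. \<Phi> (z f) * M f)" by auto
  define r where "r = (\<chi> i. h$i mod int l)"
  define g where "g = (\<chi> i. h$i div int l)"
  have r: "r \<in> residues" using l_pos by (simp add: residues_def r_def)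
  have "h = int l *s g + r" by (simp add: Finite_Cartesian_Product.vec_eq_iff r_def g_def)
  then have "M h = N g * M r" by (simp add: M_mult_dvd_left dvd_vec_scale)
  then have u: "sc c u = \<Phi> (scF c (laurent_monomial x g)) * M r"
    by (simp add: h \<Phi>_scale \<Phi>_monomial sc_mult_left)
  have "(\<Sum>f\<in>residues. \<Phi> (z f + (if f = r then scF c (laurent_monomial x g) else 0)) * M f)
      = (\<Sum>f\<in>residues. \<Phi> (z f) * M f + (if f = r then sc c u else 0))"
    by (intro sum.cong) (auto simp: \<Phi>_add \<Phi>_0 distrib_right u)
  also have "\<dots> = w + sc c u" using r by (simp add: sum.distrib z finite_residues)
  finally have eq: "(\<Sum>f\<in>residues. \<Phi> (z f + (if f = r then scF c (laurent_monomial x g) else 0)) * M f)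
      = w + sc c u" .
  show ?case
    by (rule exI[of _ "\<lambda>f. z f + (if f = r then scF c (laurent_monomial x g) else 0)"])
      (rule trans[OF add.commute eq[symmetric]])
qed

text \<open>The coefficients \<open>z f\<close> are fractions, whereas \<open>tr\<close> is linear
  only over the central torus; so they are turned into Laurent polynomials simultaneously.\<close>

lemma common_denominator:
  assumes "finite S"
  shows "\<exists>b. b \<noteq> 0 \<and> (\<forall>f\<in>S. \<exists>a. z f * evX b = evX a)"
  using assms
proof (induction S rule: finite_induct)
  case empty
  show ?case using one_nonzero_G by blast
next
  case (insert f S)
  then obtain b where b: "b \<noteq> 0" "\<forall>f\<in>S. \<exists>a. z f * evX b = evX a" by blast
  obtain a' b' where f: "b' \<noteq> 0" "z f = XH.frac a' b'" using frac_exists by metis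
  show ?case
  proof (rule exI[of _ "b * b'"], intro conjI ballI)
    show "b * b' \<noteq> 0" by (rule XH.mult_nonzero[OF b(1) f(1)])
    fix g assume "g \<in> insert f S"
    then show "\<exists>a. z g * evX (b * b') = evX a"
    proof
      assume "g = f"
      then show ?thesis using XH.frac_cancel_mult(2)[OF f(1), of a' b] f(2) by auto
    next
      assume "g \<in> S"
      then obtain a where "z g * evX b = evX a" using b(2) by blast
      then have "z g * evX (b * b') = evX (a * b')" by (simp add: XH.h_mult mult.assoc[symmetric])
      then show ?thesis by blast
    qed
  qed
qed

text \<open>The trace is the diagonal coefficient of left multiplication on the basis \<open>M f\<close>, \<open>f\<close> a residue.\<close>

lemma diagonal_coefficient:
  assumes w: "w \<in> torus" and g: "g \<in> residues" and eq: "w * M g = (\<Sum>f\<in>residues. \<Phi> (z f) * M f)"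
  shows "\<Phi> (z g) = tr w"
proof -
  obtain b where b: "b \<noteq> 0" "\<forall>f\<in>residues. \<exists>a. z f * evX b = evX a"
    using common_denominator[OF finite_residues] by blast
  then obtain a where a: "\<And>f. f \<in> residues \<Longrightarrow> z f * evX b = evX (a f)" by metis
  have az: "evN b * \<Phi> (z f) = evN (a f)" if "f \<in> residues" for f
    using arg_cong[OF a[OF that], of \<Phi>] by (simp add: mult.commute[of "z f"] \<Phi>_mult \<Phi>_ev)
  \<comment> \<open>Right multiplication by \<open>M (- g)\<close> moves the term
    \<open>f = g\<close> to exponent 0. The other exponents \<open>f - g\<close> are not multiples
    of \<open>l\<close>, so the trace picks out a single coefficient.\<close>
  have "evN b * w = evN b * (w * M g) * M (- g)"
    by (simp add: M_uminus mult.assoc M_nonzero)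
  also have "\<dots> = (\<Sum>f\<in>residues. evN (a f) * (M f * M (- g)))"
    by (simp add: eq sum_distrib_left sum_distrib_right mult.assoc[symmetric] az)
  finally have "tr (evN b * w) = (\<Sum>f\<in>residues. tr (evN (a f) * (M f * M (- g))))"
    using subsetD[OF central_torus_subset evN_central]
    by (simp only:) (subst proj_sum, auto intro!: torus_mult M_in_torus)
  also have "\<dots> = (\<Sum>f\<in>residues. if f = g then evN (a g) else 0)"
  proof (intro sum.cong refl)
    fix f assume f: "f \<in> residues"
    have "tr (M f * M (- g)) = (if f = g then 1 else 0)"
    proof (cases "f = g")
      case True
      then have "M f * M (- g) = M 0" by (simp add: M_uminus M_nonzero)
      then show ?thesis using True proj_M[of "dvd_vec l" 0] by simp
    next
      case False
      then have "\<not> dvd_vec l (f + - g)" using residues_cong[OF f g] by auto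
      then show ?thesis using False by (simp add: M_mult proj_scale proj_M)
    qed
    then show "tr (evN (a f) * (M f * M (- g))) = (if f = g then evN (a g) else 0)"
      by (simp add: tr_central_mult[OF evN_central] torus_mult)
  qed
  also have "\<dots> = evN b * \<Phi> (z g)" using g az[OF g] by (simp add: finite_residues)
  finally have "evN b * tr w = evN b * \<Phi> (z g)"
    by (simp add: tr_central_mult[OF evN_central w])
  then show ?thesis using b(1) by (simp add: NH.h_eq_0_iff)
qed

text \<open>The matrix entries come from the classical field through \<open>\<Phi>\<close>. Each
  diagonal entry by itself equals \<open>tr w\<close>, so the matrix trace is
  \<open>card residues\<close> times \<open>tr w\<close>.\<close>

lemma trace_algebra_torus:
  "\<exists>e. trace_algebra sc torus tr \<Phi> e (card residues)"
proof -
  obtain en where en: "bij_betw en {0..<card residues} residues"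
    using ex_bij_betw_nat_finite[OF finite_residues] by blast
  then have en': "bij_betw en {..<card residues} residues" by (simp add: atLeast0LessThan)
  have reindex: "(\<Sum>i<card residues. G (en i)) = (\<Sum>f\<in>residues. G f)" for G :: "int^'n \<Rightarrow> 'd"
    by (rule sum.reindex_bij_betw[OF en'])
  have "0 \<in> residues" using l_pos by (simp add: residues_def)
  have "trace_algebra sc torus tr \<Phi> (\<lambda>i. M (en i)) (card residues)"
  proof unfold_locales
    show "1 \<in> torus" using M_in_torus[of 0] by simp
    show "w + w' \<in> torus" if "w \<in> torus" "w' \<in> torus" for w w' using that by (rule span_add)
    show "w * w' \<in> torus" if "w \<in> torus" "w' \<in> torus" for w w' using that by (rule torus_mult)
    show "- w \<in> torus" if "w \<in> torus" for w using that by (rule span_neg)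
    show "w \<in> torus" if "0 < m" "of_nat m * w \<in> torus" for m w
    proof -
      have "sc (inverse (of_nat m)) (of_nat m * w) \<in> torus" using that(2) by (rule span_scale)
      then show ?thesis using that(1) by (simp add: sc_of_nat[symmetric])
    qed
    show "w = 0" if "0 < m" "of_nat m * w = 0" for m and w :: 'd
    proof -
      have "sc (of_nat m) w = 0" using that(2) by (simp add: sc_of_nat)
      then show ?thesis using that(1) by simp
    qed
    show tr_T: "tr w \<in> torus" if "w \<in> torus" for w
      using tr_in_central_torus[OF that] central_torus_subset by blast
    show "tr (w + w') = tr w + tr w'" if "w \<in> torus" "w' \<in> torus" for w w' using that by (rule proj_add)
    show "tr (w * w') = tr (w' * w)" if "w \<in> torus" "w' \<in> torus" for w w' using that by (rule tr_comm)
    show "tr (tr w * w') = tr w * tr w'" if "w \<in> torus" "w' \<in> torus" for w w'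
      using that by (intro tr_central_mult tr_in_central_torus)
    show "tr w * w' = w' * tr w" if "w \<in> torus" "w' \<in> torus" for w w'
      using that by (intro central_torus_central tr_in_central_torus)
    show "\<Phi> (a + b) = \<Phi> a + \<Phi> b" "\<Phi> (a * b) = \<Phi> a * \<Phi> b" "\<Phi> 1 = 1" for a b
      by (rule \<Phi>_add \<Phi>_mult \<Phi>_1)+
    show "\<Phi> a * w = w * \<Phi> a" if "w \<in> torus" for w a using that by (rule \<Phi>_central)
    obtain i where "i < card residues" "en i = 0"
      using en' \<open>0 \<in> residues\<close> by (auto simp: bij_betw_def image_iff) (metis lessThan_iff image_iff)
    then show "1 \<in> (\<lambda>i. M (en i)) ` {..<card residues}"
      by (auto intro!: image_eqI[of _ _ i])
    show "sc c w \<in> torus" if "w \<in> torus" for c w using that by (rule span_scale)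
    show "tr (sc c w) = sc c (tr w)" if "w \<in> torus" for c w using that by (rule proj_scale)
  next
    fix w assume w: "w \<in> torus"
    have "\<exists>z. w * M (en j) = (\<Sum>f\<in>residues. \<Phi> (z f) * M f)" for j
      by (rule torus_expand) (simp add: torus_mult w)
    then obtain z where z: "\<And>j. w * M (en j) = (\<Sum>f\<in>residues. \<Phi> (z j f) * M f)" by metis
    show "\<exists>z. \<forall>j<card residues. w * M (en j) = (\<Sum>i<card residues. \<Phi> (z i j) * M (en i))"
      by (rule exI[of _ "\<lambda>i j. z j (en i)"])
        (simp add: z reindex[of "\<lambda>f. \<Phi> (z _ f) * M f"])
  next
    fix w z
    assume w: "w \<in> torus" and eq: "\<And>j. j < card residues \<Longrightarrow>
      w * M (en j) = (\<Sum>i<card residues. \<Phi> (z i j) * M (en i))"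
    have "\<Phi> (z j j) = tr w" if j: "j < card residues" for j
    proof -
      define inv_en where "inv_en = inv_into {..<card residues} en"
      have inv: "inv_en (en i) = i" if "i < card residues" for i
        using en' that by (simp add: inv_en_def bij_betw_def inv_into_f_f)
      have "w * M (en j) = (\<Sum>i<card residues. \<Phi> (z (inv_en (en i)) j) * M (en i))"
        unfolding eq[OF j] by (intro sum.cong) (auto simp: inv)
      also have "\<dots> = (\<Sum>f\<in>residues. \<Phi> (z (inv_en f) j) * M f)"
        by (rule reindex[of "\<lambda>f. \<Phi> (z (inv_en f) j) * M f"])
      finally have "\<Phi> (z (inv_en (en j)) j) = tr w"
        using en' j by (intro diagonal_coefficient[OF w]) (auto simp: bij_betw_def)
      then show ?thesis by (simp add: inv[OF j])
    qed
    then show "(\<Sum>i<card residues. \<Phi> (z i i)) = of_nat (card residues) * tr w" by simp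
  qed
  then show ?thesis by blast
qed

end

section \<open>Comparison of classical and quantum seeds\<close>

context div_algebra
begin

text \<open>The counterpart, inside the quantum torus, of the mixed Laurent ring of the matching
  classical seed.\<close>

definition power_span :: "nat \<Rightarrow> 'n::finite set \<Rightarrow> (int^'n \<Rightarrow> 'd) \<Rightarrow> 'd set" where
  "power_span l U M = span {M (int l *s f) | f. \<forall>j. j \<notin> U \<longrightarrow> 0 \<le> f$j}"

lemma power_span_subset: "power_span l U M \<subseteq> mixed_quantum_torus sc U M"
  unfolding power_span_def mixed_quantum_torus_def by (rule span_mono) auto

lemma power_span_eq:
  assumes "0 < l"
  shows "power_span l U M = span {M f | f. (\<forall>j. j \<notin> U \<longrightarrow> 0 \<le> f$j) \<and> dvd_vec l f}"
proof -
  have "{M (int l *s f) | f. \<forall>j. j \<notin> U \<longrightarrow> 0 \<le> f$j} = {M f | f. (\<forall>j. j \<notin> U \<longrightarrow> 0 \<le> f$j) \<and> dvd_vec l f}"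
    (is "?A = ?B")
  proof
    show "?A \<subseteq> ?B"
    proof
      fix z assume "z \<in> ?A"
      then obtain f where "z = M (int l *s f)" "\<And>j. j \<notin> U \<Longrightarrow> 0 \<le> f$j" by blast
      then show "z \<in> ?B" by (intro CollectI exI[of _ "int l *s f"]) (auto simp: dvd_vec_scale)
    qed
    show "?B \<subseteq> ?A"
    proof
      fix z assume "z \<in> ?B"
      then obtain f where f: "z = M f" "\<And>j. j \<notin> U \<Longrightarrow> 0 \<le> f$j" "dvd_vec l f" by blast
      obtain g where g: "f = int l *s g" using f(3) by (rule dvd_vecE)
      have "0 \<le> g$j" if "j \<notin> U" for j
        using f(2)[OF that] assms by (simp add: g zero_le_mult_iff)
      then show "z \<in> ?A" using f(1) g by blast
    qed
  qed
  then show ?thesis by (simp add: power_span_def)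
qed

end

context central_field
begin

definition corresponds :: "('n \<Rightarrow> 'f) \<Rightarrow> (int^'n \<Rightarrow> 'd) \<Rightarrow> bool" where
  "corresponds x' M' \<longleftrightarrow> (\<forall>i. \<Phi> (x' i) = M' (int l *s axis i 1))"

lemma corresponds_nonzero:
  assumes "corresponds x' M'" "frame sc q l L' M'"
  shows "x' i \<noteq> 0"
proof -
  interpret F': frame sc q l L' M' by (rule assms(2))
  show ?thesis
    using assms(1) F'.M_nonzero \<Phi>_eq_0_iff by (metis corresponds_def)
qed

lemma \<Phi>_laurent_monomial:
  assumes c: "corresponds x' M'" and F': "frame sc q l L' M'"
  shows "\<Phi> (laurent_monomial x' f) = M' (int l *s f)"
proof -
  interpret F': frame sc q l L' M' by (rule F')
  \<comment> \<open>This instance supplies the rules for the monomials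
    \<open>M' (int l *s f)\<close>; the embedding \<open>\<Phi>\<close> remains the one built from
    the initial frame.\<close>
  interpret C: central_field sc q l L' M' scF x
    using independent generating by unfold_locales
  note nz = corresponds_nonzero[OF c F']
  have axis: "\<Phi> (laurent_monomial x' (axis i 1)) = M' (int l *s axis i 1)" for i
    using c by (simp add: corresponds_def)
  show ?thesis
  proof (induction f rule: int_vec_induct[where U = UNIV and V = UNIV])
    case zero
    show ?case using C.N_0 by (simp add: \<Phi>_1)
  next
    case (add f i)
    then show ?case
      by (simp only: laurent_monomial_add[OF nz] \<Phi>_mult axis C.N_mult[symmetric])
  next
    case (diff f i)
    have "\<Phi> (laurent_monomial x' (f + - axis i 1)) = M' (int l *s f) * inverse (M' (int l *s axis i 1))"
      by (simp only: laurent_monomial_add[OF nz] \<Phi>_mult diff laurent_monomial_uminus \<Phi>_inverse axis)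
    also have "\<dots> = M' (int l *s (f + - axis i 1))"
      by (simp only: C.N_uminus[symmetric] C.N_mult)
    finally show ?case by simp
  qed auto
qed

text \<open>The ring is generated by the variables and the admissible inverses, the span by the
  corresponding monomials, and \<open>\<Phi>\<close> matches the two. The second claim provides
  preimages, through which generators are pulled back later.\<close>

lemma mixed_laurent_ring_iff:
  assumes c: "corresponds x' M'" and F': "frame sc q l L' M'"
  shows "y \<in> mixed_laurent_ring scF U x' \<longleftrightarrow> \<Phi> y \<in> power_span l U M'"
    and "z \<in> power_span l U M' \<Longrightarrow> z \<in> range \<Phi>"
proof -
  interpret F': frame sc q l L' M' by (rule F')
  interpret C: central_field sc q l L' M' scF x
    using independent generating by unfold_locales
  let ?R = "mixed_laurent_ring scF U x'" and ?Z = "power_span l U M'"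
  have R: "is_subalgebra scF ?R" unfolding mixed_laurent_ring_def by (rule is_subalgebra_hull)
  have Z_gen: "M' (int l *s f) \<in> ?Z" if "\<And>j. j \<notin> U \<Longrightarrow> 0 \<le> f$j" for f
    unfolding power_span_def using that by (intro span_base) blast
  have Z_mult: "z * z' \<in> ?Z" if "z \<in> ?Z" "z' \<in> ?Z" for z z'
    unfolding power_span_def
  proof (rule span_mult_closed[OF _ that[unfolded power_span_def]])
    fix a b assume "a \<in> {M' (int l *s f) | f. \<forall>j. j \<notin> U \<longrightarrow> 0 \<le> f$j}"
      "b \<in> {M' (int l *s f) | f. \<forall>j. j \<notin> U \<longrightarrow> 0 \<le> f$j}"
    then obtain f g where "a = M' (int l *s f)" "b = M' (int l *s g)"
      "\<And>j. j \<notin> U \<Longrightarrow> 0 \<le> f$j" "\<And>j. j \<notin> U \<Longrightarrow> 0 \<le> g$j" by blast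
    then show "a * b \<in> span {M' (int l *s f) | f. \<forall>j. j \<notin> U \<longrightarrow> 0 \<le> f$j}"
      using Z_gen[of "f + g"] by (simp add: C.N_mult power_span_def)
  qed
  have Z_subspace: "subspace ?Z" unfolding power_span_def by (rule subspace_span)
  have "?R \<subseteq> {y. \<Phi> y \<in> ?Z}"
    unfolding mixed_laurent_ring_def
  proof (rule hull_minimal)
    show "is_subalgebra scF {y. \<Phi> y \<in> ?Z}"
      unfolding is_subalgebra_def
    proof (intro conjI ballI allI)
      show "1 \<in> {y. \<Phi> y \<in> ?Z}" using Z_gen[of 0] C.N_0 by (simp add: \<Phi>_1)
    qed (auto simp: \<Phi>_add \<Phi>_mult \<Phi>_scale
        intro: Z_mult subspace_add[OF Z_subspace] subspace_scale[OF Z_subspace])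
    have "\<Phi> (x' i) \<in> ?Z" for i
      using c Z_gen[of "axis i 1"] by (simp add: corresponds_def axis_def)
    moreover have "\<Phi> (inverse (x' i)) \<in> ?Z" if "i \<in> U" for i
    proof -
      have "M' (int l *s (- axis i 1)) \<in> ?Z" using that by (intro Z_gen) (auto simp: axis_def)
      then show ?thesis using c by (simp add: corresponds_def \<Phi>_inverse C.N_uminus)
    qed
    ultimately show "range x' \<union> (\<lambda>i. inverse (x' i)) ` U \<subseteq> {y. \<Phi> y \<in> ?Z}" by auto
  qed
  moreover have Z_R: "z \<in> \<Phi> ` ?R" if "z \<in> ?Z" for z
    using that unfolding power_span_def
  proof (induction rule: span_induct_alt)
    case base
    have "0 \<in> ?R" using F.subalgebra_subspace[OF R] by (rule F.subspace_0)
    then show ?case using \<Phi>_0 by (metis imageI)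
  next
    case (step a u w)
    then obtain f y where f: "u = M' (int l *s f)" "\<And>j. j \<notin> U \<Longrightarrow> 0 \<le> f$j" and y: "y \<in> ?R" "w = \<Phi> y"
      by blast
    have "sc a u + w = \<Phi> (scF a (laurent_monomial x' f) + y)"
      by (simp add: f(1) y(2) \<Phi>_add \<Phi>_scale \<Phi>_laurent_monomial[OF c F'])
    moreover have "laurent_monomial x' f \<in> ?R"
      by (rule mixed_laurent_ring_monomial[OF F.algebra_over_axioms f(2)])
    ultimately show ?case using is_subalgebraD[OF R] y(1) by (metis imageI)
  qed
  ultimately show "y \<in> ?R \<longleftrightarrow> \<Phi> y \<in> ?Z" using \<Phi>_inj by blast
  show "z \<in> ?Z \<Longrightarrow> z \<in> range \<Phi>" using Z_R by blast
qed

text \<open>In direction \<open>k\<close> the Frobenius identity for \<open>y ^ l\<close> is the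
  image under \<open>\<Phi>\<close> of the classical exchange relation; the other variables do not
  change.\<close>

lemma corresponds_mutation:
  assumes c: "corresponds x' M1" and pair: "frame_mutation_pair sc q l L1 M1 B1 k dk L2 M2"
  shows "corresponds (mutate_cluster k B1 x') M2"
proof -
  interpret P: frame_mutation_pair sc q l L1 M1 B1 k dk L2 M2 by (rule pair)
  note nz = corresponds_nonzero[OF c P.frame_axioms]
  show ?thesis
    unfolding corresponds_def
  proof
    fix i
    show "\<Phi> (mutate_cluster k B1 x' i) = M2 (int l *s axis i 1)"
    proof (cases "i = k")
      case True
      show ?thesis
        unfolding True mutate_cluster_eq[OF nz] \<Phi>_add
          \<Phi>_laurent_monomial[OF c P.frame_axioms] P.M2_frobenius mutation_vec_def P.v_def
        by (rule refl)
    next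
      case False
      then have "mutate_cluster k B1 x' i = x' i" by (simp add: mutate_cluster_def)
      then show ?thesis
        using c False P.M2_axis[OF False]
        by (simp add: corresponds_def P.M_power[symmetric] P.N.M_power[symmetric])
    qed
  qed
qed

end

section \<open>Matching classical and quantum mutation sequences\<close>

locale quantum_and_classical = root_of_unity_algebra sc q l ex d + F: div_algebra scF
  for sc :: "'k::field_char_0 \<Rightarrow> 'd::division_ring \<Rightarrow> 'd" and q l
    and ex :: "'n::finite set" and d and scF :: "'k \<Rightarrow> 'f::field \<Rightarrow> 'f" +
  fixes M :: "int^'n \<Rightarrow> 'd" and B :: "int^'n^'n" and x :: "'n \<Rightarrow> 'f" and L
  assumes seed: "quantum_seed sc q l ex d (M, B)" and toric_M: "toric_frame sc q l L M"
    and x_independent: "algebraically_independent scF x"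
    and x_generating: "is_intermediate_field scF hull (range x) = UNIV"
begin

sublocale central_field sc q l L M scF x
  using frameI[OF toric_M] x_independent x_generating F.div_algebra_axioms
  by (simp add: central_field_def central_field_axioms_def)

lemma corresponds_step:
  assumes "quantum_seed sc q l ex d (M1, B1)" "corresponds x1 M1" "k \<in> ex"
    "frame_mutation sc q l k B1 M1 M2"
  shows "corresponds (mutate_cluster k B1 x1) M2"
  using quantum_mutation[OF assms(1,3,4)] corresponds_mutation[OF assms(2)] by metis

lemma corresponds_initial: "corresponds x M"
  unfolding corresponds_def using \<Phi>_monomial[of "axis _ 1"] by simp

text \<open>This direction rests on the existence of mutated frames. In the converse direction
  nothing comparable arises, as classical mutation is a function.\<close>

lemma quantum_reachable_of_classical:
  assumes "(seed_mutation ex)\<^sup>*\<^sup>* (x, B) (x2, B2)"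
  shows "\<exists>M2. (quantum_seed_mutation sc q l ex)\<^sup>*\<^sup>* (M, B) (M2, B2) \<and> corresponds x2 M2"
proof -
  have "\<exists>M2. (quantum_seed_mutation sc q l ex)\<^sup>*\<^sup>* (M, B) (M2, snd S) \<and> corresponds (fst S) M2"
    if "(seed_mutation ex)\<^sup>*\<^sup>* (x, B) S" for S
    using that
  proof (induction rule: rtranclp_induct)
    case base
    then show ?case using corresponds_initial by auto
  next
    case (step S S')
    obtain x1 B1 where S: "S = (x1, B1)" by (metis surj_pair)
    obtain M1 where M1: "(quantum_seed_mutation sc q l ex)\<^sup>*\<^sup>* (M, B) (M1, B1)" "corresponds x1 M1"
      using step.IH by (auto simp: S)
    obtain k where k: "k \<in> ex" "S' = (mutate_cluster k B1 x1, mutate_matrix k B1)"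
      using step(2) by (cases S') (auto simp: S seed_mutation_def)
    note seed1 = quantum_seed_reachable[OF seed M1(1)]
    obtain M2 where M2: "frame_mutation sc q l k B1 M1 M2"
      using quantum_mutation_exists[OF seed1 k(1)] by blast
    then have "quantum_seed_mutation sc q l ex (M1, B1) (M2, mutate_matrix k B1)"
      using k(1) by (auto simp: quantum_seed_mutation_def)
    with M1(1) have "(quantum_seed_mutation sc q l ex)\<^sup>*\<^sup>* (M, B) (M2, mutate_matrix k B1)"
      by (rule rtranclp.rtrancl_into_rtrancl)
    then show ?case using corresponds_step[OF seed1 M1(2) k(1) M2] k(2) by auto
  qed
  from this[OF assms] show ?thesis by simp
qed

lemma classical_reachable_of_quantum:
  assumes "(quantum_seed_mutation sc q l ex)\<^sup>*\<^sup>* (M, B) (M2, B2)"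
  shows "\<exists>x2. (seed_mutation ex)\<^sup>*\<^sup>* (x, B) (x2, B2) \<and> corresponds x2 M2"
proof -
  have "\<exists>x2. (seed_mutation ex)\<^sup>*\<^sup>* (x, B) (x2, snd S) \<and> corresponds x2 (fst S)"
    if "(quantum_seed_mutation sc q l ex)\<^sup>*\<^sup>* (M, B) S" for S
    using that
  proof (induction rule: rtranclp_induct)
    case base
    then show ?case using corresponds_initial by auto
  next
    case (step S S')
    obtain M1 B1 where S: "S = (M1, B1)" by (metis surj_pair)
    obtain x1 where x1: "(seed_mutation ex)\<^sup>*\<^sup>* (x, B) (x1, B1)" "corresponds x1 M1"
      using step.IH by (auto simp: S)
    obtain k M2 where k: "k \<in> ex" "frame_mutation sc q l k B1 M1 M2" "S' = (M2, mutate_matrix k B1)"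
      using step(2) by (cases S') (auto simp: S quantum_seed_mutation_def)
    have seed1: "quantum_seed sc q l ex d (M1, B1)"
      using quantum_seed_reachable[OF seed] step(1) S by simp
    have "seed_mutation ex (x1, B1) (mutate_cluster k B1 x1, mutate_matrix k B1)"
      using k(1) by (auto simp: seed_mutation_def)
    with x1(1) have "(seed_mutation ex)\<^sup>*\<^sup>* (x, B) (mutate_cluster k B1 x1, mutate_matrix k B1)"
      by (rule rtranclp.rtrancl_into_rtrancl)
    then show ?case using corresponds_step[OF seed1 x1(2) k(1,2)] k(3) by auto
  qed
  from this[OF assms] show ?thesis by simp
qed

text \<open>Forward, \<open>\<Phi> y\<close> lies in the \<open>power_span\<close> of every
  reachable frame, hence in the quantum algebra, and it is its own trace because only exponents
  divisible by \<open>l\<close> occur. Backward, the trace of \<open>a\<close> is computed in the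
  frame matched with a given classical seed, where the projection lands in
  \<open>power_span\<close>.\<close>

lemma upper_cluster_algebra_iff:
  "y \<in> upper_cluster_algebra scF ex invt x B \<longleftrightarrow>
     \<Phi> y \<in> tr ` upper_quantum_cluster_algebra sc q l ex invt M B"
proof
  assume y: "y \<in> upper_cluster_algebra scF ex invt x B"
  have Z: "\<Phi> y \<in> power_span l (ex \<union> invt) M2"
    if reach: "(quantum_seed_mutation sc q l ex)\<^sup>*\<^sup>* (M, B) (M2, B2)" for M2 B2
  proof -
    obtain L2 where "toric_frame sc q l L2 M2"
      using quantum_seed_reachable[OF seed reach] by (auto simp: quantum_seed_iff)
    then have F2: "frame sc q l L2 M2" by (rule frameI)
    obtain x2 where x2: "(seed_mutation ex)\<^sup>*\<^sup>* (x, B) (x2, B2)" "corresponds x2 M2"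
      using classical_reachable_of_quantum[OF reach] by blast
    have "y \<in> mixed_laurent_ring scF (ex \<union> invt) x2"
      using y x2(1) by (auto simp: upper_cluster_algebra_def)
    then show ?thesis by (simp add: mixed_laurent_ring_iff(1)[OF x2(2) F2])
  qed
  have "\<Phi> y \<in> upper_quantum_cluster_algebra sc q l ex invt M B"
    unfolding upper_quantum_cluster_algebra_def
    using Z power_span_subset by blast
  moreover have "\<Phi> y = tr (\<Phi> y)"
    using Z[of M B] proj_id[where Q = "dvd_vec l"] unfolding power_span_eq[OF l_pos] by auto
  ultimately show "\<Phi> y \<in> tr ` upper_quantum_cluster_algebra sc q l ex invt M B" by (rule rev_image_eqI)
next
  assume "\<Phi> y \<in> tr ` upper_quantum_cluster_algebra sc q l ex invt M B"
  then obtain a where a: "a \<in> upper_quantum_cluster_algebra sc q l ex invt M B" "\<Phi> y = tr a" by auto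
  show "y \<in> upper_cluster_algebra scF ex invt x B"
    unfolding upper_cluster_algebra_def
  proof safe
    fix x2 B2 assume "(seed_mutation ex)\<^sup>*\<^sup>* (x, B) (x2, B2)"
    then obtain M2 where M2: "(quantum_seed_mutation sc q l ex)\<^sup>*\<^sup>* (M, B) (M2, B2)" "corresponds x2 M2"
      using quantum_reachable_of_classical by blast
    obtain L2 where "toric_frame sc q l L2 M2"
      using quantum_seed_reachable[OF seed M2(1)] by (auto simp: quantum_seed_iff)
    then have F2: "frame sc q l L2 M2" by (rule frameI)
    interpret F2: frame sc q l L2 M2 by (rule F2)
    have "\<Phi> y = F2.tr a"
      using frame_tr_mutation_invariant(2)[OF seed M2(1) a(1)] a(2) by (simp add: frame_tr_def)
    also have "\<dots> \<in> power_span l (ex \<union> invt) M2"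
      unfolding power_span_eq[OF l_pos]
      by (rule F2.proj_in_span) (use upper_quantum_subset[OF M2(1) a(1)] in \<open>simp add: mixed_quantum_torus_eq\<close>)
    finally show "y \<in> mixed_laurent_ring scF (ex \<union> invt) x2"
      by (simp add: mixed_laurent_ring_iff(1)[OF M2(2) F2])
  qed
qed

lemma upper_quantum_traces_in_range:
  "tr ` upper_quantum_cluster_algebra sc q l ex invt M B \<subseteq> range \<Phi>"
proof
  fix z assume "z \<in> tr ` upper_quantum_cluster_algebra sc q l ex invt M B"
  then obtain a where a: "a \<in> upper_quantum_cluster_algebra sc q l ex invt M B" "z = tr a" by auto
  have "tr a \<in> power_span l (ex \<union> invt) M"
    unfolding power_span_eq[OF l_pos]
    by (rule proj_in_span) (use upper_quantum_subset[OF rtranclp.rtrancl_refl a(1)] in \<open>simp add: mixed_quantum_torus_eq\<close>)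
  then show "z \<in> range \<Phi>"
    using mixed_laurent_ring_iff(2)[OF corresponds_initial frame_axioms] a(2) by blast
qed

lemma upper_cluster_algebra_subalgebra:
  "is_subalgebra scF (upper_cluster_algebra scF ex invt x B)"
proof -
  have R: "is_subalgebra scF (mixed_laurent_ring scF (ex \<union> invt) y)" for y
    unfolding mixed_laurent_ring_def by (rule is_subalgebra_hull)
  have mem: "y \<in> upper_cluster_algebra scF ex invt x B \<longleftrightarrow>
      (\<forall>x2 B2. (seed_mutation ex)\<^sup>*\<^sup>* (x, B) (x2, B2) \<longrightarrow> y \<in> mixed_laurent_ring scF (ex \<union> invt) x2)" for y
    by (auto simp: upper_cluster_algebra_def)
  show ?thesis
    unfolding is_subalgebra_def
  proof (intro conjI ballI allI)
    fix y z c
    assume y: "y \<in> upper_cluster_algebra scF ex invt x B"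
    show "scF c y \<in> upper_cluster_algebra scF ex invt x B"
      unfolding mem using y[unfolded mem] by (blast intro: is_subalgebraD(4)[OF R])
    assume z: "z \<in> upper_cluster_algebra scF ex invt x B"
    show "y + z \<in> upper_cluster_algebra scF ex invt x B"
      unfolding mem using y[unfolded mem] z[unfolded mem] by (blast intro: is_subalgebraD(2)[OF R])
    show "y * z \<in> upper_cluster_algebra scF ex invt x B"
      unfolding mem using y[unfolded mem] z[unfolded mem] by (blast intro: is_subalgebraD(3)[OF R])
  qed (simp add: mem is_subalgebraD(1)[OF R])
qed

theorem finitely_generated_upper_cluster_algebra:
  assumes fg: "finitely_generated_algebra sc (upper_quantum_cluster_algebra sc q l ex invt M B)"
  shows "finitely_generated_algebra scF (upper_cluster_algebra scF ex invt x B)"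
proof -
  let ?A = "upper_quantum_cluster_algebra sc q l ex invt M B"
  let ?U = "upper_cluster_algebra scF ex invt x B"
  obtain e where "trace_algebra sc torus tr \<Phi> e (card residues)"
    using trace_algebra_torus by blast
  then interpret TA: trace_algebra sc torus tr \<Phi> e "card residues" .
  have "?A \<subseteq> torus"
  proof
    fix a assume "a \<in> ?A"
    from upper_quantum_subset[OF rtranclp.rtrancl_refl this] show "a \<in> torus"
      unfolding mixed_quantum_torus_eq by (rule subsetD[OF span_subset_torus])
  qed
  moreover have "tr ` ?A \<subseteq> ?A"
    using frame_tr_in_upper_quantum[OF seed] by (auto simp: frame_tr_def)
  ultimately have "finitely_generated_algebra sc (tr ` ?A)"
    by (rule TA.finitely_generated_traces[OF fg])
  then obtain S where S: "finite S" "is_subalgebra sc hull S = tr ` ?A"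
    by (auto simp: finitely_generated_algebra_def)
  \<comment> \<open>The generators of the trace ring are images of classical elements, so they can
    be pulled back along the injective \<open>\<Phi>\<close>.\<close>
  have "S \<subseteq> range \<Phi>"
    using hull_subset[of S "is_subalgebra sc"] S(2) upper_quantum_traces_in_range by blast
  then obtain S' where S': "finite S'" "S = \<Phi> ` S'"
    using S(1) by (metis finite_subset_image)
  have H: "is_subalgebra scF (is_subalgebra scF hull S')" by (rule is_subalgebra_hull)
  have "is_subalgebra scF hull S' = ?U"
  proof
    have "S' \<subseteq> ?U"
    proof
      fix y assume "y \<in> S'"
      then have "\<Phi> y \<in> tr ` ?A" using S'(2) S(2) hull_subset[of S "is_subalgebra sc"] by blast
      then show "y \<in> ?U" by (simp only: upper_cluster_algebra_iff)
    qed
    then show "is_subalgebra scF hull S' \<subseteq> ?U"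
      by (rule hull_minimal) (rule upper_cluster_algebra_subalgebra)
    have "is_subalgebra sc hull S \<subseteq> \<Phi> ` (is_subalgebra scF hull S')"
    proof (rule hull_minimal)
      show "S \<subseteq> \<Phi> ` (is_subalgebra scF hull S')"
        unfolding S'(2) by (rule image_mono) (rule hull_subset)
      show "is_subalgebra sc (\<Phi> ` (is_subalgebra scF hull S'))"
        unfolding is_subalgebra_def[of sc]
      proof (intro conjI ballI allI)
        show "1 \<in> \<Phi> ` (is_subalgebra scF hull S')"
          using is_subalgebraD(1)[OF H] \<Phi>_1 by (metis imageI)
      next
        fix a b assume "a \<in> \<Phi> ` (is_subalgebra scF hull S')" "b \<in> \<Phi> ` (is_subalgebra scF hull S')"
        then obtain y z where "a = \<Phi> y" "b = \<Phi> z" "y \<in> is_subalgebra scF hull S'" "z \<in> is_subalgebra scF hull S'"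
          by blast
        then show "a + b \<in> \<Phi> ` (is_subalgebra scF hull S')" "a * b \<in> \<Phi> ` (is_subalgebra scF hull S')"
          using is_subalgebraD(2,3)[OF H] by (auto simp: \<Phi>_add[symmetric] \<Phi>_mult[symmetric])
      next
        fix c a assume "a \<in> \<Phi> ` (is_subalgebra scF hull S')"
        then show "sc c a \<in> \<Phi> ` (is_subalgebra scF hull S')"
          using is_subalgebraD(4)[OF H] by (auto simp: \<Phi>_scale[symmetric])
      qed
    qed
    then have sub: "tr ` ?A \<subseteq> \<Phi> ` (is_subalgebra scF hull S')" by (simp only: S(2))
    show "?U \<subseteq> is_subalgebra scF hull S'"
    proof
      fix y assume "y \<in> ?U"
      then have "\<Phi> y \<in> tr ` ?A" by (simp only: upper_cluster_algebra_iff)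
      with sub obtain z where "\<Phi> y = \<Phi> z" "z \<in> is_subalgebra scF hull S'" by auto
      then show "y \<in> is_subalgebra scF hull S'" using \<Phi>_inj by metis
    qed
  qed
  then show ?thesis using S'(1) by (auto simp: finitely_generated_algebra_def)
qed

end

theorem mainTheorem3:
  fixes scD :: "'k::field_char_0 \<Rightarrow> 'd::division_ring \<Rightarrow> 'd"
    and scF :: "'k \<Rightarrow> 'f::field \<Rightarrow> 'f"
    and q :: 'k and l :: nat
    and ex invt :: "'n::finite set"
    and d :: "'n \<Rightarrow> nat"
    and M :: "int^'n \<Rightarrow> 'd"
    and B :: "int^'n^'n"
    and x :: "'n \<Rightarrow> 'f"
  assumes "primitive_root_of_unity l q"
    and "invt \<inter> ex = {}"
    and "algebra_over scD"
    and "quantum_seed scD q l ex d (M, B)"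
    and "odd l"
    and "\<forall>j\<in>ex. coprime l (d j)"
    and "algebra_over scF"
    and "cluster_seed scF ex (x, B)"
    and "finitely_generated_algebra scD (upper_quantum_cluster_algebra scD q l ex invt M B)"
  shows "finitely_generated_algebra scF (upper_cluster_algebra scF ex invt x B)"
proof -
  obtain L where L: "toric_frame scD q l L M" using assms(4) by (auto simp: quantum_seed_iff)
  interpret D: div_algebra scD using assms(3) by (simp add: div_algebra_def)
  interpret F: div_algebra scF using assms(7) by (simp add: div_algebra_def)
  interpret quantum_and_classical scD q l ex d scF M B x L
    using assms L by unfold_locales (auto simp: cluster_seed_def)
  show ?thesis by (rule finitely_generated_upper_cluster_algebra[OF assms(9)])
qed

end
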